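(* Let $f$ be a log-concave probability density supported on $\mathbb{R}^p$ (satisfying the standing assumptions of the context) and let $g_{LAP}$ be its Laplace approximation. Then $$KL(g_{LAP},f)=KL(\boldsymbol e_g,\boldsymbol e_f)+\mathbb{E}_{\boldsymbol e\sim g_{LAP}(\boldsymbol e)}\left[KL(r_g,r_f|\boldsymbol e)\right],$$ and in the asymptote $\Delta_3p^{3/2}\to 0$ the two parts scale as follows. For the radial part, $$KL(r_g,r_f|\boldsymbol e)\le \mathcal{O}\left((\Delta_3)^2p^2\right),$$ $$KL(r_g,r_f|\boldsymbol e)\le\frac{1}{2p^{2/3}}\mathbb{E}_{r\sim g_{LAP}(r)}\left[r^{4/3}\left(\boldsymbol e^T\nabla\tilde\phi_f(r\boldsymbol e)-r\right)^2\right]+\mathcal{O}\left((\Delta_3)^3p^{5/2}\right).$$ For the directional part, $$KL(\boldsymbol e_g,\boldsymbol e_f)=\mathcal{O}\left((\Delta_3)^2p^3\right),$$ $$KL(\boldsymbol e_g,\boldsymbol e_f)=\frac12\mathrm{Var}_{\boldsymbol e\sim g_{LAP}(\boldsymbol e)}\left[\mathbb{E}_{r\sim g_{LAP}(r)}\left[\tilde\phi_f(r\boldsymbol e)-\tfrac12r^2\right]\right]+\mathcal{O}\left((\Delta_3)^3p^{9/2}\right),$$ $$KL(\boldsymbol e_g,\boldsymbol e_f)\le\frac12KL_{var}(g_{LAP},f)+\mathcal{O}\left((\Delta_3)^3p^{9/2}\right).$$ Consequently the reverse KL divergence goes to $0$ as $$KL(g_{LAP},f)=\mathcal{O}\lef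t((\Delta_3)^2p^3\right).$$
   Context: Standing setting. $f(\boldsymbol\theta)=\exp(-\phi_f(\boldsymbol\theta)-\log Z_f)$ is a probability density on $\mathbb{R}^p$ (everywhere positive), with $\phi_f$ strictly convex and three times differentiable. $\boldsymbol\mu=\mathrm{argmin}_{\boldsymbol\theta}\,\phi_f(\boldsymbol\theta)$ and $\Sigma^{-1}=H\phi_f(\boldsymbol\mu)$ (Hessian, assumed positive definite). The Laplace approximation $g_{LAP}$ is the Gaussian density with mean $\boldsymbol\mu$ and covariance $\Sigma$; put $\phi_g(\boldsymbol\theta)=\frac12(\boldsymbol\theta-\boldsymbol\mu)^T\Sigma^{-1}(\boldsymbol\theta-\boldsymbol\mu)$. Standardization: $\tilde{\boldsymbol\theta}=\Sigma^{-1/2}(\boldsymbol\theta-\boldsymbol\mu)$ and $\tilde\phi_f(\tilde{\boldsymbol\theta})=\phi_f(\boldsymbol\mu+\Sigma^{1/2}\tilde{\boldsymbol\theta})$. The regularity scalar, assumed finite, is $$\Delta_3=\max_{\tilde{\boldsymbol\theta},v_1,v_2,v_3}\frac{|\tilde\phi_f^{(3)}(\tilde{\boldsymbol\theta})[v_1,v_2,v_3]|}{\|v_1\|_2\|v_2\|_2\|v_3\|_2}$$ (supremum over $\tilde{\boldsymbol\theta}\in\mathbb{R}^p$ and nonzero $v_i\in\mathbb{R}^p$), where $\tilde\phi_f^{(3)}$ is the third derivative seen as a trilinear form. Spherical coordinates: $\tilde{\boldsymbol\theta}=r\boldsymbol e$ with $r=\|\tilde{\boldsymbol\theta}\|_2\ge0$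 and $\boldsymbol e\in S^{p-1}$ (unit sphere of $\mathbb{R}^p$). Under $g_{LAP}$, $r$ and $\boldsymbol e$ are independent, $r$ is $\chi_p$ (density proportional to $r^{p-1}e^{-r^2/2}$), and $\boldsymbol e$ is uniform on $S^{p-1}$. $g_{LAP}(r)$ and $g_{LAP}(\boldsymbol e)$ denote these laws. $KL(\boldsymbol e_g,\boldsymbol e_f)$ is the KL divergence between the marginal laws of $\boldsymbol e$ under $g_{LAP}$ and $f$; $KL(r_g,r_f|\boldsymbol e)$ is the KL divergence between the law of $r$ under $g_{LAP}$ and the conditional law of $r$ given $\boldsymbol e$ under $f$. $KL(g,f)=\mathbb{E}_{\boldsymbol\theta\sim g}[\log(g(\boldsymbol\theta)/f(\boldsymbol\theta))]$ and $KL_{var}(g,f)=\mathrm{Var}_{\boldsymbol\theta\sim g}[\phi_f(\boldsymbol\theta)-\phi_g(\boldsymbol\theta)]$. Asymptotic convention: the pair $(p,f)$ varies so that the stated quantity tends to $0$; $\mathcal{O}(a)$ denotes a quantity bounded in absolute value by a universal constant times $a$ once that quantity is small enough, uniformly in $\boldsymbol e\in S^{p-1}$. *)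

theory Defs
  imports "HOL-Probability.Probability"
begin

text \<open>
  The constants hidden in the asymptotic notation must not depend on the dimension \<open>p\<close>, so \<open>p\<close>
  is a natural number and not a type: a vector of \<open>\<real>\<^sup>p\<close> is an extensional function on \<open>{..<p}\<close>,
  a \<open>p \<times> p\<close> matrix is a function of two indices, of which only the entries below \<open>p\<close> are used.
  The Euclidean norm of \<open>x\<close> is \<open>L2_set x {..<p}\<close>.
\<close>

type_synonym rvec = "nat \<Rightarrow> real"
type_synonym rmat = "nat \<Rightarrow> nat \<Rightarrow> real"

definition Rn :: "nat \<Rightarrow> rvec set" where
  "Rn p = ({..<p} \<rightarrow>\<^sub>E UNIV)"

definition leb :: "nat \<Rightarrow> rvec measure" where
  "leb p = (\<Pi>\<^sub>M i\<in>{..<p}. lborel)"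

definition vnorm :: "nat \<Rightarrow> rvec \<Rightarrow> real" where
  "vnorm p x = L2_set x {..<p}"

definition vdot :: "nat \<Rightarrow> rvec \<Rightarrow> rvec \<Rightarrow> real" where
  "vdot p x y = (\<Sum>i<p. x i * y i)"

definition vadd :: "nat \<Rightarrow> rvec \<Rightarrow> rvec \<Rightarrow> rvec" where
  "vadd p x y = (\<lambda>i\<in>{..<p}. x i + y i)"

definition vsub :: "nat \<Rightarrow> rvec \<Rightarrow> rvec \<Rightarrow> rvec" where
  "vsub p x y = (\<lambda>i\<in>{..<p}. x i - y i)"

definition vscale :: "nat \<Rightarrow> real \<Rightarrow> rvec \<Rightarrow> rvec" where
  "vscale p c x = (\<lambda>i\<in>{..<p}. c * x i)"

definition mvec :: "nat \<Rightarrow> rmat \<Rightarrow> rvec \<Rightarrow> rvec" where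
  "mvec p A x = (\<lambda>i\<in>{..<p}. \<Sum>j<p. A i j * x j)"

definition mprod_eq :: "nat \<Rightarrow> rmat \<Rightarrow> rmat \<Rightarrow> rmat \<Rightarrow> bool" where
  "mprod_eq p A B C \<longleftrightarrow> (\<forall>i<p. \<forall>j<p. (\<Sum>k<p. A i k * B k j) = C i j)"

definition minverse :: "nat \<Rightarrow> rmat \<Rightarrow> rmat \<Rightarrow> bool" where
  "minverse p A B \<longleftrightarrow>
     mprod_eq p A B (\<lambda>i j. of_bool (i = j)) \<and> mprod_eq p B A (\<lambda>i j. of_bool (i = j))"

definition pos_def :: "nat \<Rightarrow> rmat \<Rightarrow> bool" where
  "pos_def p A \<longleftrightarrow> (\<forall>i<p. \<forall>j<p. A i j = A j i) \<and>
     (\<forall>v\<in>Rn p. vnorm p v \<noteq> 0 \<longrightarrow> 0 < vdot p v (mvec p A v))"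

definition partial :: "nat \<Rightarrow> (rvec \<Rightarrow> real) \<Rightarrow> rvec \<Rightarrow> real" where
  "partial i \<phi> x = deriv (\<lambda>t. \<phi> (x(i := t))) (x i)"

definition grad :: "nat \<Rightarrow> (rvec \<Rightarrow> real) \<Rightarrow> rvec \<Rightarrow> rvec" where
  "grad p \<phi> x = (\<lambda>i\<in>{..<p}. partial i \<phi> x)"

definition hess :: "(rvec \<Rightarrow> real) \<Rightarrow> rvec \<Rightarrow> rmat" where
  "hess \<phi> x = (\<lambda>i j. partial i (partial j \<phi>) x)"

definition third_deriv :: "nat \<Rightarrow> (rvec \<Rightarrow> real) \<Rightarrow> rvec \<Rightarrow> rvec \<Rightarrow> rvec \<Rightarrow> rvec \<Rightarrow> real" where
  "third_deriv p \<phi> x u v w =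
     (\<Sum>i<p. \<Sum>j<p. \<Sum>k<p. partial i (partial j (partial k \<phi>)) x * u i * v j * w k)"

text \<open>Frechet differentiability at a point of \<open>\<real>\<^sup>p\<close>, in the form of \<open>has_derivative_within_alt\<close>.\<close>

definition frechet_differentiable :: "nat \<Rightarrow> (rvec \<Rightarrow> real) \<Rightarrow> rvec \<Rightarrow> bool" where
  "frechet_differentiable p \<phi> x \<longleftrightarrow>
     (\<exists>d\<in>Rn p. \<forall>\<epsilon>>0. \<exists>\<delta>>0. \<forall>y\<in>Rn p. vnorm p (vsub p y x) < \<delta> \<longrightarrow>
        \<bar>\<phi> y - \<phi> x - vdot p d (vsub p y x)\<bar> \<le> \<epsilon> * vnorm p (vsub p y x))"

text \<open>
  A function is \<open>k + 1\<close> times differentiable iff it is differentiable and its derivative, here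
  represented by the partial derivatives, is \<open>k\<close> times differentiable.
\<close>

fun times_differentiable :: "nat \<Rightarrow> nat \<Rightarrow> (rvec \<Rightarrow> real) \<Rightarrow> bool" where
  "times_differentiable p 0 \<phi> \<longleftrightarrow> True"
| "times_differentiable p (Suc k) \<phi> \<longleftrightarrow>
     (\<forall>x\<in>Rn p. frechet_differentiable p \<phi> x) \<and>
     (\<forall>i<p. times_differentiable p k (partial i \<phi>))"

definition strictly_convex :: "nat \<Rightarrow> (rvec \<Rightarrow> real) \<Rightarrow> bool" where
  "strictly_convex p \<phi> \<longleftrightarrow>
     (\<forall>x\<in>Rn p. \<forall>y\<in>Rn p. \<forall>t. x \<noteq> y \<and> 0 < t \<and> t < 1 \<longrightarrow>
        \<phi> (vadd p (vscale p (1 - t) x) (vscale p t y)) < (1 - t) * \<phi> x + t * \<phi> y)"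

text \<open>The probability density \<open>exp (- \<phi> - log Z)\<close> with \<open>Z = \<integral> exp (- \<phi>)\<close>, as a measure.\<close>

definition gibbs :: "nat \<Rightarrow> (rvec \<Rightarrow> real) \<Rightarrow> rvec measure" where
  "gibbs p \<phi> = density (leb p) (\<lambda>x. ennreal (exp (- \<phi> x - ln (\<integral>y. exp (- \<phi> y) \<partial>leb p))))"

definition phi_g :: "nat \<Rightarrow> (rvec \<Rightarrow> real) \<Rightarrow> rvec \<Rightarrow> rvec \<Rightarrow> real" where
  "phi_g p \<phi> \<mu> x = 1/2 * vdot p (vsub p x \<mu>) (mvec p (hess \<phi> \<mu>) (vsub p x \<mu>))"

text \<open>The Gaussian of mean \<open>\<mu>\<close> and precision matrix \<open>hess \<phi> \<mu>\<close>, i.e. the density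
  proportional to \<open>exp (- phi_g)\<close>.\<close>

definition laplace_approx :: "nat \<Rightarrow> (rvec \<Rightarrow> real) \<Rightarrow> rvec \<Rightarrow> rvec measure" where
  "laplace_approx p \<phi> \<mu> = gibbs p (phi_g p \<phi> \<mu>)"

text \<open>\<open>S\<close> stands for the square root of the covariance and \<open>W\<close> for its inverse.\<close>

definition standardize :: "nat \<Rightarrow> rvec \<Rightarrow> rmat \<Rightarrow> rvec \<Rightarrow> rvec" where
  "standardize p \<mu> W x = mvec p W (vsub p x \<mu>)"

definition phi_std :: "nat \<Rightarrow> (rvec \<Rightarrow> real) \<Rightarrow> rvec \<Rightarrow> rmat \<Rightarrow> rvec \<Rightarrow> real" where
  "phi_std p \<phi> \<mu> S x = \<phi> (vadd p \<mu> (mvec p S x))"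

definition Delta3_set :: "nat \<Rightarrow> (rvec \<Rightarrow> real) \<Rightarrow> rvec \<Rightarrow> rmat \<Rightarrow> real set" where
  "Delta3_set p \<phi> \<mu> S =
     {\<bar>third_deriv p (phi_std p \<phi> \<mu> S) x u v w\<bar> / (vnorm p u * vnorm p v * vnorm p w) | x u v w.
        x \<in> Rn p \<and> u \<in> Rn p \<and> v \<in> Rn p \<and> w \<in> Rn p \<and>
        vnorm p u \<noteq> 0 \<and> vnorm p v \<noteq> 0 \<and> vnorm p w \<noteq> 0}"

definition Delta3 :: "nat \<Rightarrow> (rvec \<Rightarrow> real) \<Rightarrow> rvec \<Rightarrow> rmat \<Rightarrow> real" where
  "Delta3 p \<phi> \<mu> S = Sup (Delta3_set p \<phi> \<mu> S)"

text \<open>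
  \<open>Cov\<close>, \<open>S\<close> and \<open>W\<close> are the matrices \<open>\<Sigma>\<close>, \<open>\<Sigma>\<^sup>1\<^sup>/\<^sup>2\<close> (the symmetric positive definite root) and
  \<open>\<Sigma>\<^sup>-\<^sup>1\<^sup>/\<^sup>2\<close>; their entries below \<open>p\<close> are determined by \<open>\<phi>\<close> and \<open>\<mu>\<close>.
\<close>

definition laplace_setting ::
  "nat \<Rightarrow> (rvec \<Rightarrow> real) \<Rightarrow> rvec \<Rightarrow> rmat \<Rightarrow> rmat \<Rightarrow> rmat \<Rightarrow> bool" where
  "laplace_setting p \<phi> \<mu> Cov S W \<longleftrightarrow>
     1 \<le> p \<and>
     integrable (leb p) (\<lambda>x. exp (- \<phi> x)) \<and>
     strictly_convex p \<phi> \<and>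
     times_differentiable p 3 \<phi> \<and>
     \<mu> \<in> Rn p \<and> (\<forall>x\<in>Rn p. \<phi> \<mu> \<le> \<phi> x) \<and>
     pos_def p (hess \<phi> \<mu>) \<and>
     minverse p (hess \<phi> \<mu>) Cov \<and>
     pos_def p S \<and> mprod_eq p S S Cov \<and>
     minverse p S W \<and>
     bdd_above (Delta3_set p \<phi> \<mu> S)"

text \<open>The library's \<open>KL_divergence\<close> takes the reference measure first.\<close>

definition KL :: "'a measure \<Rightarrow> 'a measure \<Rightarrow> real" where
  "KL g f = KL_divergence (exp 1) f g"

definition KL_var :: "nat \<Rightarrow> (rvec \<Rightarrow> real) \<Rightarrow> rvec \<Rightarrow> real" where
  "KL_var p \<phi> \<mu> = prob_space.variance (laplace_approx p \<phi> \<mu>) (\<lambda>x. \<phi> x - phi_g p \<phi> \<mu> x)"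

definition unit_sphere :: "nat \<Rightarrow> rvec set" where
  "unit_sphere p = {e \<in> Rn p. vnorm p e = 1}"

text \<open>
  Laws of the standardized direction and radius when the original variable has law \<open>M\<close>. The
  direction is sent to \<open>0\<close> at the origin, which is a null set for the measures considered.
\<close>

definition dir_law :: "nat \<Rightarrow> rvec \<Rightarrow> rmat \<Rightarrow> rvec measure \<Rightarrow> rvec measure" where
  "dir_law p \<mu> W M = distr M (\<Pi>\<^sub>M i\<in>{..<p}. borel)
     (\<lambda>x. vscale p (1 / vnorm p (standardize p \<mu> W x)) (standardize p \<mu> W x))"

definition rad_law :: "nat \<Rightarrow> rvec \<Rightarrow> rmat \<Rightarrow> rvec measure \<Rightarrow> real measure" where
  "rad_law p \<mu> W M = distr M borel (\<lambda>x. vnorm p (standardize p \<mu> W x))"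

text \<open>
  Conditional law of the radius under \<open>gibbs p \<phi>\<close>, given that the standardized direction is \<open>e\<close>.
  Since Lebesgue measure is \<open>r\<^sup>p\<^sup>-\<^sup>1 dr de\<close> in spherical coordinates, the joint density of \<open>(r, e)\<close> is
  proportional to \<open>r\<^sup>p\<^sup>-\<^sup>1 exp (- phi_std (r e))\<close>. This version of the conditional density is
  defined for every \<open>e\<close> of the sphere, not just for almost every \<open>e\<close>.
\<close>

definition rad_weight :: "nat \<Rightarrow> (rvec \<Rightarrow> real) \<Rightarrow> rvec \<Rightarrow> rmat \<Rightarrow> rvec \<Rightarrow> real \<Rightarrow> real" where
  "rad_weight p \<phi> \<mu> S e r =
     indicator {0..} r * r ^ (p - 1) * exp (- phi_std p \<phi> \<mu> S (vscale p r e))"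

definition rad_cond_law :: "nat \<Rightarrow> (rvec \<Rightarrow> real) \<Rightarrow> rvec \<Rightarrow> rmat \<Rightarrow> rvec \<Rightarrow> real measure" where
  "rad_cond_law p \<phi> \<mu> S e =
     density lborel (\<lambda>r. ennreal (rad_weight p \<phi> \<mu> S e r / (\<integral>s. rad_weight p \<phi> \<mu> S e s \<partial>lborel)))"

definition dir_g :: "nat \<Rightarrow> (rvec \<Rightarrow> real) \<Rightarrow> rvec \<Rightarrow> rmat \<Rightarrow> rvec measure" where
  "dir_g p \<phi> \<mu> W = dir_law p \<mu> W (laplace_approx p \<phi> \<mu>)"

definition rad_g :: "nat \<Rightarrow> (rvec \<Rightarrow> real) \<Rightarrow> rvec \<Rightarrow> rmat \<Rightarrow> real measure" where
  "rad_g p \<phi> \<mu> W = rad_law p \<mu> W (laplace_approx p \<phi> \<mu>)"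

definition KL_dir :: "nat \<Rightarrow> (rvec \<Rightarrow> real) \<Rightarrow> rvec \<Rightarrow> rmat \<Rightarrow> real" where
  "KL_dir p \<phi> \<mu> W = KL (dir_g p \<phi> \<mu> W) (dir_law p \<mu> W (gibbs p \<phi>))"

definition KL_rad :: "nat \<Rightarrow> (rvec \<Rightarrow> real) \<Rightarrow> rvec \<Rightarrow> rmat \<Rightarrow> rmat \<Rightarrow> rvec \<Rightarrow> real" where
  "KL_rad p \<phi> \<mu> S W e = KL (rad_g p \<phi> \<mu> W) (rad_cond_law p \<phi> \<mu> S e)"

end

theory Submission
  imports Defs
begin

text \<open>
  After standardization the Laplace approximation is the standard Gaussian, and the potential of
  \<open>f\<close> is \<open>\<bar>x\<bar>\<^sup>2 / 2\<close> plus a constant plus a remainder. In polar coordinates \<open>x = r e\<close> the Gaussian is a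
  product of a chi law and the uniform law of the sphere, so \<open>f\<close> has a density proportional to
  \<open>exp (- \<psi> e r)\<close> with respect to that product, where \<open>\<psi> e\<close> is the remainder along the ray of direction \<open>e\<close>.
  With \<open>A e = E\<^sub>r (\<psi> e r)\<close> and \<open>M e = E\<^sub>r (exp (- \<psi> e r))\<close> the three divergences are
  \<open>E A + ln (E M)\<close> in total, \<open>ln (E M) - E (ln M)\<close> for the direction and \<open>A e + ln (M e)\<close> for the radius,
  and the chain rule is the sum of the last two.

  The minimum is at the origin and the standardized Hessian there is the identity. So \<open>\<psi> e\<close> vanishes
  to second order at \<open>0\<close>, and the bound \<open>D\<close> on the third derivative gives \<open>\<bar>\<psi> e r\<bar> \<le> D r\<^sup>3 / 6\<close>. A cubic bound
  alone does not control \<open>exp (- \<psi> e r)\<close> against a Gaussian. Beyond a multiple of \<open>\<surd>p\<close> the convexity of the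
  potential replaces it by linear growth, and the resulting exponential tail is negligible against the
  chi law. This yields all tilted moments with constants that do not depend on \<open>p\<close>
  (\<open>tilted_expectation_small\<close>).

  For the radius, \<open>A e + ln (M e)\<close> is \<open>ln (E (exp Y))\<close> for the centred variable \<open>Y = A e - \<psi> e r\<close>. Its cubic
  term is split between the square and the fourth power, so that \<open>51/100 E Y\<^sup>2\<close> plus a multiple of
  \<open>E Y\<^sup>4\<close> remains. Since \<open>r\<^sup>2\<close> concentrates at \<open>p\<close>, the fourth moment is \<open>O(D\<^sup>4 p\<^sup>4)\<close> although \<open>\<psi> e r\<close> itself
  is only \<open>O(D p\<^sup>3\<^sup>/\<^sup>2)\<close>. The variance becomes the gradient term through a Poincare inequality for the chi law with
  weight \<open>r\<^sup>4\<^sup>/\<^sup>3\<close> (\<open>chi_poincare\<close>), whose constant is better than needed by the factor \<open>51/50\<close>.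

  For the direction, \<open>M = 1 - A + O(D\<^sup>2 p\<^sup>3)\<close>, and a second order expansion of the logarithm turns
  \<open>ln (E M) - E (ln M)\<close> into half the variance of \<open>A\<close> (\<open>log_partition_expansion\<close>). Averaging over \<open>r\<close> can only lower
  the variance of the remainder, which is the comparison with \<open>KL_var\<close>. The bound on the total divergence is
  the sum of the bounds on its parts, of which the directional one dominates.
\<close>

section \<open>Euclidean space and its Lebesgue measure\<close>

lemma space_leb [simp]: "space (leb p) = Rn p"
  by (simp add: leb_def Rn_def space_PiM)

lemma sets_leb: "sets (leb p) = sets (\<Pi>\<^sub>M i\<in>{..<p}. borel)"
  unfolding leb_def by (intro sets_PiM_cong) auto

lemma measurable_component [measurable]: "i < p \<Longrightarrow> (\<lambda>x. x i) \<in> borel_measurable (leb p)"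
  unfolding leb_def by measurable

lemma measurable_into_leb:
  assumes "\<And>i. i < p \<Longrightarrow> (\<lambda>x. f x i) \<in> borel_measurable M" "\<And>x. x \<in> space M \<Longrightarrow> f x \<in> Rn p"
  shows "f \<in> M \<rightarrow>\<^sub>M leb p"
  unfolding leb_def
  by (rule measurable_PiM_single') (use assms in \<open>auto simp: Rn_def space_PiM\<close>)

lemma vadd_in_Rn [simp]: "vadd p x y \<in> Rn p"
  and vsub_in_Rn [simp]: "vsub p x y \<in> Rn p"
  and vscale_in_Rn [simp]: "vscale p c x \<in> Rn p"
  and mvec_in_Rn [simp]: "mvec p A x \<in> Rn p"
  by (auto simp: vadd_def vsub_def vscale_def mvec_def Rn_def)

lemma Rn_eqI: "x \<in> Rn p \<Longrightarrow> y \<in> Rn p \<Longrightarrow> (\<And>i. i < p \<Longrightarrow> x i = y i) \<Longrightarrow> x = y"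
  unfolding Rn_def by (rule PiE_ext) auto

lemma vadd_apply [simp]: "i < p \<Longrightarrow> vadd p x y i = x i + y i"
  and vsub_apply [simp]: "i < p \<Longrightarrow> vsub p x y i = x i - y i"
  and vscale_apply [simp]: "i < p \<Longrightarrow> vscale p c x i = c * x i"
  and mvec_apply [simp]: "i < p \<Longrightarrow> mvec p A x i = (\<Sum>j<p. A i j * x j)"
  by (auto simp: vadd_def vsub_def vscale_def mvec_def)

lemma measurable_vadd [measurable (raw)]:
  assumes "f \<in> M \<rightarrow>\<^sub>M leb p" "g \<in> M \<rightarrow>\<^sub>M leb p"
  shows "(\<lambda>x. vadd p (f x) (g x)) \<in> M \<rightarrow>\<^sub>M leb p"
proof (rule measurable_into_leb)
  note [measurable] = assms
  fix i assume "i < p" then show "(\<lambda>x. vadd p (f x) (g x) i) \<in> borel_measurable M"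
    by simp
qed simp

lemma measurable_vsub [measurable (raw)]:
  assumes "f \<in> M \<rightarrow>\<^sub>M leb p" "g \<in> M \<rightarrow>\<^sub>M leb p"
  shows "(\<lambda>x. vsub p (f x) (g x)) \<in> M \<rightarrow>\<^sub>M leb p"
proof (rule measurable_into_leb)
  note [measurable] = assms
  fix i assume "i < p" then show "(\<lambda>x. vsub p (f x) (g x) i) \<in> borel_measurable M"
    by simp
qed simp

lemma measurable_vscale [measurable (raw)]:
  assumes "c \<in> borel_measurable M" "g \<in> M \<rightarrow>\<^sub>M leb p"
  shows "(\<lambda>x. vscale p (c x) (g x)) \<in> M \<rightarrow>\<^sub>M leb p"
proof (rule measurable_into_leb)
  note [measurable] = assms
  fix i assume "i < p" then show "(\<lambda>x. vscale p (c x) (g x) i) \<in> borel_measurable M"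
    by simp
qed simp

lemma measurable_mvec [measurable (raw)]:
  assumes "g \<in> M \<rightarrow>\<^sub>M leb p"
  shows "(\<lambda>x. mvec p A (g x)) \<in> M \<rightarrow>\<^sub>M leb p"
proof (rule measurable_into_leb)
  note [measurable] = assms
  fix i assume "i < p" then show "(\<lambda>x. mvec p A (g x) i) \<in> borel_measurable M"
    by simp
qed simp

lemma measurable_vnorm [measurable]: "vnorm p \<in> borel_measurable (leb p)"
  unfolding vnorm_def L2_set_def by measurable

lemma vnorm_nonneg [simp]: "0 \<le> vnorm p x"
  by (simp add: vnorm_def)

lemma vnorm_square: "(vnorm p x)\<^sup>2 = (\<Sum>i<p. (x i)\<^sup>2)"
  by (simp add: vnorm_def L2_set_def sum_nonneg)

lemma vnorm_square_vdot: "(vnorm p x)\<^sup>2 = vdot p x x"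
  unfolding vnorm_square by (simp add: vdot_def power2_eq_square)

lemma vnorm_vscale [simp]: "vnorm p (vscale p c x) = \<bar>c\<bar> * vnorm p x"
proof -
  have "(vnorm p (vscale p c x))\<^sup>2 = (\<bar>c\<bar> * vnorm p x)\<^sup>2"
    by (simp add: vnorm_square power_mult_distrib sum_distrib_left)
  then show ?thesis by (simp add: power2_eq_iff_nonneg)
qed

lemma abs_component_le_vnorm: "i < p \<Longrightarrow> \<bar>x i\<bar> \<le> vnorm p x"
  using member_le_L2_set[of "{..<p}" i "\<lambda>i. \<bar>x i\<bar>"] by (simp add: vnorm_def L2_set_def)

lemma vnorm_eq_0_iff: "x \<in> Rn p \<Longrightarrow> vnorm p x = 0 \<longleftrightarrow> x = (\<lambda>i\<in>{..<p}. 0)"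
  by (auto simp: vnorm_def L2_set_eq_0_iff Rn_def fun_eq_iff PiE_def extensional_def)

lemma sigma_finite_leb: "sigma_finite_measure (leb p)"
proof -
  interpret finite_product_sigma_finite "\<lambda>_. lborel" "{..<p}" by standard auto
  show ?thesis unfolding leb_def by unfold_locales
qed

lemma emeasure_leb_box:
  assumes "\<And>i. i < p \<Longrightarrow> A i \<in> sets borel"
  shows "emeasure (leb p) (Pi\<^sub>E {..<p} A) = (\<Prod>i<p. emeasure lborel (A i))"
proof -
  interpret finite_product_sigma_finite "\<lambda>_. lborel" "{..<p}" by standard auto
  show ?thesis unfolding leb_def by (rule emeasure_PiM) (use assms in auto)
qed

lemma leb_eqI:
  assumes "sets M = sets (leb p)"
    and "\<And>A. (\<And>i. i < p \<Longrightarrow> A i \<in> sets borel) \<Longrightarrow>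
           emeasure M (Pi\<^sub>E {..<p} A) = (\<Prod>i<p. emeasure lborel (A i))"
  shows "M = leb p"
proof -
  interpret product_sigma_finite "\<lambda>_. lborel :: real measure" by standard
  show ?thesis unfolding leb_def
    by (rule PiM_eqI) (use assms in \<open>auto simp: leb_def\<close>)
qed

lemma distr_leb_vadd: "distr (leb p) (leb p) (vadd p a) = leb p"
proof (rule leb_eqI)
  fix A :: "nat \<Rightarrow> real set" assume A: "\<And>i. i < p \<Longrightarrow> A i \<in> sets borel"
  have box: "Pi\<^sub>E {..<p} A \<in> sets (leb p)"
    unfolding leb_def by (rule sets_PiM_I_finite) (use A in auto)
  have "vadd p a -` Pi\<^sub>E {..<p} A \<inter> Rn p = Pi\<^sub>E {..<p} (\<lambda>i. (+) (a i) -` A i)"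
    by (auto simp: Rn_def PiE_iff vadd_def)
  moreover have "emeasure lborel ((+) (a i) -` A i) = emeasure lborel (A i)" if "i < p" for i
  proof -
    have "emeasure lborel (A i) = emeasure (distr lborel borel ((+) (a i))) (A i)"
      by (simp add: lborel_distr_plus)
    also have "\<dots> = emeasure lborel ((+) (a i) -` A i)"
      using A[OF that] by (subst emeasure_distr) auto
    finally show ?thesis by simp
  qed
  moreover have "(+) (a i) -` A i \<in> sets borel" if "i < p" for i
  proof -
    have "(+) (a i) \<in> borel \<rightarrow>\<^sub>M borel" by measurable
    from measurable_sets[OF this A[OF that]] show ?thesis by simp
  qed
  ultimately show "emeasure (distr (leb p) (leb p) (vadd p a)) (Pi\<^sub>E {..<p} A)
      = (\<Prod>i<p. emeasure lborel (A i))"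
    using box by (subst emeasure_distr) (simp_all add: emeasure_leb_box measurable_into_leb)
qed simp

lemma leb_vscale:
  assumes "c \<noteq> 0"
  shows "leb p = density (distr (leb p) (leb p) (vscale p c)) (\<lambda>_. ennreal (\<bar>c\<bar> ^ p))"
proof (rule leb_eqI[symmetric])
  fix A :: "nat \<Rightarrow> real set" assume A: "\<And>i. i < p \<Longrightarrow> A i \<in> sets borel"
  have box: "Pi\<^sub>E {..<p} A \<in> sets (leb p)"
    unfolding leb_def by (rule sets_PiM_I_finite) (use A in auto)
  have "vscale p c -` Pi\<^sub>E {..<p} A \<inter> Rn p = Pi\<^sub>E {..<p} (\<lambda>i. (*) c -` A i)"
    by (auto simp: Rn_def PiE_iff vscale_def)
  moreover have "ennreal \<bar>c\<bar> * emeasure lborel ((*) c -` A i) = emeasure lborel (A i)" if "i < p" for i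
  proof -
    have "emeasure lborel (A i) = emeasure (density (distr lborel borel ((*) c)) (\<lambda>_. \<bar>c\<bar>)) (A i)"
      using lborel_distr_mult'[OF assms] by simp
    also have "\<dots> = \<bar>c\<bar> * emeasure lborel ((*) c -` A i)"
      using A[OF that] by (subst emeasure_density_const) (auto simp: emeasure_distr)
    finally show ?thesis by simp
  qed
  then have "(\<Prod>i<p. emeasure lborel (A i)) = (\<Prod>i<p. ennreal \<bar>c\<bar> * emeasure lborel ((*) c -` A i))"
    by (intro prod.cong) auto
  moreover have "(*) c -` A i \<in> sets borel" if "i < p" for i
  proof -
    have "(*) c \<in> borel \<rightarrow>\<^sub>M borel" by measurable
    from measurable_sets[OF this A[OF that]] show ?thesis by simp
  qed
  ultimately show "emeasure (density (distr (leb p) (leb p) (vscale p c)) (\<lambda>_. ennreal (\<bar>c\<bar> ^ p))) (Pi\<^sub>E {..<p} A)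
      = (\<Prod>i<p. emeasure lborel (A i))"
    using box by (subst emeasure_density_const)
      (simp_all add: emeasure_distr emeasure_leb_box measurable_into_leb prod.distrib ennreal_power)
qed simp

lemma nn_integral_leb_vadd:
  assumes [measurable]: "f \<in> borel_measurable (leb p)"
  shows "(\<integral>\<^sup>+x. f (vadd p a x) \<partial>leb p) = (\<integral>\<^sup>+x. f x \<partial>leb p)"
proof -
  have "vadd p a \<in> leb p \<rightarrow>\<^sub>M leb p" by (rule measurable_into_leb) simp_all
  from nn_integral_distr[OF this, of f] show ?thesis by (simp add: distr_leb_vadd)
qed

lemma nn_integral_leb_reflect:
  assumes [measurable]: "f \<in> borel_measurable (leb p)"
  shows "(\<integral>\<^sup>+x. f (vscale p (-1) x) \<partial>leb p) = (\<integral>\<^sup>+x. f x \<partial>leb p)"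
proof -
  have "vscale p (-1) \<in> leb p \<rightarrow>\<^sub>M leb p" by (rule measurable_into_leb) simp_all
  from nn_integral_distr[OF this, of f] show ?thesis
    using leb_vscale[of "-1" p] by (simp add: density_1)
qed

text \<open>
  Uniqueness of Haar measure, by computing the integral of \<open>1\<^sub>A x * 1\<^sub>B (x + y)\<close> over
  the product of \<open>M\<close> and Lebesgue measure in both orders: invariance under shifts of
  \<open>y\<close> gives the left-hand side, invariance under shifts of \<open>x\<close> the right-hand side. It
  determines the image of Lebesgue measure under a linear bijection up to a factor.
\<close>

lemma translation_invariant_proportional:
  assumes M: "sigma_finite_measure M" and sets_M: "sets M = sets (leb p)"
    and inv: "\<And>a. a \<in> Rn p \<Longrightarrow> distr M (leb p) (vadd p a) = M"
    and A: "A \<in> sets (leb p)" and B: "B \<in> sets (leb p)"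
  shows "emeasure M A * emeasure (leb p) B = emeasure (leb p) A * emeasure M B"
proof -
  interpret M: sigma_finite_measure M by fact
  interpret L: sigma_finite_measure "leb p" by (rule sigma_finite_leb)
  interpret P: pair_sigma_finite M "leb p" by standard
  have space_M: "space M = Rn p" using sets_eq_imp_space_eq[OF sets_M] by simp
  note [measurable] = A B
  have [measurable]: "A \<in> sets M" "B \<in> sets M" using A B sets_M by auto
  have [measurable_cong]: "sets M = sets (leb p)" by fact
  have shift_M: "(\<integral>\<^sup>+x. f (vadd p a x) \<partial>M) = (\<integral>\<^sup>+x. f x \<partial>M)"
    if a: "a \<in> Rn p" and [measurable]: "f \<in> borel_measurable (leb p)" for f a
  proof -
    have "vadd p a \<in> M \<rightarrow>\<^sub>M leb p"
      by (rule measurable_into_leb) (simp_all)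
    from nn_integral_distr[OF this, of f] show ?thesis using inv[OF a] by simp
  qed
  have "emeasure M A * emeasure (leb p) B = (\<integral>\<^sup>+x. indicator A x * (\<integral>\<^sup>+y. indicator B y \<partial>leb p) \<partial>M)"
    by (subst nn_integral_multc) auto
  also have "\<dots> = (\<integral>\<^sup>+x. indicator A x * (\<integral>\<^sup>+y. indicator B (vadd p x y) \<partial>leb p) \<partial>M)"
    by (intro nn_integral_cong arg_cong2[where f="(*)"] refl nn_integral_leb_vadd[symmetric]) auto
  also have "\<dots> = (\<integral>\<^sup>+x. (\<integral>\<^sup>+y. indicator A x * indicator B (vadd p x y) \<partial>leb p) \<partial>M)"
    by (intro nn_integral_cong nn_integral_cmult[symmetric]) (auto intro!: measurable_vadd simp: space_M)
  also have "\<dots> = (\<integral>\<^sup>+y. (\<integral>\<^sup>+x. indicator A x * indicator B (vadd p x y) \<partial>M) \<partial>leb p)"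
    by (intro P.Fubini'[symmetric]) measurable
  also have "\<dots> = (\<integral>\<^sup>+y. (\<integral>\<^sup>+x. indicator A (vsub p x y) * indicator B x \<partial>M) \<partial>leb p)"
  proof (rule nn_integral_cong)
    fix y assume y: "y \<in> space (leb p)"
    have "(\<integral>\<^sup>+x. indicator A x * indicator B (vadd p x y) \<partial>M)
       = (\<integral>\<^sup>+x. indicator A (vsub p (vadd p y x) y) * indicator B (vadd p y x) \<partial>M)"
    proof (rule nn_integral_cong)
      fix x assume "x \<in> space M"
      then have "vsub p (vadd p y x) y = x" by (intro Rn_eqI[of _ p]) (auto simp: space_M)
      moreover have "vadd p y x = vadd p x y" by (intro Rn_eqI[of _ p]) auto
      ultimately show "indicator A x * indicator B (vadd p x y)
        = (indicator A (vsub p (vadd p y x) y) * indicator B (vadd p y x) :: ennreal)" by simp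
    qed
    also have "\<dots> = (\<integral>\<^sup>+x. indicator A (vsub p x y) * indicator B x \<partial>M)"
      by (rule shift_M) (use y in \<open>auto intro!: measurable_vsub borel_measurable_times\<close>)
    finally show "(\<integral>\<^sup>+x. indicator A x * indicator B (vadd p x y) \<partial>M)
       = (\<integral>\<^sup>+x. indicator A (vsub p x y) * indicator B x \<partial>M)" .
  qed
  also have "\<dots> = (\<integral>\<^sup>+x. (\<integral>\<^sup>+y. indicator A (vsub p x y) * indicator B x \<partial>leb p) \<partial>M)"
    by (intro P.Fubini') measurable
  also have "\<dots> = (\<integral>\<^sup>+x. emeasure (leb p) A * indicator B x \<partial>M)"
  proof (rule nn_integral_cong)
    fix x assume x: "x \<in> space M"
    have "(\<integral>\<^sup>+y. indicator A (vsub p x y) * indicator B x \<partial>leb p)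
       = (\<integral>\<^sup>+y. indicator A (vsub p x y) \<partial>leb p) * indicator B x"
      by (rule nn_integral_multc) (use x in \<open>auto simp: space_M intro!: measurable_vsub\<close>)
    also have "(\<integral>\<^sup>+y. indicator A (vsub p x y) \<partial>leb p) =
       (\<integral>\<^sup>+y. indicator A (vadd p x (vscale p (-1) y)) \<partial>leb p)"
      by (intro nn_integral_cong arg_cong[where f="indicator A"] Rn_eqI[of _ p]) auto
    also have "\<dots> = (\<integral>\<^sup>+y. indicator A (vadd p x y) \<partial>leb p)"
      by (rule nn_integral_leb_reflect) (use x in \<open>auto simp: space_M intro!: measurable_vadd\<close>)
    also have "\<dots> = emeasure (leb p) A" by (subst nn_integral_leb_vadd) auto
    finally show "(\<integral>\<^sup>+y. indicator A (vsub p x y) * indicator B x \<partial>leb p) = emeasure (leb p) A * indicator B x" .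
  qed
  also have "\<dots> = emeasure (leb p) A * emeasure M B"
    by (subst nn_integral_cmult) auto
  finally show ?thesis .
qed

section \<open>Lebesgue measure under affine bijections\<close>

lemma mvec_mprod_eq:
  assumes "mprod_eq p A B C" shows "mvec p A (mvec p B x) = mvec p C x"
proof (rule Rn_eqI[of _ p])
  fix i assume i: "i < p"
  have "mvec p A (mvec p B x) i = (\<Sum>k<p. \<Sum>j<p. A i k * B k j * x j)"
    using i by (simp add: sum_distrib_left mult.assoc)
  also have "\<dots> = (\<Sum>j<p. (\<Sum>k<p. A i k * B k j) * x j)"
    by (subst sum.swap) (simp add: sum_distrib_right)
  also have "\<dots> = (\<Sum>j<p. C i j * x j)" using assms i by (simp add: mprod_eq_def)
  finally show "mvec p A (mvec p B x) i = mvec p C x i" using i by simp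
qed simp_all

lemma minverse_mvec:
  assumes "minverse p A B" "x \<in> Rn p"
  shows "mvec p A (mvec p B x) = x" "mvec p B (mvec p A x) = x"
proof -
  have "mvec p (\<lambda>i j. of_bool (i = j)) x = x"
    using assms(2) by (intro Rn_eqI[of _ p]) (auto simp: of_bool_def if_distrib[of "\<lambda>c. c * _"] cong: if_cong)
  then show "mvec p A (mvec p B x) = x" "mvec p B (mvec p A x) = x"
    using assms(1) by (auto simp: minverse_def mvec_mprod_eq)
qed

lemma mvec_vadd: "mvec p A (vadd p x y) = vadd p (mvec p A x) (mvec p A y)"
  by (rule Rn_eqI[of _ p]) (auto simp: sum.distrib distrib_left)

lemma mvec_vscale: "mvec p A (vscale p c x) = vscale p c (mvec p A x)"
  by (rule Rn_eqI[of _ p]) (auto simp: sum_distrib_left mult_ac)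

lemma unstandardize_standardize:
  assumes "minverse p S W" "\<mu> \<in> Rn p" "x \<in> Rn p"
  shows "vadd p \<mu> (mvec p S (standardize p \<mu> W x)) = x"
  using assms minverse_mvec(1)[OF assms(1), of "vsub p x \<mu>"]
  by (intro Rn_eqI[of _ p]) (auto simp: standardize_def)

lemma standardize_unstandardize:
  assumes "minverse p S W" "\<mu> \<in> Rn p" "y \<in> Rn p"
  shows "standardize p \<mu> W (vadd p \<mu> (mvec p S y)) = y"
proof -
  have "vsub p (vadd p \<mu> (mvec p S y)) \<mu> = mvec p S y"
    by (intro Rn_eqI[of _ p]) auto
  then show ?thesis using minverse_mvec(2)[OF assms(1,3)] by (simp add: standardize_def)
qed

lemma standardize_in_Rn [simp]: "standardize p \<mu> W x \<in> Rn p"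
  by (simp add: standardize_def)

lemma measurable_standardize [measurable]:
  assumes "\<mu> \<in> Rn p"
  shows "standardize p \<mu> W \<in> leb p \<rightarrow>\<^sub>M leb p"
proof -
  note [measurable] = measurable_vsub measurable_mvec
  have [measurable]: "(\<lambda>_. \<mu>) \<in> leb p \<rightarrow>\<^sub>M leb p" using assms by (intro measurable_const) simp
  show ?thesis unfolding standardize_def by measurable
qed

lemma emeasure_leb_unit_box: "emeasure (leb p) (Pi\<^sub>E {..<p} (\<lambda>_. {0..1})) = 1"
  by (subst emeasure_leb_box) auto

lemma emeasure_leb_Rn_neq_0: "emeasure (leb p) (Rn p) \<noteq> 0"
proof -
  have "Pi\<^sub>E {..<p} (\<lambda>_. {0..1::real}) \<subseteq> Rn p" unfolding Rn_def by (rule PiE_mono) simp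
  then have "1 \<le> emeasure (leb p) (Rn p)"
    using emeasure_mono[of _ "Rn p" "leb p"] emeasure_leb_unit_box[of p] sets.top[of "leb p"]
    by (metis space_leb)
  then show ?thesis by auto
qed

text \<open>
  The image of Lebesgue measure is invariant under translations, hence a multiple of it. The factor
  \<open>c\<close> is a determinant, but it cancels in every normalized density.
\<close>

lemma distr_leb_standardize:
  assumes inv: "minverse p S W" and \<mu>: "\<mu> \<in> Rn p"
  obtains c :: real where "0 < c"
    "distr (leb p) (leb p) (standardize p \<mu> W) = density (leb p) (\<lambda>_. ennreal c)"
proof -
  define M where "M = distr (leb p) (leb p) (standardize p \<mu> W)"
  interpret L: sigma_finite_measure "leb p" by (rule sigma_finite_leb)
  note [measurable] = measurable_standardize[OF \<mu>, of W]
  have unstd [measurable]: "(\<lambda>y. vadd p \<mu> (mvec p S y)) \<in> leb p \<rightarrow>\<^sub>M leb p"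
  proof -
    have "(\<lambda>_. \<mu>) \<in> leb p \<rightarrow>\<^sub>M leb p" using \<mu> by (intro measurable_const) simp
    then show ?thesis by (intro measurable_vadd measurable_mvec) simp_all
  qed
  have sets_M [measurable_cong]: "sets M = sets (leb p)" by (simp add: M_def)
  have "distr M (leb p) (\<lambda>y. vadd p \<mu> (mvec p S y))
     = distr (leb p) (leb p) (\<lambda>x. vadd p \<mu> (mvec p S (standardize p \<mu> W x)))"
    unfolding M_def by (subst distr_distr) (auto simp: o_def)
  also have "\<dots> = distr (leb p) (leb p) (\<lambda>x. x)"
    using unstandardize_standardize[OF inv \<mu>] by (intro distr_cong) auto
  finally have "distr M (leb p) (\<lambda>y. vadd p \<mu> (mvec p S y)) = leb p" by simp
  then have sf: "sigma_finite_measure M"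
    using sigma_finite_measure_distr[of M "leb p" "\<lambda>y. vadd p \<mu> (mvec p S y)"] unstd sets_M
    by (simp add: sigma_finite_leb cong: measurable_cong_sets)
  interpret M: sigma_finite_measure M by fact
  have translate [measurable]: "vadd p a \<in> leb p \<rightarrow>\<^sub>M leb p" for a
    by (rule measurable_into_leb) simp_all
  have shift: "distr M (leb p) (vadd p a) = M" if a: "a \<in> Rn p" for a
  proof -
    have "distr M (leb p) (vadd p a) = distr (leb p) (leb p) (\<lambda>x. vadd p a (standardize p \<mu> W x))"
      unfolding M_def by (subst distr_distr) (simp_all add: o_def)
    also have "\<dots> = distr (leb p) (leb p) (\<lambda>x. standardize p \<mu> W (vadd p (mvec p S a) x))"
    proof (intro distr_cong refl)
      fix x
      have "vsub p (vadd p (mvec p S a) x) \<mu> = vadd p (mvec p S a) (vsub p x \<mu>)"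
        by (rule Rn_eqI[of _ p]) auto
      then show "vadd p a (standardize p \<mu> W x) = standardize p \<mu> W (vadd p (mvec p S a) x)"
        using minverse_mvec(2)[OF inv a] by (simp add: standardize_def mvec_vadd)
    qed
    also have "\<dots> = distr (distr (leb p) (leb p) (vadd p (mvec p S a))) (leb p) (standardize p \<mu> W)"
      by (subst distr_distr) (simp_all add: o_def)
    finally show ?thesis by (simp add: distr_leb_vadd M_def)
  qed
  define B :: "rvec set" where "B = Pi\<^sub>E {..<p} (\<lambda>_. {0..1})"
  have B [measurable]: "B \<in> sets (leb p)"
    unfolding B_def leb_def by (rule sets_PiM_I_finite) auto
  define c where "c = emeasure M B"
  have scal: "emeasure M A = emeasure (leb p) A * c" if "A \<in> sets (leb p)" for A
    using translation_invariant_proportional[OF sf sets_M shift that B]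
    by (simp add: B_def emeasure_leb_unit_box c_def)
  have M_UNIV: "emeasure M (Rn p) = emeasure (leb p) (Rn p)"
  proof -
    have "standardize p \<mu> W -` Rn p \<inter> Rn p = Rn p" by auto
    then show ?thesis using sets.top[of "leb p"] by (simp add: M_def emeasure_distr)
  qed
  have "c \<noteq> 0"
  proof
    assume "c = 0"
    then have "emeasure M (Rn p) = 0" using scal[of "Rn p"] sets.top[of "leb p"] by simp
    then show False using M_UNIV emeasure_leb_Rn_neq_0[of p] by simp
  qed
  moreover have "c \<noteq> \<infinity>"
  proof
    assume c: "c = \<infinity>"
    obtain A :: "nat \<Rightarrow> rvec set" where A: "range A \<subseteq> sets M" "(\<Union>i. A i) = space M"
        "\<And>i. emeasure M (A i) \<noteq> \<infinity>"
      using M.sigma_finite by metis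
    have "emeasure (leb p) (A i) = 0" for i
    proof (rule ccontr)
      assume "emeasure (leb p) (A i) \<noteq> 0"
      then have "emeasure M (A i) = \<infinity>"
        using A(1) c scal[of "A i"] sets_M by (auto simp: ennreal_mult_top)
      then show False using A(3)[of i] by simp
    qed
    then have "emeasure (leb p) (\<Union>i. A i) = 0"
      using A(1) sets_M by (intro emeasure_UN_eq_0) auto
    then show False using A(2) emeasure_leb_Rn_neq_0[of p] sets_eq_imp_space_eq[OF sets_M] by simp
  qed
  ultimately obtain c' where c': "0 < c'" "c = ennreal c'"
    by (cases c) (auto simp: less_le)
  have "M = density (leb p) (\<lambda>_. ennreal c')"
  proof (rule measure_eqI)
    fix A assume "A \<in> sets M"
    then have "A \<in> sets (leb p)" using sets_M by simp
    then show "emeasure M A = emeasure (density (leb p) (\<lambda>_. ennreal c')) A"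
      using scal[of A] c' by (simp add: emeasure_density_const mult.commute)
  qed (simp add: sets_M)
  then show ?thesis using that[OF c'(1)] by (simp add: M_def)
qed

section \<open>Polar coordinates\<close>

definition vdir :: "nat \<Rightarrow> rvec \<Rightarrow> rvec" where
  "vdir p x = vscale p (1 / vnorm p x) x"

lemma vdir_in_Rn [simp]: "vdir p x \<in> Rn p"
  by (simp add: vdir_def)

lemma measurable_vdir [measurable]: "vdir p \<in> leb p \<rightarrow>\<^sub>M leb p"
  unfolding vdir_def by measurable

lemma vscale_vnorm_vdir: "x \<in> Rn p \<Longrightarrow> vscale p (vnorm p x) (vdir p x) = x"
proof (rule Rn_eqI[of _ p])
  fix i assume "x \<in> Rn p" "i < p"
  then show "vscale p (vnorm p x) (vdir p x) i = x i"
    by (cases "vnorm p x = 0") (auto simp: vdir_def vnorm_eq_0_iff)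
qed simp_all

lemma vscale_vscale [simp]: "vscale p a (vscale p b x) = vscale p (a * b) x"
  by (rule Rn_eqI[of _ p]) auto

lemma vdir_vscale: "0 < c \<Longrightarrow> vdir p (vscale p c x) = vdir p x"
  by (simp add: vdir_def)

lemma vnorm_vdir: "x \<in> Rn p \<Longrightarrow> vnorm p x \<noteq> 0 \<Longrightarrow> vnorm p (vdir p x) = 1"
  by (simp add: vdir_def)

lemma AE_leb_vnorm_neq_0: 
  assumes "1 \<le> p" shows "AE x in leb p. vnorm p x \<noteq> 0"
proof (rule AE_I')
  have "{\<lambda>i\<in>{..<p}. 0} = Pi\<^sub>E {..<p} (\<lambda>_. {0::real})" 
    by (auto simp: PiE_eq_singleton)
  moreover have "emeasure (leb p) (Pi\<^sub>E {..<p} (\<lambda>_. {0::real})) = 0"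
    using assms by (subst emeasure_leb_box) auto
  moreover have "Pi\<^sub>E {..<p} (\<lambda>_. {0::real}) \<in> sets (leb p)"
    unfolding leb_def by (rule sets_PiM_I_finite) auto
  ultimately have "emeasure (leb p) {\<lambda>i\<in>{..<p}. 0} = 0" "{\<lambda>i\<in>{..<p}. 0::real} \<in> sets (leb p)"
    by simp_all
  then show "{\<lambda>i\<in>{..<p}. 0} \<in> null_sets (leb p)" by auto
  show "{x \<in> space (leb p). \<not> vnorm p x \<noteq> 0} \<subseteq> {\<lambda>i\<in>{..<p}. 0}"
    by (auto simp: vnorm_eq_0_iff)
qed

text \<open>
  The surface measure of the sphere up to a constant factor: a set of directions gets the volume of the part of
  the unit ball that lies in these directions.
\<close>

definition cone_measure :: "nat \<Rightarrow> rvec measure" where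
  "cone_measure p = distr (density (leb p) (indicator {x \<in> Rn p. vnorm p x \<le> 1})) (leb p) (vdir p)"

lemma sets_cone_measure [simp, measurable_cong]: "sets (cone_measure p) = sets (leb p)"
  and space_cone_measure [simp]: "space (cone_measure p) = Rn p"
  by (simp_all add: cone_measure_def)

lemma ball_sets [measurable]: "{x \<in> Rn p. vnorm p x \<le> t} \<in> sets (leb p)"
proof -
  have "{x \<in> space (leb p). vnorm p x \<le> t} \<in> sets (leb p)" by measurable
  then show ?thesis by simp
qed

lemma emeasure_cone_measure:
  assumes [measurable]: "B \<in> sets (leb p)"
  shows "emeasure (cone_measure p) B = emeasure (leb p) {x \<in> Rn p. vnorm p x \<le> 1 \<and> vdir p x \<in> B}"
proof -
  have [measurable]: "vdir p -` B \<inter> Rn p \<in> sets (leb p)"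
    using measurable_sets[OF measurable_vdir assms] by simp
  have "emeasure (cone_measure p) B
    = (\<integral>\<^sup>+x. indicator {x \<in> Rn p. vnorm p x \<le> 1} x * indicator (vdir p -` B \<inter> Rn p) x \<partial>leb p)"
    unfolding cone_measure_def
    by (subst emeasure_distr) (auto simp: emeasure_density)
  also have "\<dots> = (\<integral>\<^sup>+x. indicator {x \<in> Rn p. vnorm p x \<le> 1 \<and> vdir p x \<in> B} x \<partial>leb p)"
    by (intro nn_integral_cong) (auto split: split_indicator)
  also have "\<dots> = emeasure (leb p) {x \<in> Rn p. vnorm p x \<le> 1 \<and> vdir p x \<in> B}"
  proof (rule nn_integral_indicator)
    have "{x \<in> space (leb p). vnorm p x \<le> 1 \<and> vdir p x \<in> B} \<in> sets (leb p)" by measurable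
    then show "{x \<in> Rn p. vnorm p x \<le> 1 \<and> vdir p x \<in> B} \<in> sets (leb p)" by simp
  qed
  finally show ?thesis .
qed

lemma finite_cone_measure: "finite_measure (cone_measure p)"
proof
  have "emeasure (cone_measure p) (Rn p) = emeasure (leb p) {x \<in> Rn p. vnorm p x \<le> 1}"
    using sets.top[of "leb p"] by (simp add: emeasure_cone_measure)
  also have "\<dots> \<le> emeasure (leb p) (Pi\<^sub>E {..<p} (\<lambda>_. {-1..1}))"
  proof (rule emeasure_mono)
    have "x \<in> Pi\<^sub>E {..<p} (\<lambda>_. {-1..1})" if "x \<in> Rn p" "vnorm p x \<le> 1" for x
      using that order_trans[OF abs_component_le_vnorm[of _ p x] that(2)]
      by (auto simp: Rn_def PiE_iff abs_le_iff)
    then show "{x \<in> Rn p. vnorm p x \<le> 1} \<subseteq> Pi\<^sub>E {..<p} (\<lambda>_. {-1..1})" by auto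
    show "Pi\<^sub>E {..<p} (\<lambda>_. {-1..1::real}) \<in> sets (leb p)"
      unfolding leb_def by (rule sets_PiM_I_finite) auto
  qed
  also have "\<dots> < \<infinity>" by (subst emeasure_leb_box) (auto simp: ennreal_power[symmetric] power_less_top_ennreal)
  finally show "emeasure (cone_measure p) (space (cone_measure p)) \<noteq> \<infinity>" by simp
qed

text \<open>
  Directions are unaffected by dilations, so the part of a ball in a given set of directions scales like the
  ball.
\<close>

lemma emeasure_leb_cone:
  assumes t: "0 < t" and [measurable]: "B \<in> sets (leb p)"
  shows "emeasure (leb p) {x \<in> Rn p. vnorm p x \<le> t \<and> vdir p x \<in> B}
       = ennreal (t ^ p) * emeasure (cone_measure p) B"
proof -
  let ?A = "{x \<in> Rn p. vnorm p x \<le> t \<and> vdir p x \<in> B}"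
  have "{x \<in> space (leb p). vnorm p x \<le> t \<and> vdir p x \<in> B} \<in> sets (leb p)" by measurable
  then have A: "?A \<in> sets (leb p)" by simp
  have "emeasure (leb p) ?A = ennreal (t ^ p) * emeasure (distr (leb p) (leb p) (vscale p t)) ?A"
    using A t by (subst leb_vscale[of t p]) (simp_all add: emeasure_density_const)
  also have "emeasure (distr (leb p) (leb p) (vscale p t)) ?A
     = emeasure (leb p) (vscale p t -` ?A \<inter> Rn p)"
    using A by (subst emeasure_distr) (auto intro!: measurable_into_leb)
  also have "vscale p t -` ?A \<inter> Rn p = {x \<in> Rn p. vnorm p x \<le> 1 \<and> vdir p x \<in> B}"
    using t by (auto simp: vdir_vscale)
  finally show ?thesis by (simp add: emeasure_cone_measure)
qed

definition radial_measure :: "nat \<Rightarrow> real measure" where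
  "radial_measure p = density lborel (\<lambda>r. ennreal (indicator {0..} r * (real p * r ^ (p - 1))))"

lemma sets_radial_measure [simp, measurable_cong]: "sets (radial_measure p) = sets borel"
  by (simp add: radial_measure_def)

lemma emeasure_radial_measure:
  assumes "1 \<le> p"
  shows "emeasure (radial_measure p) {..t} = (if 0 \<le> t then ennreal (t ^ p) else 0)"
proof -
  have "emeasure (radial_measure p) {..t}
     = (\<integral>\<^sup>+r. ennreal (indicator {0..} r * (real p * r ^ (p - 1))) * indicator {..t} r \<partial>lborel)"
    unfolding radial_measure_def by (subst emeasure_density) auto
  also have "\<dots> = (\<integral>\<^sup>+r. ennreal (real p * r ^ (p - 1)) * indicator {0..t} r \<partial>lborel)"
    by (intro nn_integral_cong) (auto split: split_indicator)
  also have "\<dots> = (if 0 \<le> t then ennreal (t ^ p) else 0)"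
  proof (cases "0 \<le> t")
    case True
    have "(\<integral>\<^sup>+r. ennreal (real p * r ^ (p - 1)) * indicator {0..t} r \<partial>lborel) = t ^ p - 0 ^ p"
      by (rule nn_integral_FTC_Icc) (use True in \<open>auto intro!: derivative_eq_intros\<close>)
    then show ?thesis using True assms by (simp add: zero_power)
  qed auto
  finally show ?thesis .
qed

lemma sigma_finite_radial_measure: "1 \<le> p \<Longrightarrow> sigma_finite_measure (radial_measure p)"
proof (rule sigma_finite_measure.intro, rule exI[of _ "range (\<lambda>n. {..real n})"], intro conjI ballI)
  fix a assume "1 \<le> p" "a \<in> range (\<lambda>n. {..real n})"
  then show "emeasure (radial_measure p) a \<noteq> \<infinity>"
    by (auto simp: emeasure_radial_measure)
next
  show "\<Union> (range (\<lambda>n. {..real n})) = space (radial_measure p)"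
    by (auto simp: radial_measure_def real_arch_simple)
qed auto

text \<open>
  For a fixed set \<open>B\<close> of directions, the law of the radius of the points of the cone over
  \<open>B\<close> is determined by its values on the intervals \<open>{..t}\<close>, which are given by
  \<open>emeasure_leb_cone\<close>.
\<close>

theorem distr_leb_polar:
  assumes p: "1 \<le> p"
  shows "distr (leb p) (borel \<Otimes>\<^sub>M leb p) (\<lambda>x. (vnorm p x, vdir p x)) = radial_measure p \<Otimes>\<^sub>M cone_measure p"
proof (rule pair_measure_eqI[symmetric])
  show "sigma_finite_measure (radial_measure p)" by (rule sigma_finite_radial_measure[OF p])
  interpret finite_measure "cone_measure p" by (rule finite_cone_measure)
  show "sigma_finite_measure (cone_measure p)" by unfold_locales
  show "sets (radial_measure p \<Otimes>\<^sub>M cone_measure p) = sets (distr (leb p) (borel \<Otimes>\<^sub>M leb p) (\<lambda>x. (vnorm p x, vdir p x)))"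
    by (simp cong: sets_pair_measure_cong)
  fix A B assume A: "A \<in> sets (radial_measure p)" and B: "B \<in> sets (cone_measure p)"
  then have [measurable]: "A \<in> sets borel" "B \<in> sets (leb p)" by auto
  define L where "L = distr (density (leb p) (\<lambda>x. indicator B (vdir p x))) borel (vnorm p)"
  have meas_L: "emeasure L A = emeasure (leb p) {x \<in> Rn p. vnorm p x \<in> A \<and> vdir p x \<in> B}"
    if [measurable]: "A \<in> sets borel" for A
  proof -
    have m: "{x \<in> space (leb p). vnorm p x \<in> A \<and> vdir p x \<in> B} \<in> sets (leb p)" by measurable
    have [measurable]: "vnorm p -` A \<inter> Rn p \<in> sets (leb p)"
      using measurable_sets[OF measurable_vnorm that] by simp
    have "emeasure L A = (\<integral>\<^sup>+x. indicator B (vdir p x) * indicator (vnorm p -` A \<inter> Rn p) x \<partial>leb p)"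
      unfolding L_def by (subst emeasure_distr)
        (auto simp: emeasure_density)
    also have "\<dots> = (\<integral>\<^sup>+x. indicator {x \<in> Rn p. vnorm p x \<in> A \<and> vdir p x \<in> B} x \<partial>leb p)"
      by (intro nn_integral_cong) (auto split: split_indicator)
    finally show ?thesis using m by simp
  qed
  have "L = density (radial_measure p) (\<lambda>_. emeasure (cone_measure p) B)"
  proof (rule measure_eqI_generator_eq[of "range (\<lambda>t::real. {..t})" UNIV])
    show "Int_stable (range (\<lambda>t::real. {..t}))"
      by (auto simp: Int_stable_def)
    show "sets L = sigma_sets UNIV (range (\<lambda>t::real. {..t}))"
      "sets (density (radial_measure p) (\<lambda>_. emeasure (cone_measure p) B)) = sigma_sets UNIV (range (\<lambda>t::real. {..t}))"
      by (simp_all add: L_def borel_eq_atMost)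
    fix X assume "X \<in> range (\<lambda>t::real. {..t})"
    then obtain t where X: "X = {..t}" by auto
    have "emeasure L X = emeasure (leb p) {x \<in> Rn p. vnorm p x \<le> t \<and> vdir p x \<in> B}"
      by (simp add: X meas_L)
    also have "\<dots> = emeasure (cone_measure p) B * emeasure (radial_measure p) {..t}"
    proof (cases "0 < t")
      case True
      then show ?thesis using p by (simp add: emeasure_leb_cone emeasure_radial_measure mult.commute)
    next
      case False
      have "\<not> (vnorm p x \<le> t \<and> vdir p x \<in> B)" if "vnorm p x \<noteq> 0" for x
        using that False vnorm_nonneg[of p x] by linarith
      then have "AE x in leb p. vnorm p x \<noteq> 0 \<longrightarrow> \<not> (vnorm p x \<le> t \<and> vdir p x \<in> B)"
        by (intro AE_I2) blast
      from AE_mp[OF AE_leb_vnorm_neq_0[OF p] this]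
      have "AE x in leb p. \<not> (vnorm p x \<le> t \<and> vdir p x \<in> B)" .
      from emeasure_eq_0_AE[OF this]
      have "emeasure (leb p) {x \<in> Rn p. vnorm p x \<le> t \<and> vdir p x \<in> B} = 0" by simp
      then show ?thesis using p False by (auto simp: emeasure_radial_measure)
    qed
    finally show "emeasure L X = emeasure (density (radial_measure p) (\<lambda>_. emeasure (cone_measure p) B)) X"
      by (simp add: X emeasure_density_const)
  next
    fix i :: nat
    have "emeasure L {..real i} \<le> emeasure (leb p) {x \<in> Rn p. vnorm p x \<le> real i + 1 \<and> vdir p x \<in> B}"
    proof (subst meas_L, simp, rule emeasure_mono)
      have "{x \<in> space (leb p). vnorm p x \<le> real i + 1 \<and> vdir p x \<in> B} \<in> sets (leb p)" by measurable
      then show "{x \<in> Rn p. vnorm p x \<le> real i + 1 \<and> vdir p x \<in> B} \<in> sets (leb p)" by simp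
    qed auto
    also have "\<dots> < \<infinity>"
      by (subst emeasure_leb_cone) (simp_all add: less_top[symmetric] ennreal_mult_eq_top_iff)
    finally show "emeasure L {..real i} \<noteq> \<infinity>" by simp
  next
    show "range (\<lambda>i. {..real i}) \<subseteq> range atMost" "(\<Union>i. {..real i}) = UNIV"
      by (auto simp: real_arch_simple)
  qed auto
  then have "emeasure (radial_measure p) A * emeasure (cone_measure p) B = emeasure L A"
    by (simp add: emeasure_density_const mult.commute)
  also have "\<dots> = emeasure (distr (leb p) (borel \<Otimes>\<^sub>M leb p) (\<lambda>x. (vnorm p x, vdir p x))) (A \<times> B)"
    by (subst emeasure_distr) (auto simp: meas_L intro!: arg_cong[where f="emeasure (leb p)"])
  finally show "emeasure (radial_measure p) A * emeasure (cone_measure p) B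
     = emeasure (distr (leb p) (borel \<Otimes>\<^sub>M leb p) (\<lambda>x. (vnorm p x, vdir p x))) (A \<times> B)" .
qed

(* Its conclusion unifies with every function application, which disturbs measurability proofs that
   are not about vectors. *)
declare measurable_component [measurable del]

section \<open>The chi law\<close>

definition half_moment :: "nat \<Rightarrow> real" where
  "half_moment n = (\<integral>r. indicator {0..} r * (r ^ n * exp (- r\<^sup>2 / 2)) \<partial>lborel)"

lemma integrable_half_moment:
  "integrable lborel (\<lambda>r::real. indicator {0..} r * (r ^ n * exp (- r\<^sup>2 / 2)))"
proof -
  have *: "integrable lborel (\<lambda>x::real. indicator {0..} x * (exp (-x\<^sup>2) * x ^ n))"
  proof (cases "even n")
    case True
    then obtain k where "n = 2 * k" by (elim evenE)
    then show ?thesis using gaussian_moment_even_pos[of k] by (simp add: has_bochner_integral_iff)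
  next
    case False
    then obtain k where "n = 2 * k + 1" by (elim oddE)
    then show ?thesis using gaussian_moment_odd_pos[of k] by (simp add: has_bochner_integral_iff)
  qed
  have "integrable lborel (\<lambda>r::real. sqrt 2 ^ n * (indicator {0..} (0 + (1 / sqrt 2) * r) *
      (exp (- (0 + (1 / sqrt 2) * r)\<^sup>2) * (0 + (1 / sqrt 2) * r) ^ n)))"
    by (intro integrable_mult_right lborel_integrable_real_affine *) simp
  also have "(\<lambda>r::real. sqrt 2 ^ n * (indicator {0..} (0 + (1 / sqrt 2) * r) *
      (exp (- (0 + (1 / sqrt 2) * r)\<^sup>2) * (0 + (1 / sqrt 2) * r) ^ n)))
      = (\<lambda>r::real. indicator {0..} r * (r ^ n * exp (- r\<^sup>2 / 2)))"
    by (auto simp: fun_eq_iff power_divide zero_le_divide_iff split: split_indicator)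
  finally show ?thesis .
qed

text \<open>
  Integration by parts, with the primitive \<open>r\<^sup>n\<^sup>+\<^sup>1 exp (- r\<^sup>2 / 2)\<close>, which
  vanishes at both ends.
\<close>

lemma half_moment_rec: "half_moment (n + 2) = (real n + 1) * half_moment n"
proof -
  let ?f = "\<lambda>r::real. (real n + 1) * (r ^ n * exp (- r\<^sup>2 / 2)) - r ^ (n + 2) * exp (- r\<^sup>2 / 2)"
  have int: "set_integrable lborel {0..} ?f"
    unfolding set_integrable_def
    using integrable_half_moment[of n] integrable_half_moment[of "n + 2"]
    by (auto simp: algebra_simps intro!: Bochner_Integration.integrable_diff Bochner_Integration.integrable_add)
  have "(LINT r:{0..}|lborel. ?f r) = 0"
  proof (rule LIMSEQ_unique)
    let ?A = "\<lambda>k. {0..real k}"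
    have "(\<lambda>k. LINT r:?A k|lborel. ?f r) \<longlonglongrightarrow> (LINT r:(\<Union>k. ?A k)|lborel. ?f r)"
    proof (rule set_integral_cont_up)
      show "set_integrable lborel (\<Union>k. ?A k) ?f"
        by (rule set_integrable_subset[OF int]) auto
    qed (auto simp: incseq_def)
    also have "(\<Union>k. ?A k) = {0::real..}" by (auto simp: real_arch_simple)
    finally show "(\<lambda>k. LINT r:?A k|lborel. ?f r) \<longlonglongrightarrow> (LINT r:{0..}|lborel. ?f r)" .
    have "(LINT r:?A k|lborel. ?f r) = real k ^ (n + 1) * exp (- (real k)\<^sup>2 / 2)" for k
    proof -
      have D: "((\<lambda>r::real. r ^ Suc n * exp (- r\<^sup>2 / 2)) has_real_derivative
         (real (Suc n) * x ^ n * exp (- x\<^sup>2 / 2) + x ^ Suc n * (exp (- x\<^sup>2 / 2) * - x))) (at x within S)" for x S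
        by (auto intro!: derivative_eq_intros simp del: power_Suc)
      have "(LINT r:?A k|lborel. ?f r) = real k ^ Suc n * exp (- (real k)\<^sup>2 / 2) - 0 ^ Suc n * exp (- 0\<^sup>2 / 2)"
        unfolding set_lebesgue_integral_def
      proof (rule integral_FTC_atLeastAtMost)
        fix x :: real
        show "((\<lambda>r. r ^ Suc n * exp (- r\<^sup>2 / 2)) has_vector_derivative ?f x) (at x within {0..real k})"
          using D[of x "{0..real k}"]
          by (simp add: has_real_derivative_iff_has_vector_derivative[symmetric] power2_eq_square algebra_simps)
      qed (auto intro!: continuous_intros)
      then show ?thesis by simp
    qed
    moreover have "(\<lambda>k. real k ^ (n + 1) * exp (- (real k)\<^sup>2 / 2)) \<longlonglongrightarrow> 0"
    proof (rule tendsto_sandwich[OF _ _ tendsto_const])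
      have "((\<lambda>x::real. x ^ (n + 1) / exp x) \<longlongrightarrow> 0) at_top" by (rule tendsto_power_div_exp_0)
      from filterlim_compose[OF this filterlim_real_sequentially]
      show "(\<lambda>k. real k ^ (n + 1) / exp (real k)) \<longlonglongrightarrow> 0" .
      show "\<forall>\<^sub>F k in sequentially. real k ^ (n + 1) * exp (- (real k)\<^sup>2 / 2) \<le> real k ^ (n + 1) / exp (real k)"
      proof (rule eventually_sequentiallyI[of 2])
        fix k :: nat assume "2 \<le> k"
        then have "2 * real k \<le> (real k)\<^sup>2" by (simp add: power2_eq_square)
        then have "exp (- (real k)\<^sup>2 / 2) \<le> exp (- real k)" by simp
        then show "real k ^ (n + 1) * exp (- (real k)\<^sup>2 / 2) \<le> real k ^ (n + 1) / exp (real k)"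
          using mult_left_mono[of "exp (- (real k)\<^sup>2 / 2)" "exp (- real k)" "real k ^ (n + 1)"]
          by (simp only: exp_minus[of "real k"] divide_inverse[of _ "exp (real k)"]) simp
      qed
    qed simp
    ultimately show "(\<lambda>k. LINT r:?A k|lborel. ?f r) \<longlonglongrightarrow> 0" by (simp only:)
  qed
  also have "(LINT r:{0..}|lborel. ?f r) = (real n + 1) * half_moment n - half_moment (n + 2)"
  proof -
    have "(LINT r:{0..}|lborel. ?f r) = (\<integral>r. (real n + 1) * (indicator {0..} r * (r ^ n * exp (- r\<^sup>2 / 2)))
        - indicator {0..} r * (r ^ (n + 2) * exp (- r\<^sup>2 / 2)) \<partial>lborel)"
      unfolding set_lebesgue_integral_def
      by (rule Bochner_Integration.integral_cong[OF refl]) (simp add: indicator_def)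
    also have "\<dots> = (real n + 1) * half_moment n - half_moment (n + 2)"
      unfolding half_moment_def
      using integrable_half_moment[of n] integrable_half_moment[of "n + 2"]
      by (subst Bochner_Integration.integral_diff) (auto simp del: power_add power_Suc)
    finally show ?thesis .
  qed
  finally show ?thesis by simp
qed

text \<open>
  The integral restricted to \<open>{0..\<surd>p}\<close>, with the exponential replaced by its value at
  \<open>\<surd>p\<close>. The integrand has its maximum close to \<open>\<surd>p\<close>, so this only loses a
  power of \<open>p\<close>.
\<close>

lemma half_moment_lower:
  assumes "1 \<le> p"
  shows "exp (- real p / 2) * sqrt (real p) ^ p / real p \<le> half_moment (p - 1)"
proof -
  have s: "sqrt (real p) ^ 2 = real p" by simp
  have "exp (- real p / 2) * (sqrt (real p) ^ p / real p)
     = (\<integral>r. indicator {0..sqrt (real p)} r *\<^sub>R (exp (- real p / 2) * r ^ (p - 1)) \<partial>lborel)"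
  proof -
    have "(\<integral>r. indicator {0..sqrt (real p)} r *\<^sub>R (exp (- real p / 2) * r ^ (p - 1)) \<partial>lborel)
      = exp (- real p / 2) * (sqrt (real p) ^ p / real p) - exp (- real p / 2) * (0 ^ p / real p)"
      by (rule integral_FTC_atLeastAtMost)
         (use assms in \<open>auto intro!: derivative_eq_intros continuous_intros
             simp: has_real_derivative_iff_has_vector_derivative[symmetric]\<close>)
    then show ?thesis using assms by (simp add: zero_power)
  qed
  also have "\<dots> \<le> half_moment (p - 1)"
    unfolding half_moment_def
  proof (rule integral_mono[OF _ integrable_half_moment])
    show "integrable lborel (\<lambda>r. indicator {0..sqrt (real p)} r *\<^sub>R (exp (- real p / 2) * r ^ (p - 1)))"
      by (intro borel_integrable_compact continuous_intros) auto
    fix r :: real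
    have "r\<^sup>2 \<le> real p" if "0 \<le> r" "r \<le> sqrt (real p)"
      using power_mono[OF that(2,1), of 2] s by simp
    then show "indicator {0..sqrt (real p)} r *\<^sub>R (exp (- real p / 2) * r ^ (p - 1))
       \<le> indicator {0..} r * (r ^ (p - 1) * exp (- r\<^sup>2 / 2))"
      by (auto split: split_indicator simp: mult.commute intro!: mult_left_mono)
  qed
  finally show ?thesis by simp
qed

lemma half_moment_pos:
  assumes "1 \<le> p" shows "0 < half_moment (p - 1)"
  by (rule less_le_trans[OF _ half_moment_lower[OF assms]]) (use assms in simp)

lemma integrable_exp_tail:
  assumes "0 < a"
  shows "integrable lborel (\<lambda>r::real. indicator {0..} r * (r ^ n * exp (- (a * r))))" (is ?int)
    and "(\<integral>r. indicator {0..} r * (r ^ n * exp (- (a * r))) \<partial>lborel) = fact n / a ^ (n + 1)" (is ?eq)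
proof -
  have "has_bochner_integral lborel (erlang_density n a) 1"
    using nn_integral_erlang_ith_moment[OF assms, of n 0] assms
    by (intro has_bochner_integral_nn_integral) auto
  then have "has_bochner_integral lborel (\<lambda>r. erlang_density n a r * (fact n / a ^ (n + 1))) (1 * (fact n / a ^ (n + 1)))"
    by (rule has_bochner_integral_mult_left)
  also have "(\<lambda>r. erlang_density n a r * (fact n / a ^ (n + 1))) = (\<lambda>r. indicator {0..} r * (r ^ n * exp (- (a * r))))"
    using assms by (auto simp: fun_eq_iff erlang_density_def split: split_indicator)
  finally show ?int ?eq by (auto simp: has_bochner_integral_iff)
qed

definition chi :: "nat \<Rightarrow> real measure" where
  "chi p = density lborel (\<lambda>r. ennreal (indicator {0..} r * (r ^ (p - 1) * exp (- r\<^sup>2 / 2)) / half_moment (p - 1)))"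

lemma sets_chi [simp, measurable_cong]: "sets (chi p) = sets borel"
  and space_chi [simp]: "space (chi p) = UNIV"
  by (simp_all add: chi_def)

lemma prob_space_chi:
  assumes "1 \<le> p" shows "prob_space (chi p)"
proof
  have "emeasure (chi p) (space (chi p))
     = (\<integral>\<^sup>+r. ennreal (indicator {0..} r * (r ^ (p - 1) * exp (- r\<^sup>2 / 2)) / half_moment (p - 1)) \<partial>lborel)"
    by (simp add: chi_def emeasure_density)
  also have "\<dots> = ennreal (\<integral>r. indicator {0..} r * (r ^ (p - 1) * exp (- r\<^sup>2 / 2)) / half_moment (p - 1) \<partial>lborel)"
    by (rule nn_integral_eq_integral)
       (use half_moment_pos[OF assms] integrable_half_moment[of "p - 1"] in \<open>auto split: split_indicator\<close>)
  also have "\<dots> = 1" using half_moment_pos[OF assms] by (simp add: half_moment_def)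
  finally show "emeasure (chi p) (space (chi p)) = 1" .
qed

lemma AE_chi_nonneg: "AE r in chi p. 0 \<le> r"
  unfolding chi_def by (subst AE_density) (auto intro!: AE_I2 split: split_indicator)

lemma integrable_chi_iff:
  assumes "1 \<le> p" "f \<in> borel_measurable borel"
  shows "integrable (chi p) f \<longleftrightarrow>
    integrable lborel (\<lambda>r. indicator {0..} r * (r ^ (p - 1) * exp (- r\<^sup>2 / 2)) * f r)"
proof -
  have "integrable (chi p) f \<longleftrightarrow>
    integrable lborel (\<lambda>r. indicator {0..} r * (r ^ (p - 1) * exp (- r\<^sup>2 / 2)) / half_moment (p - 1) * f r)"
    unfolding chi_def using half_moment_pos[OF assms(1)] assms(2)
    by (subst integrable_real_density) (auto split: split_indicator)
  also have "\<dots> \<longleftrightarrow> integrable lborel (\<lambda>r. (indicator {0..} r * (r ^ (p - 1) * exp (- r\<^sup>2 / 2)) * f r) / half_moment (p - 1))"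
    by simp
  also have "\<dots> \<longleftrightarrow> integrable lborel (\<lambda>r. indicator {0..} r * (r ^ (p - 1) * exp (- r\<^sup>2 / 2)) * f r)"
    using half_moment_pos[OF assms(1)] by (simp only: divide_inverse integrable_mult_right_iff) simp
  finally show ?thesis .
qed

lemma integral_chi:
  assumes "1 \<le> p" "f \<in> borel_measurable borel"
  shows "(\<integral>r. f r \<partial>chi p) =
    (\<integral>r. indicator {0..} r * (r ^ (p - 1) * exp (- r\<^sup>2 / 2)) * f r \<partial>lborel) / half_moment (p - 1)"
proof -
  have "(\<integral>r. f r \<partial>chi p) =
    (\<integral>r. indicator {0..} r * (r ^ (p - 1) * exp (- r\<^sup>2 / 2)) / half_moment (p - 1) * f r \<partial>lborel)"
    unfolding chi_def using half_moment_pos[OF assms(1)] assms(2)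
    by (subst integral_real_density) (auto split: split_indicator)
  then show ?thesis by simp
qed

lemma integrable_chi_power: assumes "1 \<le> p" shows "integrable (chi p) (\<lambda>r. r ^ k)"
proof -
  have "(\<lambda>r::real. indicator {0..} r * (r ^ (p - 1) * exp (- r\<^sup>2 / 2)) * r ^ k)
    = (\<lambda>r. indicator {0..} r * (r ^ (p - 1 + k) * exp (- r\<^sup>2 / 2)))"
    by (simp add: fun_eq_iff power_add)
  then show ?thesis using integrable_half_moment[of "p - 1 + k"] assms
    by (simp add: integrable_chi_iff)
qed

lemma chi_power: assumes "1 \<le> p"
  shows "(\<integral>r. r ^ k \<partial>chi p) = half_moment (p - 1 + k) / half_moment (p - 1)"
proof -
  have "(\<lambda>r::real. indicator {0..} r * (r ^ (p - 1) * exp (- r\<^sup>2 / 2)) * r ^ k)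
    = (\<lambda>r. indicator {0..} r * (r ^ (p - 1 + k) * exp (- r\<^sup>2 / 2)))"
    by (simp add: fun_eq_iff power_add)
  then show ?thesis using assms by (simp add: integral_chi half_moment_def)
qed

lemma chi_even_power: assumes "1 \<le> p"
  shows "(\<integral>r. r ^ (2 * j) \<partial>chi p) = (\<Prod>i<j. real p + 2 * real i)"
proof (induction j)
  case 0
  then show ?case using half_moment_pos[OF assms] chi_power[OF assms, of 0] by simp
next
  case (Suc j)
  have "half_moment (p - 1 + 2 * Suc j) = (real p + 2 * real j) * half_moment (p - 1 + 2 * j)"
    using half_moment_rec[of "p - 1 + 2 * j"] assms by (simp add: of_nat_diff add_ac)
  then have "(\<integral>r. r ^ (2 * Suc j) \<partial>chi p) = (real p + 2 * real j) * (\<integral>r. r ^ (2 * j) \<partial>chi p)"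
    using assms by (simp only: chi_power) simp
  then show ?case using Suc by (simp add: mult.commute)
qed

lemma exp_half_le_two_power: "exp (real p / 2) \<le> 2 ^ p"
proof -
  have "exp (1/2 :: real) \<le> 2"
  proof -
    have "exp (1::real) \<le> 2\<^sup>2" using e_less_272 by simp
    moreover have "exp (1::real) = (exp (1/2))\<^sup>2" by (simp add: power2_eq_square flip: exp_add)
    ultimately show ?thesis by (metis power2_le_imp_le zero_le_numeral)
  qed
  then have "exp (1/2 :: real) ^ p \<le> 2 ^ p" by (intro power_mono) auto
  then show ?thesis by (simp add: exp_of_nat_mult[symmetric])
qed

lemma fact_add_le: "fact (n + k) \<le> fact n * (real n + real k) ^ k"
proof (induction k)
  case (Suc k)
  have "fact (n + Suc k) = (real n + real (Suc k)) * fact (n + k)" by (simp add: add_ac)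
  also have "\<dots> \<le> (real n + real (Suc k)) * (fact n * (real n + real k) ^ k)"
    by (intro mult_left_mono Suc) simp
  also have "\<dots> \<le> (real n + real (Suc k)) * (fact n * (real n + real (Suc k)) ^ k)"
    by (intro mult_left_mono power_mono) auto
  finally show ?case by (simp add: mult_ac)
qed simp

text \<open>
  The left-hand side is \<open>(p - 1 + k)! / (17 \<surd>p)\<^sup>p\<^sup>+\<^sup>k\<close>. Against the
  normalization of the chi law, which is at least \<open>exp (- p / 2) p\<^sup>p\<^sup>/\<^sup>2 / p\<close>,
  the powers of \<open>p\<close> cancel and there remains a power of \<open>exp (1/2) / 17\<close>. So an
  exponential tail of rate \<open>17 \<surd>p\<close> is exponentially small in \<open>p\<close>. The
  restriction on \<open>k\<close> gives \<open>p - 1 + k \<le> 17 p\<close>.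
\<close>

lemma exp_tail_moment_bound:
  assumes p: "1 \<le> p" and k: "k \<le> 16"
  shows "(\<integral>r. indicator {0..} r * (r ^ (p - 1 + k) * exp (- (17 * sqrt (real p) * r))) \<partial>lborel)
     \<le> sqrt (real p) ^ k * (2 / 17) ^ p * half_moment (p - 1)"
proof -
  define s where "s = sqrt (real p)"
  have s: "0 < s" "s * s = real p" using p by (simp_all add: s_def)
  have P: "real p > 0" using p by simp
  have e: "p - 1 + k + 1 = p + k" using p by simp
  have "(\<integral>r. indicator {0..} r * (r ^ (p - 1 + k) * exp (- (17 * s * r))) \<partial>lborel)
     = fact (p - 1 + k) / (17 * s) ^ (p + k)"
    using integrable_exp_tail(2)[of "17 * s" "p - 1 + k"] s e by simp
  also have "\<dots> \<le> fact (p - 1) * (17 * real p) ^ k / (17 * s) ^ (p + k)"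
  proof (intro divide_right_mono order.trans[OF fact_add_le] mult_left_mono power_mono)
    show "real (p - 1) + real k \<le> 17 * real p" using p k by (simp add: of_nat_diff)
  qed (use s in auto)
  also have "\<dots> = fact (p - 1) * s ^ k / (17 * s) ^ p"
    unfolding s(2)[symmetric] using s(1) by (simp add: power_add power_mult_distrib)
  also have "\<dots> \<le> s ^ k * (2 / 17) ^ p * half_moment (p - 1)"
  proof -
    have "fact (p - 1) * real p = (fact p :: real)" using p by (cases p) (auto simp: algebra_simps)
    also have "\<dots> \<le> real p ^ p" using fact_le_power[of p, where 'a=real] by simp
    also have "real p ^ p = s ^ p * s ^ p" by (simp add: s(2)[symmetric] power_mult_distrib)
    finally have "fact (p - 1) / s ^ p \<le> s ^ p / real p"
      using s P by (simp add: field_simps)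
    also have "\<dots> = exp (real p / 2) * (exp (- real p / 2) * s ^ p / real p)"
      by (simp flip: exp_add add: mult.assoc[symmetric])
    also have "\<dots> \<le> 2 ^ p * half_moment (p - 1)"
      using half_moment_lower[OF p] exp_half_le_two_power[of p] s P unfolding s_def[symmetric]
      by (intro mult_mono) auto
    finally have "fact (p - 1) / s ^ p * (s ^ k / 17 ^ p) \<le> 2 ^ p * half_moment (p - 1) * (s ^ k / 17 ^ p)"
      by (rule mult_right_mono) (use s in simp)
    then show ?thesis by (simp add: power_mult_distrib power_divide mult_ac)
  qed
  finally show ?thesis by (simp add: s_def)
qed

section \<open>A weighted Poincare inequality on the half-line\<close>

text \<open>
  A ground state substitution. Let \<open>v = f - f m\<close> and \<open>T = A v\<^sup>2 / H\<close>. Since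
  \<open>A' = - \<rho> H\<close>, \<open>T' = - \<rho> v\<^sup>2 + A (2 (v / H) f' - (v / H)\<^sup>2
  H')\<close>, and completing the square bounds the bracket by \<open>f'\<^sup>2 / H'\<close>. With \<open>A
  \<le> \<rho> w H'\<close> this makes \<open>T'\<close> at most the integrand. The boundary terms have the
  right sign: \<open>T\<close> tends to \<open>0\<close> at \<open>m\<close>, where \<open>v\<close> and
  \<open>H\<close> both have a zero, and it is nonnegative at \<open>b\<close>.

  For \<open>A = \<rho>\<close> the weight is \<open>w = 1 / H'\<close> with \<open>H = - (ln \<rho>)'\<close>,
  as in the Brascamp-Lieb inequality. A different \<open>A\<close> covers weights for which this fails.
\<close>

lemma poincare_right:
  fixes f f' A H H' \<rho> w :: "real \<Rightarrow> real"
  assumes m: "m < b"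
    and f: "\<And>x. x \<in> {m..b} \<Longrightarrow> (f has_real_derivative f' x) (at x)"
    and A: "\<And>x. x \<in> {m..b} \<Longrightarrow> (A has_real_derivative - \<rho> x * H x) (at x)"
    and H: "\<And>x. x \<in> {m..b} \<Longrightarrow> (H has_real_derivative H' x) (at x)"
    and H'_pos: "\<And>x. x \<in> {m..b} \<Longrightarrow> 0 < H' x"
    and Hm: "H m = 0"
    and A_nonneg: "\<And>x. x \<in> {m..b} \<Longrightarrow> 0 \<le> A x"
    and A_le: "\<And>x. x \<in> {m..b} \<Longrightarrow> A x \<le> \<rho> x * w x * H' x"
    and cont: "continuous_on {m..b} \<rho>" "continuous_on {m..b} w" "continuous_on {m..b} f'"
  shows "0 \<le> integral {m..b} (\<lambda>x. \<rho> x * (w x * (f' x)\<^sup>2 - (f x - f m)\<^sup>2))"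
proof -
  define L where "L = (\<lambda>x. \<rho> x * (w x * (f' x)\<^sup>2 - (f x - f m)\<^sup>2))"
  define v where "v = (\<lambda>x. f x - f m)"
  define T where "T = (\<lambda>x. A x * (v x)\<^sup>2 / H x)"
  have H_pos: "0 < H x" if "m < x" "x \<le> b" for x
  proof -
    have "H m < H x"
      by (rule DERIV_pos_imp_increasing[OF that(1)]) (use H H'_pos that in \<open>force\<close>)
    then show ?thesis by (simp add: Hm)
  qed
  have f_cont: "continuous_on {m..b} f"
    using f by (meson DERIV_isCont continuous_at_imp_continuous_on)
  have L_cont: "continuous_on {m..b} L"
    unfolding L_def by (intro continuous_intros cont f_cont)
  have v: "(v has_real_derivative f' x) (at x)" if "x \<in> {m..b}" for x
    unfolding v_def using f[OF that] by (auto intro!: derivative_eq_intros)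
  define T' where "T' = (\<lambda>x. - \<rho> x * (v x)\<^sup>2 + A x * (2 * v x * f' x / H x - (v x)\<^sup>2 * H' x / (H x)\<^sup>2))"
  have T: "(T has_real_derivative T' x) (at x)" if "m < x" "x \<le> b" for x
  proof -
    have mem: "x \<in> {m..b}" using that by auto
    have "H x \<noteq> 0" using H_pos that by force
    then show ?thesis unfolding T_def T'_def
      using A[OF mem] v[OF mem] H[OF mem]
      by (auto intro!: derivative_eq_intros simp: field_simps power2_eq_square)
  qed
  have T'_le: "T' x \<le> L x" if "m < x" "x \<le> b" for x
  proof -
    have mem: "x \<in> {m..b}" using that by auto
    define q where "q = v x / H x"
    have "2 * q * f' x - q\<^sup>2 * H' x \<le> (f' x)\<^sup>2 / H' x"
    proof -
      have "0 \<le> (q * H' x - f' x)\<^sup>2 / H' x" using H'_pos[OF mem] by simp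
      also have "\<dots> = q\<^sup>2 * H' x - 2 * q * f' x + (f' x)\<^sup>2 / H' x"
        using H'_pos[OF mem] by (simp add: field_simps power2_eq_square)
      finally show ?thesis by simp
    qed
    then have "A x * (2 * q * f' x - q\<^sup>2 * H' x) \<le> A x * ((f' x)\<^sup>2 / H' x)"
      by (rule mult_left_mono[OF _ A_nonneg[OF mem]])
    also have "\<dots> \<le> \<rho> x * w x * H' x * ((f' x)\<^sup>2 / H' x)"
      by (rule mult_right_mono[OF A_le[OF mem]]) (use H'_pos[OF mem] in simp)
    also have "\<dots> = \<rho> x * w x * (f' x)\<^sup>2" using H'_pos[OF mem] by simp
    finally show ?thesis
      by (simp add: T'_def L_def q_def v_def[symmetric] power_divide right_diff_distrib)
         (simp add: v_def mult_ac)
  qed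
  have T_at_m: "(T \<longlongrightarrow> 0) (at_right m)"
  proof -
    have vm: "((\<lambda>x. v x / (x - m)) \<longlongrightarrow> f' m) (at_right m)"
      using v[of m] m unfolding has_field_derivative_iff
      by (auto simp: v_def intro: tendsto_mono[OF at_le])
    have Hq: "((\<lambda>x. H x / (x - m)) \<longlongrightarrow> H' m) (at_right m)"
      using H[of m] m unfolding has_field_derivative_iff
      by (auto simp: Hm intro: tendsto_mono[OF at_le])
    have Ac: "(A \<longlongrightarrow> A m) (at_right m)"
      using DERIV_isCont[OF A[of m]] m unfolding isCont_def by (auto intro: tendsto_mono[OF at_le])
    have xm: "((\<lambda>x. x - m) \<longlongrightarrow> m - m) (at_right m)" by (intro tendsto_intros)
    have "((\<lambda>x. A x * ((v x / (x - m))\<^sup>2 * (x - m)) / (H x / (x - m))) \<longlongrightarrow> A m * ((f' m)\<^sup>2 * (m - m)) / H' m) (at_right m)"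
      using H'_pos[of m] m by (intro tendsto_intros vm Hq Ac xm) auto
    then have lim: "((\<lambda>x. A x * ((v x / (x - m))\<^sup>2 * (x - m)) / (H x / (x - m))) \<longlongrightarrow> 0) (at_right m)" by simp
    have alg: "a * ((c / d)\<^sup>2 * d) / (h / d) = a * c\<^sup>2 / h" if "d \<noteq> 0" for a c d h :: real
      using that by (cases "h = 0") (simp_all add: field_simps power2_eq_square)
    have "\<forall>\<^sub>F x in at_right m. A x * ((v x / (x - m))\<^sup>2 * (x - m)) / (H x / (x - m)) = T x"
      unfolding eventually_at_right[OF m]
      by (rule exI[of _ b]) (use m alg in \<open>auto simp: T_def\<close>)
    from Lim_transform_eventually[OF lim this] show ?thesis .
  qed
  \<comment> \<open>\<open>U\<close> increases since \<open>T' \<le> L\<close>, and it vanishes at \<open>m\<close>.\<close>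
  define U where "U = (\<lambda>x. integral {m..x} L - T x)"
  have "U m \<le> U b"
  proof (rule DERIV_nonneg_imp_increasing_open[where f=U])
    show "m \<le> b" using m by simp
    show "\<exists>y. DERIV U x :> y \<and> 0 \<le> y" if x: "m < x" "x < b" for x
    proof (intro exI conjI)
      have "((\<lambda>x. integral {m..x} L) has_real_derivative L x) (at x within {m..b})"
        by (rule integral_has_real_derivative[OF L_cont]) (use x in auto)
      then have "((\<lambda>x. integral {m..x} L) has_real_derivative L x) (at x)"
        using x at_within_Icc_at[of m x b] by simp
      then show "DERIV U x :> L x - T' x"
        unfolding U_def using T[of x] x by (auto intro!: derivative_eq_intros)
      show "0 \<le> L x - T' x" using T'_le[of x] x by simp
    qed
    have "continuous_on {m..b} (\<lambda>x. integral {m..x} L)"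
      by (rule indefinite_integral_continuous_1) (rule integrable_continuous_real[OF L_cont])
    moreover have "continuous_on {m..b} T"
      unfolding continuous_on_eq_continuous_within
    proof
      fix x assume x: "x \<in> {m..b}"
      show "continuous (at x within {m..b}) T"
      proof (cases "x = m")
        case True
        then show ?thesis using T_at_m m
          by (simp add: continuous_within T_def v_def at_within_Icc_at_right)
      next
        case False
        then show ?thesis using x T[of x] DERIV_isCont continuous_at_imp_continuous_at_within
          by (metis atLeastAtMost_iff less_eq_real_def)
      qed
    qed
    ultimately show "continuous_on {m..b} U" unfolding U_def by (intro continuous_on_diff)
  qed
  moreover have "U m = 0" by (simp add: U_def T_def v_def)
  moreover have "0 \<le> T b" using H_pos[of b] A_nonneg[of b] m by (simp add: T_def)
  ultimately show ?thesis unfolding U_def L_def[symmetric] by simp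
qed

lemma poincare_left:
  fixes f f' A H H' \<rho> w :: "real \<Rightarrow> real"
  assumes m: "a < m"
    and f: "\<And>x. x \<in> {a..m} \<Longrightarrow> (f has_real_derivative f' x) (at x)"
    and A: "\<And>x. x \<in> {a..m} \<Longrightarrow> (A has_real_derivative - \<rho> x * H x) (at x)"
    and H: "\<And>x. x \<in> {a..m} \<Longrightarrow> (H has_real_derivative H' x) (at x)"
    and H'_pos: "\<And>x. x \<in> {a..m} \<Longrightarrow> 0 < H' x"
    and Hm: "H m = 0"
    and A_nonneg: "\<And>x. x \<in> {a..m} \<Longrightarrow> 0 \<le> A x"
    and A_le: "\<And>x. x \<in> {a..m} \<Longrightarrow> A x \<le> \<rho> x * w x * H' x"
    and cont: "continuous_on {a..m} \<rho>" "continuous_on {a..m} w" "continuous_on {a..m} f'"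
  shows "0 \<le> integral {a..m} (\<lambda>x. \<rho> x * (w x * (f' x)\<^sup>2 - (f x - f m)\<^sup>2))"
proof -
  have "0 \<le> integral {- m..- a} (\<lambda>x. \<rho> (- x) * (w (- x) * (- f' (- x))\<^sup>2 - (f (- x) - f (- (- m)))\<^sup>2))"
  proof (rule poincare_right[where f="\<lambda>x. f (- x)" and f'="\<lambda>x. - f' (- x)" and A="\<lambda>x. A (- x)"
        and H="\<lambda>x. - H (- x)" and H'="\<lambda>x. H' (- x)" and \<rho>="\<lambda>x. \<rho> (- x)" and w="\<lambda>x. w (- x)"
        and m="- m" and b="- a"])
    fix x assume "x \<in> {- m..- a}"
    then have x: "- x \<in> {a..m}" by auto
    show "((\<lambda>x. f (- x)) has_real_derivative - f' (- x)) (at x)"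
      using f[OF x] by (simp add: DERIV_mirror)
    show "((\<lambda>x. A (- x)) has_real_derivative - \<rho> (- x) * - H (- x)) (at x)"
      using A[OF x] by (simp add: DERIV_mirror)
    have "((\<lambda>x. H (- x)) has_real_derivative - H' (- x)) (at x)"
      using H[OF x] by (simp add: DERIV_mirror)
    then show "((\<lambda>x. - H (- x)) has_real_derivative H' (- x)) (at x)"
      by (auto intro!: derivative_eq_intros)
    show "0 < H' (- x)" "0 \<le> A (- x)" "A (- x) \<le> \<rho> (- x) * w (- x) * H' (- x)"
      using H'_pos[OF x] A_nonneg[OF x] A_le[OF x] by auto
  next
    have im: "uminus ` {- m..- a} = {a..m}" by auto
    show "continuous_on {- m..- a} (\<lambda>x. \<rho> (- x))" "continuous_on {- m..- a} (\<lambda>x. w (- x))"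
      "continuous_on {- m..- a} (\<lambda>x. - f' (- x))"
      by (intro continuous_intros continuous_on_compose2[OF cont(1)] continuous_on_compose2[OF cont(2)]
          continuous_on_compose2[OF cont(3)]; auto)+
  qed (use m Hm in auto)
  also have "\<dots> = integral {- m..- a} (\<lambda>x. (\<lambda>x. \<rho> x * (w x * (f' x)\<^sup>2 - (f x - f m)\<^sup>2)) (- x))" by simp
  also have "\<dots> = integral {a..m} (\<lambda>x. \<rho> x * (w x * (f' x)\<^sup>2 - (f x - f m)\<^sup>2))"
    by (rule Henstock_Kurzweil_Integration.integral_reflect_real)
  finally show ?thesis .
qed

text \<open>
  The point \<open>m\<close> splits every \<open>{a..b}\<close> into an interval on its right and one on its
  left, and the boundary terms at \<open>a\<close> and \<open>b\<close> have the right sign. So the inequality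
  holds on \<open>{a..b}\<close> and passes to the limit by integrability.
\<close>

theorem weighted_poincare:
  fixes f f' A H H' \<rho> w :: "real \<Rightarrow> real"
  assumes m: "0 < m"
    and f: "\<And>x. 0 < x \<Longrightarrow> (f has_real_derivative f' x) (at x)"
    and A: "\<And>x. 0 < x \<Longrightarrow> (A has_real_derivative - \<rho> x * H x) (at x)"
    and H: "\<And>x. 0 < x \<Longrightarrow> (H has_real_derivative H' x) (at x)"
    and H'_pos: "\<And>x. 0 < x \<Longrightarrow> 0 < H' x"
    and Hm: "H m = 0"
    and A_nonneg: "\<And>x. 0 < x \<Longrightarrow> 0 \<le> A x"
    and A_le: "\<And>x. 0 < x \<Longrightarrow> A x \<le> \<rho> x * w x * H' x"
    and cont: "continuous_on {0<..} \<rho>" "continuous_on {0<..} w" "continuous_on {0<..} f'"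
    and int: "set_integrable lborel {0<..} (\<lambda>x. \<rho> x * (w x * (f' x)\<^sup>2 - (f x - f m)\<^sup>2))"
  shows "0 \<le> (LINT x:{0<..}|lborel. \<rho> x * (w x * (f' x)\<^sup>2 - (f x - f m)\<^sup>2))"
proof -
  define L where "L = (\<lambda>x. \<rho> x * (w x * (f' x)\<^sup>2 - (f x - f m)\<^sup>2))"
  have f_cont: "continuous_on {0<..} f"
    using f by (meson DERIV_isCont continuous_at_imp_continuous_on greaterThan_iff)
  have L_cont: "continuous_on {0<..} L"
    unfolding L_def by (intro continuous_intros cont f_cont)
  have pos: "0 \<le> (LINT x:{a..b}|lborel. L x)" if ab: "0 < a" "a < m" "m < b" for a b
  proof -
    have Lc: "continuous_on {a..b} L" by (rule continuous_on_subset[OF L_cont]) (use ab in auto)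
    have "(LINT x:{a..b}|lborel. L x) = integral {a..b} L"
      using Lc by (intro set_borel_integral_eq_integral borel_integrable_atLeastAtMost')
    also have "\<dots> = integral {a..m} L + integral {m..b} L"
      using ab by (intro Henstock_Kurzweil_Integration.integral_combine[symmetric] integrable_continuous_real[OF Lc]) auto
    also have "\<dots> \<ge> 0"
    proof (rule add_nonneg_nonneg)
      show "0 \<le> integral {a..m} L" unfolding L_def
        by (rule poincare_left[where A=A and H=H and H'=H'])
           (use ab f A H H'_pos Hm A_nonneg A_le in \<open>auto intro!: continuous_on_subset[OF cont(1)]
              continuous_on_subset[OF cont(2)] continuous_on_subset[OF cont(3)]\<close>)
      show "0 \<le> integral {m..b} L" unfolding L_def
        by (rule poincare_right[where A=A and H=H and H'=H'])
           (use ab f A H H'_pos Hm A_nonneg A_le in \<open>auto intro!: continuous_on_subset[OF cont(1)]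
              continuous_on_subset[OF cont(2)] continuous_on_subset[OF cont(3)]\<close>)
    qed
    finally show ?thesis .
  qed
  let ?A = "\<lambda>n. {1 / real (Suc n)..real n}"
  have U: "(\<Union>n. ?A n) = {0<..}"
  proof (rule set_eqI)
    fix x :: real
    show "x \<in> (\<Union>n. ?A n) \<longleftrightarrow> x \<in> {0<..}"
    proof
      assume "x \<in> (\<Union>n. ?A n)"
      then obtain n where "1 / real (Suc n) \<le> x" by auto
      moreover have "0 < 1 / real (Suc n)" by simp
      ultimately have "0 < x" by linarith
      then show "x \<in> {0<..}" by simp
    next
      assume x: "x \<in> {0<..}"
      obtain n where n: "max x (1 / x) < real n" using reals_Archimedean2 by blast
      then have "1 / real (Suc n) \<le> x" using x by (simp add: field_simps)
      then show "x \<in> (\<Union>n. ?A n)" using n by (intro UN_I[of n]) auto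
    qed
  qed
  have "(\<lambda>n. LINT x:?A n|lborel. L x) \<longlonglongrightarrow> (LINT x:(\<Union>n. ?A n)|lborel. L x)"
  proof (rule set_integral_cont_up)
    show "incseq ?A" by (auto simp: incseq_def frac_le)
    show "set_integrable lborel (\<Union>n. ?A n) L" using int U by (simp add: L_def)
  qed auto
  then have "(\<lambda>n. LINT x:?A n|lborel. L x) \<longlonglongrightarrow> (LINT x:{0<..}|lborel. L x)" by (simp only: U)
  moreover have "\<forall>\<^sub>F n in sequentially. 0 \<le> (LINT x:?A n|lborel. L x)"
  proof -
    obtain n where n: "max m (1 / m) < real n" using reals_Archimedean2 by blast
    show ?thesis
    proof (rule eventually_sequentiallyI[of n])
      fix k assume "n \<le> k"
      then have "max m (1 / m) < real k" using n by (meson less_le_trans of_nat_le_iff)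
      then show "0 \<le> (LINT x:?A k|lborel. L x)" using m by (intro pos) (auto simp: field_simps)
    qed
  qed
  ultimately show ?thesis unfolding L_def by (rule tendsto_lowerbound) simp
qed

section \<open>The Poincare inequality of the chi law\<close>

text \<open>
  The condition \<open>A \<le> \<rho> w H'\<close> for \<open>A = \<rho>\<close>, where \<open>\<rho> =
  r\<^sup>p\<^sup>-\<^sup>1 exp (- r\<^sup>2 / 2)\<close> and so \<open>H' = 1 + (p - 1) / r\<^sup>2\<close>. As
  \<open>p - 1 \<ge> p / 2\<close>, it reduces to \<open>u\<^sup>2 + 1 / (2 u) \<ge> 51/50\<close> for \<open>u
  = (r\<^sup>2 / p)\<^sup>1\<^sup>/\<^sup>3\<close>.
\<close>

lemma chi_poincare_weight_ge_2:
  fixes r :: real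
  assumes p: "2 \<le> p" and r: "0 < r"
  shows "51/50 * real p powr (2/3) \<le> r powr (4/3) * (1 + (real p - 1) / r\<^sup>2)"
proof -
  have P: "0 < real p" using p by simp
  define u where "u = (r\<^sup>2 / real p) powr (1/3)"
  have u: "0 < u" using r P by (simp add: u_def)
  have u3: "u ^ 3 = r\<^sup>2 / real p"
    using r P by (simp add: u_def powr_power)
  have u2: "u\<^sup>2 = r powr (4/3) / real p powr (2/3)"
  proof -
    have "u\<^sup>2 = (r\<^sup>2 / real p) powr (2/3)"
      using r P by (simp add: u_def powr_power)
    also have "\<dots> = (r\<^sup>2) powr (2/3) / real p powr (2/3)" using P by (simp add: powr_divide)
    also have "(r\<^sup>2) powr (2/3) = r powr (4/3)"
    proof -
      have "r\<^sup>2 = r powr 2" using r by (simp add: powr_numeral)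
      then show ?thesis by (simp only: powr_powr) simp
    qed
    finally show ?thesis .
  qed
  \<comment> \<open>\<open>3/5\<close> approximates the minimizer \<open>4\<^sup>-\<^sup>1\<^sup>/\<^sup>3\<close>; \<open>6/5\<close> removes the quadratic term.\<close>
  have "0 \<le> (u - 3/5)\<^sup>2 * (u + 6/5)" using u by simp
  then have cubic: "51/25 * u \<le> 2 * u ^ 3 + 1"
  proof -
    have "(u - 3/5)\<^sup>2 * (u + 6/5) = u ^ 3 - 27/25 * u + 54/125"
      by (simp add: power2_eq_square power3_eq_cube field_simps)
    with \<open>0 \<le> (u - 3/5)\<^sup>2 * (u + 6/5)\<close> u show ?thesis by linarith
  qed
  have "51/50 \<le> u\<^sup>2 * (1 + 1 / (2 * u ^ 3))"
  proof -
    have "u\<^sup>2 * (1 + 1 / (2 * u ^ 3)) = (2 * u ^ 3 + 1) / (2 * u)"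
      using u by (simp add: field_simps power2_eq_square power3_eq_cube)
    moreover have "51/50 \<le> (2 * u ^ 3 + 1) / (2 * u)"
      using cubic u by (simp add: pos_le_divide_eq)
    ultimately show ?thesis by simp
  qed
  also have "\<dots> \<le> u\<^sup>2 * (1 + (real p - 1) / r\<^sup>2)"
  proof -
    have "1 / (2 * u ^ 3) \<le> (real p - 1) / r\<^sup>2"
      unfolding u3 using p r P by (simp add: field_simps)
    then show ?thesis using u by (intro mult_left_mono) auto
  qed
  also have "u\<^sup>2 = r powr (4/3) / real p powr (2/3)" by (rule u2)
  finally show ?thesis using P by (simp add: field_simps)
qed

text \<open>
  The condition \<open>A \<le> \<rho> w H'\<close> in dimension one with denominators cleared (see
  \<open>chi_poincare_nodes\<close>). The certificate writes the difference as a combination of squares with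
  nonnegative coefficients and powers of \<open>x\<close>; the squares nearly vanish at \<open>x =
  0.475\<close>, where the difference is smallest.
\<close>

lemma quintic_nonneg:
  fixes x :: real
  assumes "0 \<le> x"
  shows "51/50 * (x * (1 + x)\<^sup>2) \<le> x ^ 3 * (1 + x)\<^sup>2 + 2/3 * x ^ 3 * (1 + x) + 2/9 * (1 + x) + 8/9 * x"
proof -
  have "0 \<le> 9 * x ^ 3 * (x - 1/2)\<^sup>2 + 357/100 * x * (x - 47/100)\<^sup>2 + 33 * (x\<^sup>2 - 91/400)\<^sup>2
    + (18/5 * 3 / 1000) * x\<^sup>2 + (31/1000) * x + 29/100"
    using assms by simp
  also have "\<dots> \<le> 9 * (x ^ 3 * (1 + x)\<^sup>2 + 2/3 * x ^ 3 * (1 + x) + 2/9 * (1 + x) + 8/9 * x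
     - 51/50 * (x * (1 + x)\<^sup>2))"
    using assms by (simp add: power2_eq_square power3_eq_cube field_simps)
  finally show ?thesis by (simp only: zero_le_mult_iff diff_ge_0_iff_ge) auto
qed

text \<open>
  For \<open>p \<ge> 2\<close> the choice \<open>A = \<rho>\<close> works. For \<open>p = 1\<close> it has
  \<open>H' = 1\<close>, while the weight \<open>r\<^sup>4\<^sup>/\<^sup>3\<close> vanishes at \<open>0\<close>,
  so \<open>A \<le> \<rho> w H'\<close> fails. The choice \<open>A = \<rho> X / (1 + X)\<close> with \<open>X =
  r\<^sup>2\<^sup>/\<^sup>3\<close> is small at \<open>0\<close> and close to \<open>\<rho>\<close> at infinity,
  and turns the condition into a rational inequality in \<open>X\<close>.
\<close>

lemma chi_poincare_nodes:
  fixes f f' :: "real \<Rightarrow> real"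
  assumes p: "1 \<le> p"
    and f: "\<And>x. (f has_real_derivative f' x) (at x)" and f'_cont: "continuous_on UNIV f'"
    and int: "\<And>c. set_integrable lborel {0<..} (\<lambda>x. x ^ (p - 1) * exp (- x\<^sup>2 / 2) *
        (50/51 * x powr (4/3) / real p powr (2/3) * (f' x)\<^sup>2 - (f x - c)\<^sup>2))"
  obtains m where "0 < m"
    "0 \<le> (LINT x:{0<..}|lborel. x ^ (p - 1) * exp (- x\<^sup>2 / 2) *
        (50/51 * x powr (4/3) / real p powr (2/3) * (f' x)\<^sup>2 - (f x - f m)\<^sup>2))"
proof (cases "p = 1")
  case False
  then obtain n where n: "p = Suc (Suc n)" using p by (metis One_nat_def Suc_le_D le_antisym not_less_eq_eq)
  define m where "m = sqrt (real p - 1)"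
  have m: "0 < m" "m * m = real p - 1" using n by (simp_all add: m_def)
  define \<rho> where "\<rho> = (\<lambda>x::real. x ^ (p - 1) * exp (- x\<^sup>2 / 2))"
  have "0 \<le> (LINT x:{0<..}|lborel. \<rho> x * (50/51 * x powr (4/3) / real p powr (2/3) * (f' x)\<^sup>2 - (f x - f m)\<^sup>2))"
  proof (rule weighted_poincare[where A=\<rho> and H="\<lambda>x. x - (real p - 1) / x" and H'="\<lambda>x. 1 + (real p - 1) / x\<^sup>2"])
    fix x :: real assume x: "0 < x"
    show "(\<rho> has_real_derivative - \<rho> x * (x - (real p - 1) / x)) (at x)"
    proof -
      have "((\<lambda>x. x ^ Suc n * exp (- x\<^sup>2 / 2)) has_real_derivative
          real (Suc n) * x ^ n * exp (- x\<^sup>2 / 2) + x ^ Suc n * (exp (- x\<^sup>2 / 2) * - x)) (at x)"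
        by (auto intro!: derivative_eq_intros simp del: power_Suc)
      moreover have "real (Suc n) * x ^ n * exp (- x\<^sup>2 / 2) + x ^ Suc n * (exp (- x\<^sup>2 / 2) * - x)
          = - \<rho> x * (x - (real p - 1) / x)"
        unfolding \<rho>_def n using x by (simp add: field_simps)
      ultimately show ?thesis unfolding \<rho>_def n by simp
    qed
    show "((\<lambda>x. x - (real p - 1) / x) has_real_derivative 1 + (real p - 1) / x\<^sup>2) (at x)"
      using x by (auto intro!: derivative_eq_intros simp: field_simps power2_eq_square)
    show pos: "0 < 1 + (real p - 1) / x\<^sup>2" using x p by (intro add_pos_nonneg) auto
    show "0 \<le> \<rho> x" using x by (simp add: \<rho>_def)
    have "1 \<le> 50/51 * x powr (4/3) / real p powr (2/3) * (1 + (real p - 1) / x\<^sup>2)"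
      using chi_poincare_weight_ge_2[of p x] x n by (simp add: field_simps)
    from mult_left_mono[OF this \<open>0 \<le> \<rho> x\<close>]
    show "\<rho> x \<le> \<rho> x * (50/51 * x powr (4/3) / real p powr (2/3)) * (1 + (real p - 1) / x\<^sup>2)"
      by (simp add: mult.assoc)
  next
    show "m - (real p - 1) / m = 0" using m by (simp add: field_simps)
    show "continuous_on {0<..} \<rho>" unfolding \<rho>_def by (intro continuous_intros) auto
    show "continuous_on {0<..} (\<lambda>x. 50/51 * x powr (4/3) / real p powr (2/3))"
      using n by (intro continuous_intros) auto
    show "continuous_on {0<..} f'" by (rule continuous_on_subset[OF f'_cont]) simp
    show "set_integrable lborel {0<..} (\<lambda>x. \<rho> x * (50/51 * x powr (4/3) / real p powr (2/3) * (f' x)\<^sup>2 - (f x - f m)\<^sup>2))"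
      using int[of "f m"] by (simp add: \<rho>_def)
  qed (use m f in auto)
  then show ?thesis using that[OF m(1)] by (simp add: \<rho>_def)
next
  case True
  define X where "X = (\<lambda>r::real. r powr (2/3))"
  define \<rho> where "\<rho> = (\<lambda>x::real. x ^ (p - 1) * exp (- x\<^sup>2 / 2))"
  define Q where "Q = (\<lambda>r. X r / r)"
  define a where "a = (\<lambda>r. 1 - 1 / (1 + X r))"
  define a' where "a' = (\<lambda>r. 2/3 * Q r / (1 + X r)\<^sup>2)"
  define H where "H = (\<lambda>r. r * a r - a' r)"
  define H' where "H' = (\<lambda>r. a r + r * a' r + 2/9 * (Q r / r) / (1 + X r)\<^sup>2
      + 8/9 * (Q r)\<^sup>2 / (1 + X r) ^ 3)"
  have X_pos: "0 < X r" if "0 < r" for r using that by (simp add: X_def)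
  have X': "(X has_real_derivative 2/3 * Q r) (at r)" if "0 < r" for r
    using has_real_derivative_powr[OF that, of "2/3"] that
    unfolding X_def Q_def by (simp only: powr_diff) simp
  have X3: "X r ^ 3 = r\<^sup>2" "(X r)\<^sup>2 = r powr (4/3)" if "0 < r" for r
    using that by (simp_all add: X_def powr_power powr_numeral)
  have Q': "(Q has_real_derivative - 1/3 * (Q r / r)) (at r)" if "0 < r" for r
  proof -
    have "(Q has_real_derivative (2/3 * Q r * r - X r * 1) / (r * r)) (at r)"
      unfolding Q_def[abs_def] using X'[OF that] that
      by (intro DERIV_divide DERIV_ident) (simp_all add: Q_def)
    moreover have "(2/3 * Q r * r - X r * 1) / (r * r) = - 1/3 * (Q r / r)"
      using that by (simp add: Q_def field_simps)
    ultimately show ?thesis by simp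
  qed
  have da: "(a has_real_derivative a' r) (at r)" if "0 < r" for r
    unfolding a_def a'_def using X'[OF that] X_pos[OF that]
    by (auto intro!: derivative_eq_intros simp: field_simps power2_eq_square)
  have da': "(a' has_real_derivative - (2/9 * (Q r / r) / (1 + X r)\<^sup>2 + 8/9 * (Q r)\<^sup>2 / (1 + X r) ^ 3)) (at r)"
    if "0 < r" for r
  proof -
    have nz: "1 + X r \<noteq> 0" using X_pos[OF that] by simp
    have "(a' has_real_derivative (2/3 * (- 1/3 * (Q r / r)) * (1 + X r)\<^sup>2 - 2/3 * Q r * (2 * (1 + X r) * (2/3 * Q r)))
        / ((1 + X r)\<^sup>2 * (1 + X r)\<^sup>2)) (at r)"
    proof -
      have "((\<lambda>r. (1 + X r)\<^sup>2) has_real_derivative 2 * (1 + X r) * (2/3 * Q r)) (at r)"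
        using X'[OF that] by (auto intro!: derivative_eq_intros)
      from DERIV_divide[OF DERIV_cmult[OF Q'[OF that], of "2/3"] this] nz
      show ?thesis by (simp add: a'_def[abs_def])
    qed
    moreover have "(2/3 * (- 1/3 * (Q r / r)) * (1 + X r)\<^sup>2 - 2/3 * Q r * (2 * (1 + X r) * (2/3 * Q r)))
        / ((1 + X r)\<^sup>2 * (1 + X r)\<^sup>2) = - (2/9 * (Q r / r) / (1 + X r)\<^sup>2 + 8/9 * (Q r)\<^sup>2 / (1 + X r) ^ 3)"
    proof -
      have alg: "(2/3 * (- 1/3 * y) * c\<^sup>2 - 2/3 * q * (2 * c * (2/3 * q))) / (c\<^sup>2 * c\<^sup>2)
         = - (2/9 * y / c\<^sup>2 + 8/9 * q\<^sup>2 / c ^ 3)" if "c \<noteq> 0" for y c q :: real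
        using that by (simp add: field_simps power2_eq_square power3_eq_cube)
      show ?thesis by (rule alg[OF nz])
    qed
    ultimately show ?thesis by simp
  qed
  have dH: "(H has_real_derivative H' r) (at r)" if "0 < r" for r
    unfolding H_def H'_def using da[OF that] da'[OF that]
    by (auto intro!: derivative_eq_intros)
  have key: "51/50 * a r \<le> r powr (4/3) * H' r" if r: "0 < r" for r
  proof -
    define x where "x = X r"
    have x: "0 < x" using X_pos[OF r] by (simp add: x_def)
    have r2: "r\<^sup>2 = x ^ 3" "r powr (4/3) = x\<^sup>2" using X3[OF r] by (simp_all add: x_def)
    have e1: "r * Q r = x" and e2: "(Q r)\<^sup>2 = 1 / x" and e3: "Q r / r = x / x ^ 3"
      using r x r2(1) by (simp_all add: Q_def x_def[symmetric] power_divide power2_eq_square power3_eq_cube)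
    have "r * a' r = 2/3 * (r * Q r) / (1 + x)\<^sup>2"
      by (simp add: a'_def x_def)
    then have ra: "r * a' r = 2/3 * x / (1 + x)\<^sup>2" using e1 by simp
    have aq: "a r = x / (1 + x)" using x by (simp add: a_def x_def[symmetric] field_simps)
    have H'_eq: "H' r = x / (1 + x) + 2/3 * x / (1 + x)\<^sup>2 + 2/9 * (x / x ^ 3) / (1 + x)\<^sup>2 + 8/9 * (1 / x) / (1 + x) ^ 3"
      unfolding H'_def ra aq x_def[symmetric] e2 e3 by simp
    have "r powr (4/3) * H' r - 51/50 * a r
       = (x ^ 3 * (1 + x)\<^sup>2 + 2/3 * x ^ 3 * (1 + x) + 2/9 * (1 + x) + 8/9 * x - 51/50 * (x * (1 + x)\<^sup>2)) / (1 + x) ^ 3"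
    proof -
      have "(1 + x) \<noteq> 0" using x by simp
      then show ?thesis unfolding r2(2) H'_eq aq using x
        by (simp add: divide_simps) (simp add: power2_eq_square power3_eq_cube algebra_simps)
    qed
    also have "\<dots> \<ge> 0" using quintic_nonneg[of x] x by simp
    finally show ?thesis by simp
  qed
  have a_pos: "0 < a r" if "0 < r" for r using X_pos[OF that] by (simp add: a_def)
  have H'_pos: "0 < H' r" if "0 < r" for r
  proof -
    have "0 < r powr (4/3) * H' r" using key[OF that] a_pos[OF that] by linarith
    then show ?thesis using that by (simp add: zero_less_mult_iff)
  qed
  \<comment> \<open>\<open>H\<close> has no zero in closed form here; \<open>1/8\<close> is convenient because \<open>X (1/8) = 1/4\<close>.\<close>
  have "\<exists>m\<ge>1/8. m \<le> 1 \<and> H m = 0"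
  proof (rule IVT')
    have X8: "X (1/8) = 1/4"
    proof -
      have "(1/8::real) = (1/2) powr 3" by (simp add: power3_eq_cube)
      then have "X (1/8) = (1/2) powr 2" unfolding X_def by (simp only: powr_powr) simp
      then show ?thesis by (simp add: power2_eq_square)
    qed
    show "H (1/8) \<le> 0" unfolding H_def a_def a'_def Q_def X8 by (simp add: power2_eq_square)
    show "0 \<le> H 1" by (simp add: H_def a_def a'_def Q_def X_def)
    show "continuous_on {1/8..1} H"
    proof (rule continuous_at_imp_continuous_on, rule ballI)
      fix x :: real assume "x \<in> {1/8..1}"
      then have "0 < x" by simp
      then show "isCont H x" by (rule DERIV_isCont[OF dH])
    qed
  qed simp
  then obtain m where m: "0 < m" "H m = 0" by (meson less_le_trans zero_less_divide_1_iff zero_less_numeral)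
  have "0 \<le> (LINT x:{0<..}|lborel. \<rho> x * (50/51 * x powr (4/3) / real p powr (2/3) * (f' x)\<^sup>2 - (f x - f m)\<^sup>2))"
  proof (rule weighted_poincare[where A="\<lambda>x. \<rho> x * a x" and H=H and H'=H'])
    fix x :: real assume x: "0 < x"
    show "((\<lambda>x. \<rho> x * a x) has_real_derivative - \<rho> x * H x) (at x)"
      unfolding \<rho>_def H_def using da[OF x] True
      by (auto intro!: derivative_eq_intros simp: algebra_simps)
    show "(H has_real_derivative H' x) (at x)" "0 < H' x" using dH[OF x] H'_pos[OF x] by auto
    have rho: "0 \<le> \<rho> x" using x by (simp add: \<rho>_def)
    then show "0 \<le> \<rho> x * a x" using a_pos[OF x] by simp
    have "a x \<le> 50/51 * x powr (4/3) / real p powr (2/3) * H' x" using key[OF x] True by simp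
    from mult_left_mono[OF this rho]
    show "\<rho> x * a x \<le> \<rho> x * (50/51 * x powr (4/3) / real p powr (2/3)) * H' x" by (simp add: mult.assoc)
  next
    show "continuous_on {0<..} \<rho>" unfolding \<rho>_def by (intro continuous_intros) auto
    show "continuous_on {0<..} (\<lambda>x. 50/51 * x powr (4/3) / real p powr (2/3))"
      using p by (intro continuous_intros) auto
    show "continuous_on {0<..} f'" by (rule continuous_on_subset[OF f'_cont]) simp
    show "set_integrable lborel {0<..} (\<lambda>x. \<rho> x * (50/51 * x powr (4/3) / real p powr (2/3) * (f' x)\<^sup>2 - (f x - f m)\<^sup>2))"
      using int[of "f m"] by (simp add: \<rho>_def)
  qed (use m f in auto)
  then show ?thesis using that[OF m(1)] by (simp add: \<rho>_def)
qed

text \<open>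
  The mean minimizes the mean square distance to \<open>f\<close>, so it does at least as well as the value
  \<open>f m\<close> of \<open>chi_poincare_nodes\<close>. The factor \<open>51/50\<close> leaves room for the
  cubic term of the radial divergence.
\<close>

theorem chi_poincare:
  fixes f f' :: "real \<Rightarrow> real"
  assumes p: "1 \<le> p"
    and f: "\<And>x. (f has_real_derivative f' x) (at x)" and f'_cont: "continuous_on UNIV f'"
    and int_f: "integrable (chi p) (\<lambda>r. (f r)\<^sup>2)"
    and int_f': "integrable (chi p) (\<lambda>r. r powr (4/3) * (f' r)\<^sup>2)"
  shows "51/50 * (\<integral>r. (f r - (\<integral>s. f s \<partial>chi p))\<^sup>2 \<partial>chi p)
    \<le> (\<integral>r. r powr (4/3) * (f' r)\<^sup>2 \<partial>chi p) / real p powr (2/3)"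
proof -
  interpret prob_space "chi p" by (rule prob_space_chi[OF p])
  have [measurable]: "f' \<in> borel_measurable borel"
    by (rule borel_measurable_continuous_onI[OF f'_cont])
  have [measurable]: "f \<in> borel_measurable borel"
    using f by (intro borel_measurable_continuous_onI) (meson DERIV_isCont continuous_at_imp_continuous_on)
  have [measurable]: "f \<in> borel_measurable (chi p)" by (simp cong: measurable_cong_sets)
  have int_f1: "integrable (chi p) f"
    by (rule square_integrable_imp_integrable[OF _ int_f]) measurable
  have sq: "integrable (chi p) (\<lambda>r. (f r - c)\<^sup>2)"
    and sq_eq: "(\<integral>r. (f r - c)\<^sup>2 \<partial>chi p) = (\<integral>r. (f r)\<^sup>2 \<partial>chi p) - 2 * c * (\<integral>r. f r \<partial>chi p) + c\<^sup>2" for c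
    using int_f int_f1 prob_space by (simp_all add: power2_diff)
  define G where "G = (\<lambda>c r. 50/51 * r powr (4/3) / real p powr (2/3) * (f' r)\<^sup>2 - (f r - c)\<^sup>2)"
  have G_meas [measurable]: "G c \<in> borel_measurable borel" for c unfolding G_def by measurable
  have int_G: "integrable (chi p) (G c)" for c
  proof -
    have "integrable (chi p) (\<lambda>r. 50/51 / real p powr (2/3) * (r powr (4/3) * (f' r)\<^sup>2) - (f r - c)\<^sup>2)"
      by (intro Bochner_Integration.integrable_diff integrable_mult_right int_f' sq)
    then show ?thesis unfolding G_def by (simp add: field_simps)
  qed
  have G_eq: "(\<integral>r. G c r \<partial>chi p) = 50/51 / real p powr (2/3) * (\<integral>r. r powr (4/3) * (f' r)\<^sup>2 \<partial>chi p) - (\<integral>r. (f r - c)\<^sup>2 \<partial>chi p)" for c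
  proof -
    have "(\<integral>r. G c r \<partial>chi p) = (\<integral>r. 50/51 / real p powr (2/3) * (r powr (4/3) * (f' r)\<^sup>2) - (f r - c)\<^sup>2 \<partial>chi p)"
      unfolding G_def by (intro Bochner_Integration.integral_cong) (simp_all add: field_simps)
    also have "\<dots> = 50/51 / real p powr (2/3) * (\<integral>r. r powr (4/3) * (f' r)\<^sup>2 \<partial>chi p) - (\<integral>r. (f r - c)\<^sup>2 \<partial>chi p)"
      using int_f' sq[of c] by (subst Bochner_Integration.integral_diff) auto
    finally show ?thesis .
  qed
  have int_set: "set_integrable lborel {0<..} (\<lambda>r. r ^ (p - 1) * exp (- r\<^sup>2 / 2) * G c r)" for c
  proof (rule set_integrable_subset)
    show "set_integrable lborel {0..} (\<lambda>r. r ^ (p - 1) * exp (- r\<^sup>2 / 2) * G c r)"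
      using int_G[of c] p unfolding set_integrable_def by (simp add: integrable_chi_iff mult.assoc)
  qed auto
  obtain m where m: "0 \<le> (LINT r:{0<..}|lborel. r ^ (p - 1) * exp (- r\<^sup>2 / 2) * G (f m) r)"
    using chi_poincare_nodes[OF p f f'_cont] int_set unfolding G_def by blast
  have "AE r in lborel. r \<noteq> (0::real)" by (rule AE_lborel_singleton)
  then have "(LINT r:{0<..}|lborel. r ^ (p - 1) * exp (- r\<^sup>2 / 2) * G (f m) r)
    = (\<integral>r. indicator {0..} r * (r ^ (p - 1) * exp (- r\<^sup>2 / 2)) * G (f m) r \<partial>lborel)"
    unfolding set_lebesgue_integral_def
    by (intro integral_cong_AE) (auto split: split_indicator)
  also have "\<dots> = half_moment (p - 1) * (\<integral>r. G (f m) r \<partial>chi p)"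
    using half_moment_pos[OF p] p by (simp add: integral_chi)
  finally have "0 \<le> (\<integral>r. G (f m) r \<partial>chi p)"
    using m half_moment_pos[OF p] by (simp add: zero_le_mult_iff)
  then have 1: "(\<integral>r. (f r - f m)\<^sup>2 \<partial>chi p) \<le> 50/51 / real p powr (2/3) * (\<integral>r. r powr (4/3) * (f' r)\<^sup>2 \<partial>chi p)"
    by (simp only: G_eq diff_ge_0_iff_ge)
  have "(\<integral>r. (f r - (\<integral>s. f s \<partial>chi p))\<^sup>2 \<partial>chi p) \<le> (\<integral>r. (f r - f m)\<^sup>2 \<partial>chi p)"
  proof -
    have "0 \<le> ((\<integral>s. f s \<partial>chi p) - f m)\<^sup>2" by simp
    then show ?thesis unfolding sq_eq by (simp add: power2_eq_square algebra_simps)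
  qed
  with 1 show ?thesis by (simp add: field_simps)
qed

section \<open>Remainders of the exponential and moments of the chi law\<close>

lemma half_integer_powers:
  assumes "1 \<le> p"
  shows "real p powr (3/2) = sqrt (real p) ^ 3" "real p powr (5/2) = sqrt (real p) ^ 5"
    "real p powr (9/2) = sqrt (real p) ^ 9"
proof -
  have "0 < sqrt (real p)" using assms by simp
  then have e: "real p powr (real n / 2) = sqrt (real p) ^ n" for n
    by (simp add: powr_half_sqrt[symmetric] powr_power)
  show "real p powr (3/2) = sqrt (real p) ^ 3" "real p powr (5/2) = sqrt (real p) ^ 5"
    "real p powr (9/2) = sqrt (real p) ^ 9"
    using e[of 3] e[of 5] e[of 9] by simp_all
qed

text \<open>
  For \<open>y = - x\<close> multiply the Taylor bound \<open>1 + y + y\<^sup>2 / 2 \<le> exp y\<close> by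
  \<open>1 - y + y\<^sup>2 / 2\<close>; the product of the two quadratics is \<open>1 + y\<^sup>4 / 4\<close>.
\<close>

lemma exp_le_quadratic_nonpos:
  fixes x :: real assumes "x \<le> 0" shows "exp x \<le> 1 + x + x\<^sup>2 / 2"
proof -
  define y where "y = - x"
  have y: "0 \<le> y" using assms by (simp add: y_def)
  have pos: "0 < 1 - y + y\<^sup>2 / 2"
  proof -
    have "0 \<le> (1 - y)\<^sup>2" by simp
    then show ?thesis by (simp add: power2_eq_square algebra_simps)
  qed
  have "1 \<le> (1 - y + y\<^sup>2 / 2) * (1 + y + y\<^sup>2 / 2)"
  proof -
    have "(1 - y + y\<^sup>2 / 2) * (1 + y + y\<^sup>2 / 2) = 1 + (y\<^sup>2)\<^sup>2 / 4"
      by (simp add: power2_eq_square field_simps)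
    then show ?thesis by simp
  qed
  also have "\<dots> \<le> (1 - y + y\<^sup>2 / 2) * exp y"
    using exp_lower_Taylor_quadratic[OF y] pos by (intro mult_left_mono) auto
  finally have "1 * exp (- y) \<le> (1 - y + y\<^sup>2 / 2) * exp y * exp (- y)"
    by (intro mult_right_mono) auto
  also have "\<dots> = 1 - y + y\<^sup>2 / 2" by (simp add: mult.assoc flip: exp_add)
  finally show ?thesis by (simp add: y_def)
qed

lemma exp_remainder_2:
  fixes x :: real shows "0 \<le> exp x - 1 - x" "exp x - 1 - x \<le> x\<^sup>2 / 2 * (1 + exp x)"
proof -
  show "0 \<le> exp x - 1 - x" using exp_ge_add_one_self[of x] by linarith
  show "exp x - 1 - x \<le> x\<^sup>2 / 2 * (1 + exp x)"
  proof (cases "x \<le> 0")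
    case True
    have "0 \<le> x\<^sup>2 / 2 * exp x" by simp
    then show ?thesis using exp_le_quadratic_nonpos[OF True]
      by (simp only: distrib_left mult_1_right)
  next
    case False
    obtain t where t: "\<bar>t\<bar> \<le> \<bar>x\<bar>" "exp x = (\<Sum>m<2. x ^ m / fact m) + exp t / fact 2 * x ^ 2"
      using Maclaurin_exp_le[of x 2] by blast
    have "exp t / 2 * x\<^sup>2 \<le> (1 + exp x) / 2 * x\<^sup>2"
      using t(1) False by (intro mult_right_mono divide_right_mono) (auto intro: order.trans[of _ "exp x"])
    then show ?thesis using t(2) by (simp add: numeral_2_eq_2 mult.commute)
  qed
qed

text \<open>
  For positive \<open>x\<close> the cubic Taylor term is at most \<open>x\<^sup>2 / 100 + x\<^sup>4\<close>. The
  third absolute moment of the centred remainder can be of order \<open>D\<^sup>3 p\<^sup>3\<close>, more than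
  the error \<open>D\<^sup>3 p\<^sup>5\<^sup>/\<^sup>2\<close> of \<open>radial_KL_le_gradient\<close>, whereas
  its fourth moment is of order \<open>D\<^sup>4 p\<^sup>4\<close>. The factor \<open>51/100\<close> instead of
  \<open>1/2\<close> is the price, which \<open>chi_poincare\<close> compensates.
\<close>

lemma exp_remainder_4:
  fixes x :: real
  shows "exp x \<le> 1 + x + 51/100 * x\<^sup>2 + 2 * (x ^ 4 * (1 + exp x))"
proof (cases "x \<le> 0")
  case True
  have "0 \<le> x ^ 4 * (1 + exp x)" by (simp add: add_nonneg_nonneg)
  then show ?thesis using exp_le_quadratic_nonpos[OF True] zero_le_power2[of x] by linarith
next
  case False
  then have x: "0 < x" by simp
  obtain t where t: "\<bar>t\<bar> \<le> \<bar>x\<bar>" "exp x = (\<Sum>m<4. x ^ m / fact m) + exp t / fact 4 * x ^ 4"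
    using Maclaurin_exp_le[of x 4] by blast
  have "exp t / fact 4 * x ^ 4 \<le> (1 + exp x) * x ^ 4"
    using t(1) x by (intro mult_right_mono)
      (auto simp: fact_numeral intro: order.trans[of _ "exp x"])
  then have "exp x \<le> 1 + x + x\<^sup>2 / 2 + x ^ 3 / 6 + x ^ 4 * (1 + exp x)"
    using t(2) by (simp add: eval_nat_numeral fact_numeral mult.commute)
  moreover have "x ^ 3 / 6 \<le> 1/100 * x\<^sup>2 + x ^ 4"
  proof -
    \<comment> \<open>The discriminant of \<open>x\<^sup>2 - x / 6 + 1/100\<close> is negative: \<open>1/144 < 1/100\<close>.\<close>
    have "0 \<le> x\<^sup>2 * ((x - 1/12)\<^sup>2 + 1/1000)" by simp
    also have "\<dots> \<le> 1/100 * x\<^sup>2 + x ^ 4 - x ^ 3 / 6"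
      using x by (simp add: power2_eq_square eval_nat_numeral field_simps)
    finally show ?thesis by simp
  qed
  moreover have "x ^ 4 \<le> x ^ 4 * (1 + exp x)"
    by (simp add: distrib_left)
  ultimately show ?thesis by linarith
qed

lemma chi_even_moments:
  assumes "1 \<le> p"
  shows "(\<integral>r. r ^ 2 \<partial>chi p) = real p"
    "(\<integral>r. r ^ 4 \<partial>chi p) = real p * (real p + 2)"
    "(\<integral>r. r ^ 6 \<partial>chi p) = real p * (real p + 2) * (real p + 4)"
    "(\<integral>r. r ^ 8 \<partial>chi p) = real p * (real p + 2) * (real p + 4) * (real p + 6)"
    "(\<integral>r. r ^ 12 \<partial>chi p) = real p * (real p + 2) * (real p + 4) * (real p + 6) * (real p + 8) * (real p + 10)"
    "(\<integral>r. r ^ 16 \<partial>chi p) = real p * (real p + 2) * (real p + 4) * (real p + 6) * (real p + 8) * (real p + 10)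
       * (real p + 12) * (real p + 14)"
  using chi_even_power[OF assms, of 1] chi_even_power[OF assms, of 2] chi_even_power[OF assms, of 3]
    chi_even_power[OF assms, of 4] chi_even_power[OF assms, of 6] chi_even_power[OF assms, of 8]
  by (simp_all add: eval_nat_numeral)

lemma chi_sixth_moment_le:
  assumes "1 \<le> p" shows "(\<integral>r. r ^ 6 \<partial>chi p) \<le> 15 * real p ^ 3"
proof -
  have P: "1 \<le> real p" using assms by simp
  have "real p * (real p + 2) * (real p + 4) \<le> real p * (3 * real p) * (5 * real p)"
    using P by (intro mult_mono) auto
  then show ?thesis by (simp add: chi_even_moments[OF assms] power3_eq_cube)
qed

text \<open>
  The square is at most the sixth moment, by Cauchy-Schwarz.
\<close>

lemma chi_third_moment_le:
  assumes p: "1 \<le> p" shows "(\<integral>r. r ^ 3 \<partial>chi p) \<le> 4 * sqrt (real p) ^ 3"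
proof -
  interpret prob_space "chi p" by (rule prob_space_chi[OF p])
  have "(\<integral>r. r ^ 3 \<partial>chi p)\<^sup>2 \<le> (\<integral>r. (r ^ 3)\<^sup>2 \<partial>chi p)"
  proof -
    have "0 \<le> variance (\<lambda>r. r ^ 3)" by (rule variance_positive)
    also have "\<dots> = (\<integral>r. (r ^ 3)\<^sup>2 \<partial>chi p) - (\<integral>r. r ^ 3 \<partial>chi p)\<^sup>2"
      using integrable_chi_power[OF p, of 3] integrable_chi_power[OF p, of 6]
      by (intro variance_eq) (simp_all flip: power_mult)
    finally show ?thesis by simp
  qed
  also have "\<dots> = (\<integral>r. r ^ 6 \<partial>chi p)" by (simp flip: power_mult)
  also have "\<dots> \<le> 16 * real p ^ 3" using chi_sixth_moment_le[OF p] zero_le_power[of "real p" 3] by linarith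
  also have "\<dots> = (4 * sqrt (real p) ^ 3)\<^sup>2"
  proof -
    have "(sqrt (real p) ^ 3)\<^sup>2 = (sqrt (real p) ^ 2) ^ 3" by (simp only: power_mult[symmetric] mult.commute)
    then show ?thesis by (simp add: power_mult_distrib)
  qed
  finally show ?thesis by (rule power2_le_imp_le) simp
qed

text \<open>
  \<open>r\<^sup>2\<close> has mean \<open>p\<close> and standard deviation of order \<open>\<surd>p\<close>, so
  \<open>r\<^sup>4 - p\<^sup>2 = (r\<^sup>2 - p) (r\<^sup>2 + p)\<close> is of order
  \<open>p\<^sup>3\<^sup>/\<^sup>2\<close>. The powers \<open>p\<^sup>8\<close> and \<open>p\<^sup>7\<close>
  cancel in the expansion of the fourth power, which only involves even moments of \<open>r\<close>.
\<close>

lemma chi_concentration: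
  assumes p: "1 \<le> p"
  shows "integrable (chi p) (\<lambda>r. (r ^ 4 - real p ^ 2) ^ 4)" (is ?int)
    and "(\<integral>r. (r ^ 4 - real p ^ 2) ^ 4 \<partial>chi p) \<le> 2000000 * real p ^ 6" (is ?bound)
proof -
  interpret prob_space "chi p" by (rule prob_space_chi[OF p])
  let ?P = "real p"
  have e: "(\<lambda>r::real. (r ^ 4 - ?P ^ 2) ^ 4) = (\<lambda>r. r ^ 16 - 4 * ?P ^ 2 * r ^ 12 + 6 * ?P ^ 4 * r ^ 8 - 4 * ?P ^ 6 * r ^ 4 + ?P ^ 8)"
    by (rule ext) (simp add: eval_nat_numeral algebra_simps)
  note ints = integrable_chi_power[OF p, of 16] integrable_chi_power[OF p, of 12]
    integrable_chi_power[OF p, of 8] integrable_chi_power[OF p, of 4]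
  show ?int unfolding e
    by (intro Bochner_Integration.integrable_add Bochner_Integration.integrable_diff integrable_mult_right ints integrable_const)
  have "(\<integral>r. (r ^ 4 - ?P ^ 2) ^ 4 \<partial>chi p)
     = (\<integral>r. r ^ 16 \<partial>chi p) - 4 * ?P ^ 2 * (\<integral>r. r ^ 12 \<partial>chi p) + 6 * ?P ^ 4 * (\<integral>r. r ^ 8 \<partial>chi p)
       - 4 * ?P ^ 6 * (\<integral>r. r ^ 4 \<partial>chi p) + ?P ^ 8"
    unfolding e using ints prob_space by simp
  also have "\<dots> = 645120 * ?P + 836352 * ?P ^ 2 + 404864 * ?P ^ 3 + 90768 * ?P ^ 4 + 8768 * ?P ^ 5 + 192 * ?P ^ 6"
    unfolding chi_even_moments[OF p] by (simp add: eval_nat_numeral algebra_simps)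
  also have "\<dots> \<le> 645120 * ?P ^ 6 + 836352 * ?P ^ 6 + 404864 * ?P ^ 6 + 90768 * ?P ^ 6 + 8768 * ?P ^ 6 + 192 * ?P ^ 6"
  proof -
    have P: "1 \<le> ?P" using p by simp
    have "?P \<le> ?P ^ 6" using power_increasing[OF _ P, of 1 6] by simp
    moreover have "?P ^ 2 \<le> ?P ^ 6" "?P ^ 3 \<le> ?P ^ 6" "?P ^ 4 \<le> ?P ^ 6" "?P ^ 5 \<le> ?P ^ 6"
      by (rule power_increasing[OF _ P]; simp)+
    ultimately show ?thesis by linarith
  qed
  also have "\<dots> \<le> 2000000 * ?P ^ 6" by simp
  finally show ?bound .
qed

lemma fourth_power_diff_le: "(a - b) ^ 4 \<le> 8 * (a ^ 4 + b ^ 4)" for a b :: real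
proof -
  have 1: "(x + y)\<^sup>2 \<le> 2 * (x\<^sup>2 + y\<^sup>2)" for x y :: real
    using zero_le_power2[of "x - y"] by (simp add: power2_eq_square algebra_simps)
  have "((a - b)\<^sup>2)\<^sup>2 \<le> (2 * (a\<^sup>2 + b\<^sup>2))\<^sup>2" using 1[of a "- b"] by (intro power_mono) auto
  also have "\<dots> \<le> 4 * (2 * ((a\<^sup>2)\<^sup>2 + (b\<^sup>2)\<^sup>2))" 
  proof -
    have "(2 * (a\<^sup>2 + b\<^sup>2))\<^sup>2 = 4 * (a\<^sup>2 + b\<^sup>2)\<^sup>2" by (simp only: power_mult_distrib) simp
    with 1[of "a\<^sup>2" "b\<^sup>2"] show ?thesis by linarith
  qed
  finally show ?thesis by (simp flip: power_mult)
qed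

lemma two_seventeenths_power: "(real p)\<^sup>2 * (2 / 17) ^ p \<le> 1"
proof -
  have "real p \<le> 2 ^ p" using of_nat_less_two_power[of p, where 'a=real] by simp
  then have "(real p)\<^sup>2 \<le> (2 ^ p)\<^sup>2" by (intro power_mono) auto
  also have "\<dots> = (4::real) ^ p" by (simp add: power2_eq_square flip: power_mult_distrib)
  finally have "(real p)\<^sup>2 * (2 / 17) ^ p \<le> 4 ^ p * (2 / 17) ^ p" by (intro mult_right_mono) auto
  also have "\<dots> = (8 / 17) ^ p" by (simp flip: power_mult_distrib)
  also have "\<dots> \<le> 1" by (rule power_le_one) auto
  finally show ?thesis .
qed

section \<open>The divergence along a ray\<close>

text \<open>
  What is known of the remainder along one ray: \<open>\<psi>\<close> is the standardized potential in a fixed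
  direction minus \<open>r\<^sup>2 / 2\<close> and minus the minimum, and \<open>D\<close> bounds the third
  derivative. The last assumption is the convexity of \<open>\<psi> r + r\<^sup>2 / 2\<close>, which is
  \<open>0\<close> at the origin, as an increase of its slopes from there.
\<close>

locale cubic_remainder =
  fixes p :: nat and D :: real and \<psi> \<psi>' :: "real \<Rightarrow> real"
  assumes p: "1 \<le> p" and D: "0 \<le> D"
    and deriv: "\<And>r. (\<psi> has_real_derivative \<psi>' r) (at r)"
    and cont': "continuous_on UNIV \<psi>'"
    and bound: "\<And>r. 0 \<le> r \<Longrightarrow> \<bar>\<psi> r\<bar> \<le> D * r ^ 3 / 6"
    and bound': "\<And>r. 0 \<le> r \<Longrightarrow> \<bar>\<psi>' r\<bar> \<le> D / 2 * r\<^sup>2"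
    and convex: "\<And>s r. 0 < s \<Longrightarrow> s \<le> r \<Longrightarrow> r / s * (\<psi> s + s\<^sup>2 / 2) \<le> \<psi> r + r\<^sup>2 / 2"
begin

sublocale prob_space "chi p" by (rule prob_space_chi[OF p])

lemma measurable_psi [measurable]: "\<psi> \<in> borel_measurable borel"
  using deriv by (intro borel_measurable_continuous_onI continuous_at_imp_continuous_on ballI)
    (rule DERIV_isCont)

lemma measurable_deriv [measurable]: "\<psi>' \<in> borel_measurable borel"
  by (rule borel_measurable_continuous_onI[OF cont'])

lemma AE_bound: "AE r in chi p. \<bar>\<psi> r\<bar> \<le> D * r ^ 3 / 6"
  using AE_chi_nonneg by eventually_elim (rule bound)

lemma integrable_psi_power: "integrable (chi p) (\<lambda>r. \<psi> r ^ k)"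
proof (rule Bochner_Integration.integrable_bound)
  show "integrable (chi p) (\<lambda>r. (D / 6) ^ k * r ^ (3 * k))"
    by (intro integrable_mult_right integrable_chi_power p)
  show "AE r in chi p. norm (\<psi> r ^ k) \<le> norm ((D / 6) ^ k * r ^ (3 * k))"
    using AE_bound AE_chi_nonneg
  proof eventually_elim
    case (elim r)
    have "\<bar>\<psi> r\<bar> ^ k \<le> (D * r ^ 3 / 6) ^ k" using elim by (intro power_mono) auto
    also have "\<dots> = (D / 6) ^ k * r ^ (3 * k)" by (simp add: power_mult power_mult_distrib power_divide)
    finally show ?case using elim D by (simp add: power_abs)
  qed
qed measurable

lemma integrable_psi [simp, intro]: "integrable (chi p) \<psi>"
  using integrable_psi_power[of 1] by simp

text \<open>
  Up to \<open>s\<close> the cubic bound is used. Beyond \<open>s\<close> the potential \<open>\<psi> r +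
  r\<^sup>2 / 2\<close> lies above the chord through the origin and the point at \<open>s\<close>, where it is
  at least \<open>s\<^sup>2 / 2 - D s\<^sup>3 / 6 \<ge> s\<^sup>2 / 3\<close>.
\<close>

lemma exp_neg_psi_bound:
  assumes s: "0 < s" "D * s \<le> 1" and r: "0 \<le> r"
  shows "exp (- r\<^sup>2 / 2) * exp (- \<psi> r) \<le> exp (D * s ^ 3 / 6) * exp (- r\<^sup>2 / 2) + exp (- (s / 3 * r))"
proof (cases "r \<le> s")
  case True
  have "- \<psi> r \<le> D * r ^ 3 / 6" using bound[OF r] by simp
  also have "\<dots> \<le> D * s ^ 3 / 6" using True r D by (intro divide_right_mono mult_left_mono power_mono) auto
  finally have "exp (- \<psi> r) \<le> exp (D * s ^ 3 / 6)" by simp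
  then have "exp (- r\<^sup>2 / 2) * exp (- \<psi> r) \<le> exp (- r\<^sup>2 / 2) * exp (D * s ^ 3 / 6)" by (intro mult_left_mono) auto
  then show ?thesis by (simp add: mult.commute add_increasing2)
next
  case False
  then have sr: "s \<le> r" by simp
  have "s\<^sup>2 / 3 \<le> \<psi> s + s\<^sup>2 / 2"
  proof -
    have "\<bar>\<psi> s\<bar> \<le> D * s * s\<^sup>2 / 6" using bound[of s] s by (simp add: power2_eq_square power3_eq_cube mult_ac)
    also have "\<dots> \<le> 1 * s\<^sup>2 / 6" using s(2) by (intro divide_right_mono mult_right_mono) auto
    finally show ?thesis by simp
  qed
  then have "r / s * (s\<^sup>2 / 3) \<le> r / s * (\<psi> s + s\<^sup>2 / 2)"
    using s r by (intro mult_left_mono) auto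
  also have "\<dots> \<le> \<psi> r + r\<^sup>2 / 2" by (rule convex[OF s(1) sr])
  finally have "s / 3 * r \<le> \<psi> r + r\<^sup>2 / 2" using s by (simp add: power2_eq_square field_simps)
  then have "exp (- r\<^sup>2 / 2) * exp (- \<psi> r) \<le> exp (- (s / 3 * r))" by (simp flip: exp_add)
  then show ?thesis by (simp add: add_increasing)
qed

definition tail :: "real \<Rightarrow> nat \<Rightarrow> real" where
  "tail s k = (\<integral>r. indicator {0..} r * (r ^ (p - 1 + k) * exp (- (s / 3 * r))) \<partial>lborel) / half_moment (p - 1)"

lemma tilted_expectation:
  assumes s: "0 < s" "D * s \<le> 1"
    and Q [measurable]: "Q \<in> borel_measurable borel" and Q_int: "integrable (chi p) Q"
    and Q_bound: "\<And>r. 0 \<le> r \<Longrightarrow> 0 \<le> Q r \<and> Q r \<le> r ^ k + c"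
  shows "integrable (chi p) (\<lambda>r. Q r * exp (- \<psi> r))" (is ?int)
    and "(\<integral>r. Q r * exp (- \<psi> r) \<partial>chi p) \<le> exp (D * s ^ 3 / 6) * (\<integral>r. Q r \<partial>chi p) + (tail s k + c * tail s 0)" (is ?bound)
proof -
  let ?w = "\<lambda>r::real. indicator {0..} r * (r ^ (p - 1) * exp (- r\<^sup>2 / 2))"
  let ?t = "\<lambda>k r::real. indicator {0..} r * (r ^ (p - 1 + k) * exp (- (s / 3 * r)))"
  let ?M = "half_moment (p - 1)"
  have M: "0 < ?M" by (rule half_moment_pos[OF p])
  have wQ: "integrable lborel (\<lambda>r. ?w r * Q r)" using Q_int p by (simp add: integrable_chi_iff)
  have t: "integrable lborel (?t j)" for j
    using integrable_exp_tail(1)[of "s / 3" "p - 1 + j"] s by simp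
  let ?B = "\<lambda>r. exp (D * s ^ 3 / 6) * (?w r * Q r) + (?t k r + c * ?t 0 r)"
  have B: "integrable lborel ?B"
    by (intro Bochner_Integration.integrable_add integrable_mult_right wQ t)
  have le: "0 \<le> ?w r * (Q r * exp (- \<psi> r)) \<and> ?w r * (Q r * exp (- \<psi> r)) \<le> ?B r" for r
  proof (cases "0 \<le> r")
    case True
    have "exp (- r\<^sup>2 / 2) * exp (- \<psi> r) * (r ^ (p - 1) * Q r)
       \<le> (exp (D * s ^ 3 / 6) * exp (- r\<^sup>2 / 2) + exp (- (s / 3 * r))) * (r ^ (p - 1) * Q r)"
      using exp_neg_psi_bound[OF s True] Q_bound[OF True] True by (intro mult_right_mono) auto
    also have "\<dots> = exp (D * s ^ 3 / 6) * (?w r * Q r) + exp (- (s / 3 * r)) * r ^ (p - 1) * Q r"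
      using True by (simp add: algebra_simps)
    also have "\<dots> \<le> exp (D * s ^ 3 / 6) * (?w r * Q r) + exp (- (s / 3 * r)) * r ^ (p - 1) * (r ^ k + c)"
      using Q_bound[OF True] True by (intro add_left_mono mult_left_mono) auto
    also have "\<dots> = ?B r" using True by (simp add: algebra_simps power_add)
    finally show ?thesis using Q_bound[OF True] True by (simp add: mult_ac)
  qed simp
  have int: "integrable lborel (\<lambda>r. ?w r * (Q r * exp (- \<psi> r)))"
    by (rule Bochner_Integration.integrable_bound[OF B]) (use le in \<open>auto intro: order.trans[OF _ abs_ge_self]\<close>)
  then show ?int using p by (subst integrable_chi_iff) auto
  have "(\<integral>r. Q r * exp (- \<psi> r) \<partial>chi p) = (\<integral>r. ?w r * (Q r * exp (- \<psi> r)) \<partial>lborel) / ?M"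
    using p by (subst integral_chi) auto
  also have "\<dots> \<le> (\<integral>r. ?B r \<partial>lborel) / ?M"
    using le M by (intro divide_right_mono integral_mono int B) auto
  also have "(\<integral>r. ?B r \<partial>lborel) = exp (D * s ^ 3 / 6) * (\<integral>r. ?w r * Q r \<partial>lborel) + ((\<integral>r. ?t k r \<partial>lborel) + c * (\<integral>r. ?t 0 r \<partial>lborel))"
    using wQ t[of k] t[of 0] by (subst Bochner_Integration.integral_add) (auto intro!: Bochner_Integration.integrable_add)
  also have "\<dots> / ?M = exp (D * s ^ 3 / 6) * (\<integral>r. Q r \<partial>chi p) + (tail s k + c * tail s 0)"
    using p M by (subst integral_chi) (auto simp: tail_def add_divide_distrib)
  finally show ?bound .
qed

lemma integrable_power_exp: "integrable (chi p) (\<lambda>r. r ^ (2 * k) * exp (- \<psi> r))"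
proof (rule tilted_expectation(1))
  \<comment> \<open>Any cutoff with \<open>D s \<le> 1\<close> gives integrability.\<close>
  show "0 < 1 / (D + 1)" "D * (1 / (D + 1)) \<le> 1" using D by (auto simp: field_simps)
  show "0 \<le> r ^ (2 * k) \<and> r ^ (2 * k) \<le> r ^ (2 * k) + 0" for r :: real by (simp add: power_mult)
qed (auto intro: integrable_chi_power[OF p])

lemma integrable_exp: "integrable (chi p) (\<lambda>r. exp (- \<psi> r))"
  using integrable_power_exp[of 0] by simp

definition "mean = (\<integral>r. \<psi> r \<partial>chi p)"
definition "tilt_mass = (\<integral>r. exp (- \<psi> r) \<partial>chi p)"
definition "centred r = mean - \<psi> r"

lemma integral_exp_centred: "(\<integral>r. exp (centred r) \<partial>chi p) = exp mean * tilt_mass"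
  and integrable_exp_centred: "integrable (chi p) (\<lambda>r. exp (centred r))"
proof -
  have "exp (centred r) = exp mean * exp (- \<psi> r)" for r by (simp add: centred_def flip: exp_add)
  then show "(\<integral>r. exp (centred r) \<partial>chi p) = exp mean * tilt_mass" "integrable (chi p) (\<lambda>r. exp (centred r))"
    using integrable_exp by (simp_all add: tilt_mass_def)
qed

lemma integrable_centred: "integrable (chi p) centred" and integral_centred: "(\<integral>r. centred r \<partial>chi p) = 0"
  unfolding centred_def[abs_def] using prob_space by (simp_all add: mean_def)

text \<open>
  Jensen's inequality for the exponential.
\<close>

lemma tilt_mass_ge: "exp (- mean) \<le> tilt_mass"
proof -
  have "1 + (\<integral>r. centred r \<partial>chi p) = (\<integral>r. 1 + centred r \<partial>chi p)" using integrable_centred prob_space by simp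
  also have "\<dots> \<le> (\<integral>r. exp (centred r) \<partial>chi p)"
    using integrable_centred integrable_exp_centred by (intro integral_mono) auto
  finally have "1 \<le> exp mean * tilt_mass" by (simp add: integral_centred integral_exp_centred)
  then show ?thesis by (simp add: exp_minus field_simps)
qed

lemma tilt_mass_pos: "0 < tilt_mass"
  using tilt_mass_ge by (rule less_le_trans[rotated]) simp

lemma radial_KL_nonneg: "0 \<le> mean + ln tilt_mass"
  using tilt_mass_ge tilt_mass_pos by (simp add: ln_ge_iff[symmetric])

lemma abs_mean_le: "\<bar>mean\<bar> \<le> D * sqrt (real p) ^ 3"
proof -
  have "\<bar>mean\<bar> \<le> (\<integral>r. \<bar>\<psi> r\<bar> \<partial>chi p)" unfolding mean_def by (rule integral_abs_bound)
  also have "\<dots> \<le> (\<integral>r. D / 6 * r ^ 3 \<partial>chi p)"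
    using AE_bound by (intro integral_mono_AE integrable_mult_right integrable_chi_power p) auto
  also have "\<dots> = D / 6 * (\<integral>r. r ^ 3 \<partial>chi p)" by simp
  also have "\<dots> \<le> D / 6 * (4 * sqrt (real p) ^ 3)"
    using chi_third_moment_le[OF p] D by (intro mult_left_mono) auto
  also have "\<dots> \<le> D * sqrt (real p) ^ 3" using D by (simp add: mult_right_mono)
  finally show ?thesis .
qed

end

text \<open>
  The threshold allows the cutoff \<open>51 \<surd>p\<close> in \<open>exp_neg_psi_bound\<close>: the cubic
  bound is still at most \<open>1\<close> there, and the rate of the linear growth beyond is \<open>51 \<surd>p
  / 3 = 17 \<surd>p\<close>, as in \<open>exp_tail_moment_bound\<close>.
\<close>

locale small_cubic_remainder = cubic_remainder +
  assumes small: "D * sqrt (real p) ^ 3 \<le> 1 / 25000"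
begin

lemma cutoff: "0 < 51 * sqrt (real p)" "D * (51 * sqrt (real p)) \<le> 1" "D * (51 * sqrt (real p)) ^ 3 / 6 \<le> 1"
proof -
  have P: "1 \<le> sqrt (real p)" using p by simp
  show "0 < 51 * sqrt (real p)" using P by simp
  have "sqrt (real p) \<le> sqrt (real p) ^ 3" using power_increasing[OF _ P, of 1 3] by simp
  then have "D * sqrt (real p) \<le> D * sqrt (real p) ^ 3" using D by (rule mult_left_mono)
  then show "D * (51 * sqrt (real p)) \<le> 1" using small by simp
  show "D * (51 * sqrt (real p)) ^ 3 / 6 \<le> 1" using small by (simp add: power_mult_distrib)
qed

lemma tail_le: 
  assumes "k \<le> 16" shows "tail (51 * sqrt (real p)) k \<le> sqrt (real p) ^ k * (2 / 17) ^ p"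
proof -
  have "51 * sqrt (real p) / 3 = 17 * sqrt (real p)" by simp
  then have "tail (51 * sqrt (real p)) k \<le> sqrt (real p) ^ k * (2 / 17) ^ p * half_moment (p - 1) / half_moment (p - 1)"
    unfolding tail_def using exp_tail_moment_bound[OF p assms] half_moment_pos[OF p]
    by (intro divide_right_mono) simp_all
  then show ?thesis using half_moment_pos[OF p] by simp
qed

text \<open>
  The comparison of the tilted law \<open>exp (- \<psi>) chi\<close> with the chi law itself, with a constant
  that does not depend on \<open>p\<close> and an error that is exponentially small in \<open>p\<close>. All
  moments of the tilted law are estimated through it.
\<close>

lemma tilted_expectation_small:
  assumes Q [measurable]: "Q \<in> borel_measurable borel" and Q_int: "integrable (chi p) Q"
    and Q_bound: "\<And>r. 0 \<le> r \<Longrightarrow> 0 \<le> Q r \<and> Q r \<le> r ^ k + c" and k: "k \<le> 16" and c: "0 \<le> c"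
  shows "integrable (chi p) (\<lambda>r. Q r * exp (- \<psi> r))" (is ?int)
    and "(\<integral>r. Q r * exp (- \<psi> r) \<partial>chi p) \<le> 3 * (\<integral>r. Q r \<partial>chi p) + (sqrt (real p) ^ k + c) * (2 / 17) ^ p" (is ?bound)
proof -
  note t = tilted_expectation[OF cutoff(1,2) Q Q_int Q_bound]
  show ?int by (rule t(1))
  have Q0: "0 \<le> (\<integral>r. Q r \<partial>chi p)"
  proof (rule integral_nonneg_AE)
    show "AE r in chi p. 0 \<le> Q r"
      using AE_chi_nonneg[of p] by eventually_elim (use Q_bound in blast)
  qed
  have "exp (D * (51 * sqrt (real p)) ^ 3 / 6) \<le> exp 1" using cutoff(3) by (simp only: exp_le_cancel_iff)
  also have "\<dots> \<le> 3" using e_less_272 by simp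
  finally have "exp (D * (51 * sqrt (real p)) ^ 3 / 6) * (\<integral>r. Q r \<partial>chi p) \<le> 3 * (\<integral>r. Q r \<partial>chi p)"
    by (rule mult_right_mono[OF _ Q0])
  moreover have "tail (51 * sqrt (real p)) k + c * tail (51 * sqrt (real p)) 0
     \<le> sqrt (real p) ^ k * (2 / 17) ^ p + c * (2 / 17) ^ p"
    using tail_le[OF k] tail_le[of 0] c by (intro add_mono mult_left_mono) auto
  ultimately show ?bound using t(2) by (simp add: distrib_right)
qed

lemma tilt_mass_le: "tilt_mass \<le> 4"
proof -
  have "(\<integral>r. 1 * exp (- \<psi> r) \<partial>chi p) \<le> 3 * (\<integral>r. 1 \<partial>chi p) + (sqrt (real p) ^ 0 + 0) * (2 / 17) ^ p"
    by (rule tilted_expectation_small) auto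
  moreover have "(2 / 17 :: real) ^ p \<le> 1" by (rule power_le_one) auto
  ultimately show ?thesis using prob_space by (simp add: tilt_mass_def)
qed

lemma sixth_moment_tilted: "(\<integral>r. r ^ 6 * exp (- \<psi> r) \<partial>chi p) \<le> 46 * real p ^ 3"
proof -
  have "(\<integral>r. r ^ 6 * exp (- \<psi> r) \<partial>chi p) \<le> 3 * (\<integral>r. r ^ 6 \<partial>chi p) + (sqrt (real p) ^ 6 + 0) * (2 / 17) ^ p"
    by (rule tilted_expectation_small) (auto intro: integrable_chi_power[OF p])
  also have "\<dots> \<le> 3 * (15 * real p ^ 3) + real p ^ 3 * 1"
  proof (intro add_mono mult_left_mono)
    have "sqrt (real p) ^ 6 = (sqrt (real p) ^ 2) ^ 3" by (simp only: power_mult[symmetric]) simp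
    then have e: "sqrt (real p) ^ 6 + 0 = real p ^ 3" by simp
    have "(2 / 17 :: real) ^ p \<le> 1" by (rule power_le_one) auto
    then show "(sqrt (real p) ^ 6 + 0) * (2 / 17) ^ p \<le> real p ^ 3 * 1"
      unfolding e by (intro mult_left_mono) auto
  qed (use chi_sixth_moment_le[OF p] in auto)
  finally show ?thesis by simp
qed

lemma square_psi: "(\<integral>r. (\<psi> r)\<^sup>2 \<partial>chi p) \<le> D\<^sup>2 * real p ^ 3"
  and square_psi_exp: "integrable (chi p) (\<lambda>r. (\<psi> r)\<^sup>2 * exp (- \<psi> r))"
    "(\<integral>r. (\<psi> r)\<^sup>2 * exp (- \<psi> r) \<partial>chi p) \<le> 46/36 * (D\<^sup>2 * real p ^ 3)"
proof -
  have AE_sq: "AE r in chi p. (\<psi> r)\<^sup>2 \<le> D\<^sup>2 / 36 * r ^ 6"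
    using AE_bound
  proof eventually_elim
    case (elim r)
    then have "\<bar>\<psi> r\<bar>\<^sup>2 \<le> (D * r ^ 3 / 6)\<^sup>2" by (intro power_mono) auto
    then show ?case by (simp add: power_mult_distrib power_divide flip: power_mult)
  qed
  have "(\<integral>r. (\<psi> r)\<^sup>2 \<partial>chi p) \<le> (\<integral>r. D\<^sup>2 / 36 * r ^ 6 \<partial>chi p)"
    by (intro integral_mono_AE integrable_psi_power integrable_mult_right integrable_chi_power p AE_sq)
  also have "\<dots> = D\<^sup>2 / 36 * (\<integral>r. r ^ 6 \<partial>chi p)" by simp
  also have "\<dots> \<le> D\<^sup>2 / 36 * (15 * real p ^ 3)" by (intro mult_left_mono chi_sixth_moment_le p) auto
  also have "\<dots> \<le> D\<^sup>2 * real p ^ 3" by (simp add: mult_left_mono)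
  finally show "(\<integral>r. (\<psi> r)\<^sup>2 \<partial>chi p) \<le> D\<^sup>2 * real p ^ 3" .
  have I6: "integrable (chi p) (\<lambda>r. D\<^sup>2 / 36 * (r ^ 6 * exp (- \<psi> r)))"
    using integrable_power_exp[of 3] by simp
  have AE_sq': "AE r in chi p. (\<psi> r)\<^sup>2 * exp (- \<psi> r) \<le> D\<^sup>2 / 36 * (r ^ 6 * exp (- \<psi> r))"
    using AE_sq
  proof eventually_elim
    case (elim r)
    from mult_right_mono[OF this, of "exp (- \<psi> r)"] show ?case by (simp add: mult.assoc)
  qed
  show int: "integrable (chi p) (\<lambda>r. (\<psi> r)\<^sup>2 * exp (- \<psi> r))"
  proof (rule Bochner_Integration.integrable_bound[OF I6])
    show "AE r in chi p. norm ((\<psi> r)\<^sup>2 * exp (- \<psi> r)) \<le> norm (D\<^sup>2 / 36 * (r ^ 6 * exp (- \<psi> r)))"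
      using AE_sq' by eventually_elim (auto intro: order.trans[OF _ abs_ge_self])
  qed measurable
  have "(\<integral>r. (\<psi> r)\<^sup>2 * exp (- \<psi> r) \<partial>chi p) \<le> (\<integral>r. D\<^sup>2 / 36 * (r ^ 6 * exp (- \<psi> r)) \<partial>chi p)"
    by (intro integral_mono_AE int I6 AE_sq')
  also have "\<dots> = D\<^sup>2 / 36 * (\<integral>r. r ^ 6 * exp (- \<psi> r) \<partial>chi p)" by simp
  also have "\<dots> \<le> D\<^sup>2 / 36 * (46 * real p ^ 3)" by (intro mult_left_mono sixth_moment_tilted) auto
  finally show "(\<integral>r. (\<psi> r)\<^sup>2 * exp (- \<psi> r) \<partial>chi p) \<le> 46/36 * (D\<^sup>2 * real p ^ 3)" by simp
qed

text \<open>
  First order expansion of \<open>exp (- \<psi>)\<close>, with the remainder \<open>exp_remainder_2\<close>.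
\<close>

lemma tilt_mass_expansion: "\<bar>tilt_mass - 1 + mean\<bar> \<le> 2 * (D\<^sup>2 * real p ^ 3)"
proof -
  have eq: "tilt_mass - 1 + mean = (\<integral>r. exp (- \<psi> r) - 1 - (- \<psi> r) \<partial>chi p)"
    using integrable_exp prob_space by (simp add: tilt_mass_def mean_def)
  have ub: "(\<integral>r. exp (- \<psi> r) - 1 - (- \<psi> r) \<partial>chi p) \<le> (\<integral>r. 1/2 * (\<psi> r)\<^sup>2 + 1/2 * ((\<psi> r)\<^sup>2 * exp (- \<psi> r)) \<partial>chi p)"
  proof (rule integral_mono)
    show "integrable (chi p) (\<lambda>r. exp (- \<psi> r) - 1 - (- \<psi> r))" using integrable_exp by simp
    show "integrable (chi p) (\<lambda>r. 1/2 * (\<psi> r)\<^sup>2 + 1/2 * ((\<psi> r)\<^sup>2 * exp (- \<psi> r)))"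
      using integrable_psi_power[of 2] square_psi_exp(1) by simp
    show "exp (- \<psi> r) - 1 - (- \<psi> r) \<le> 1/2 * (\<psi> r)\<^sup>2 + 1/2 * ((\<psi> r)\<^sup>2 * exp (- \<psi> r))" for r
      using exp_remainder_2(2)[of "- \<psi> r"] by (simp add: field_simps)
  qed
  also have "\<dots> = 1/2 * (\<integral>r. (\<psi> r)\<^sup>2 \<partial>chi p) + 1/2 * (\<integral>r. (\<psi> r)\<^sup>2 * exp (- \<psi> r) \<partial>chi p)"
    using integrable_psi_power[of 2] square_psi_exp(1) by (subst Bochner_Integration.integral_add) auto
  also have "\<dots> \<le> 2 * (D\<^sup>2 * real p ^ 3)"
  proof -
    have "0 \<le> D\<^sup>2 * real p ^ 3" by simp
    with square_psi square_psi_exp(2) show ?thesis by linarith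
  qed
  finally have "tilt_mass - 1 + mean \<le> 2 * (D\<^sup>2 * real p ^ 3)" unfolding eq .
  moreover have "0 \<le> tilt_mass - 1 + mean"
    unfolding eq by (intro integral_nonneg_AE AE_I2 exp_remainder_2(1))
  ultimately show ?thesis by simp
qed

text \<open>
  The derivative is at most \<open>D (r\<^sup>2 + p) / 2\<close> between \<open>\<surd>p\<close> and
  \<open>r\<close>, and \<open>\<bar>r - \<surd>p\<bar> \<le> \<bar>r\<^sup>2 - p\<bar> / \<surd>p\<close>. The
  product is a multiple of \<open>r\<^sup>4 - p\<^sup>2\<close>, the quantity of
  \<open>chi_concentration\<close>.
\<close>

lemma psi_increment:
  assumes r: "0 \<le> r"
  shows "\<bar>\<psi> r - \<psi> (sqrt (real p))\<bar> \<le> D / 2 * (\<bar>r ^ 4 - real p ^ 2\<bar> / sqrt (real p))"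
proof -
  define s where "s = sqrt (real p)"
  have s: "0 < s" "s\<^sup>2 = real p" using p by (simp_all add: s_def)
  have "\<bar>\<psi> r - \<psi> s\<bar> \<le> D / 2 * (r\<^sup>2 + s\<^sup>2) * \<bar>r - s\<bar>"
  proof -
    have "norm (\<psi> r - \<psi> s) \<le> D / 2 * (r\<^sup>2 + s\<^sup>2) * norm (r - s)"
    proof (rule field_differentiable_bound[where S="{0..max r s}"])
      fix z assume z: "z \<in> {0..max r s}"
      show "(\<psi> has_field_derivative \<psi>' z) (at z within {0..max r s})"
        using deriv by (rule has_field_derivative_at_within)
      have "z\<^sup>2 \<le> (max r s)\<^sup>2" using z by (intro power_mono) auto
      also have "\<dots> \<le> r\<^sup>2 + s\<^sup>2" by (auto simp: max_def)
      finally have "D / 2 * z\<^sup>2 \<le> D / 2 * (r\<^sup>2 + s\<^sup>2)" using D by (intro mult_left_mono) auto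
      then show "norm (\<psi>' z) \<le> D / 2 * (r\<^sup>2 + s\<^sup>2)" using bound'[of z] z by simp
    qed (use r s in auto)
    then show ?thesis by simp
  qed
  also have "\<dots> \<le> D / 2 * (r\<^sup>2 + s\<^sup>2) * (\<bar>r\<^sup>2 - s\<^sup>2\<bar> / s)"
  proof (intro mult_left_mono)
    have "\<bar>r - s\<bar> * s \<le> \<bar>r - s\<bar> * (r + s)" using r s by (intro mult_left_mono) auto
    also have "\<dots> = \<bar>r\<^sup>2 - s\<^sup>2\<bar>"
    proof -
      have "r\<^sup>2 - s\<^sup>2 = (r - s) * (r + s)" by (simp add: power2_eq_square algebra_simps)
      then show ?thesis using r s by (simp add: abs_mult)
    qed
    finally show "\<bar>r - s\<bar> \<le> \<bar>r\<^sup>2 - s\<^sup>2\<bar> / s" using s by (simp add: field_simps)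
  qed (use D in auto)
  also have "\<dots> = D / 2 * (\<bar>r ^ 4 - real p ^ 2\<bar> / s)"
  proof -
    have "r ^ 4 - real p ^ 2 = (r\<^sup>2 - s\<^sup>2) * (r\<^sup>2 + s\<^sup>2)"
      unfolding s(2)[symmetric] by (simp add: power2_eq_square eval_nat_numeral algebra_simps)
    then show ?thesis by (simp add: abs_mult)
  qed
  finally show ?thesis by (simp add: s_def)
qed

definition "increment r = \<psi> r - \<psi> (sqrt (real p))"

lemma measurable_increment [measurable]: "increment \<in> borel_measurable borel"
  unfolding increment_def[abs_def] by measurable

lemma measurable_centred [measurable]: "centred \<in> borel_measurable borel"
  unfolding centred_def[abs_def] by measurable

lemma AE_increment_fourth_le: "AE r in chi p. increment r ^ 4 \<le> D ^ 4 / (16 * real p ^ 2) * (r ^ 4 - real p ^ 2) ^ 4"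
  using AE_chi_nonneg
proof eventually_elim
  case (elim r)
  have "increment r ^ 4 = \<bar>increment r\<bar> ^ 4" by simp
  also have "\<dots> \<le> (D / 2 * (\<bar>r ^ 4 - real p ^ 2\<bar> / sqrt (real p))) ^ 4"
    using psi_increment[OF elim] by (intro power_mono) (auto simp: increment_def)
  also have "\<dots> = D ^ 4 / (16 * sqrt (real p) ^ 4) * (r ^ 4 - real p ^ 2) ^ 4"
    by (simp add: power_mult_distrib power_divide)
  also have "sqrt (real p) ^ 4 = (sqrt (real p) ^ 2) ^ 2" by (simp only: power_mult[symmetric]) simp
  finally show ?case by simp
qed

text \<open>
  The increment is of order \<open>D p\<close>, by \<open>psi_increment\<close> and
  \<open>chi_concentration\<close>. This is smaller by a factor \<open>\<surd>p\<close> than the order \<open>D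
  p\<^sup>3\<^sup>/\<^sup>2\<close> of the bound on \<open>\<psi>\<close> itself.
\<close>

lemma increment_fourth_moment: "integrable (chi p) (\<lambda>r. increment r ^ 4)"
    "(\<integral>r. increment r ^ 4 \<partial>chi p) \<le> 125000 * (D ^ 4 * real p ^ 4)"
  and increment_fourth_moment_tilted: "integrable (chi p) (\<lambda>r. increment r ^ 4 * exp (- \<psi> r))"
    "(\<integral>r. increment r ^ 4 * exp (- \<psi> r) \<partial>chi p) \<le> 400000 * (D ^ 4 * real p ^ 4)"
proof -
  have P: "1 \<le> real p" using p by simp
  let ?Q = "\<lambda>r. (r ^ 4 - real p ^ 2) ^ 4" and ?c = "D ^ 4 / (16 * real p ^ 2)"
  have c: "0 \<le> ?c" by simp
  have cp: "?c * (a * real p ^ 6) = a / 16 * (D ^ 4 * real p ^ 4)" for a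
    using P by (simp add: field_simps eval_nat_numeral)
  have iQ: "integrable (chi p) (\<lambda>r. ?c * ?Q r)" by (intro integrable_mult_right chi_concentration p)
  show i1: "integrable (chi p) (\<lambda>r. increment r ^ 4)"
  proof (rule Bochner_Integration.integrable_bound[OF iQ])
    show "AE r in chi p. norm (increment r ^ 4) \<le> norm (?c * ?Q r)"
      using AE_increment_fourth_le by eventually_elim simp
  qed measurable
  have "(\<integral>r. increment r ^ 4 \<partial>chi p) \<le> (\<integral>r. ?c * ?Q r \<partial>chi p)" by (intro integral_mono_AE i1 iQ AE_increment_fourth_le)
  also have "\<dots> = ?c * (\<integral>r. ?Q r \<partial>chi p)" by (rule integral_mult_right_zero)
  also have "\<dots> \<le> ?c * (2000000 * real p ^ 6)" by (intro mult_left_mono chi_concentration p c)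
  finally show "(\<integral>r. increment r ^ 4 \<partial>chi p) \<le> 125000 * (D ^ 4 * real p ^ 4)" unfolding cp by simp
  have Qb: "0 \<le> ?Q r \<and> ?Q r \<le> r ^ 16 + real p ^ 8" if "0 \<le> r" for r :: real
  proof -
    have "\<bar>r ^ 4 - real p ^ 2\<bar> \<le> max (r ^ 4) (real p ^ 2)" by (simp add: max_def abs_if)
    then have "\<bar>r ^ 4 - real p ^ 2\<bar> ^ 4 \<le> max (r ^ 4) (real p ^ 2) ^ 4" by (intro power_mono) auto
    also have "\<dots> \<le> r ^ 16 + real p ^ 8" by (simp add: max_def flip: power_mult)
    finally show ?thesis by simp
  qed
  note t = tilted_expectation_small[OF _ chi_concentration(1)[OF p] Qb]
  have iQe: "integrable (chi p) (\<lambda>r. ?c * (?Q r * exp (- \<psi> r)))"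
    by (intro integrable_mult_right t) auto
  have AE': "AE r in chi p. increment r ^ 4 * exp (- \<psi> r) \<le> ?c * (?Q r * exp (- \<psi> r))"
    using AE_increment_fourth_le
  proof eventually_elim
    case (elim r)
    from mult_right_mono[OF this, of "exp (- \<psi> r)"] show ?case by (simp add: mult.assoc)
  qed
  show i2: "integrable (chi p) (\<lambda>r. increment r ^ 4 * exp (- \<psi> r))"
  proof (rule Bochner_Integration.integrable_bound[OF iQe])
    show "AE r in chi p. norm (increment r ^ 4 * exp (- \<psi> r)) \<le> norm (?c * (?Q r * exp (- \<psi> r)))"
      using AE' by eventually_elim simp
  qed measurable
  have "(\<integral>r. increment r ^ 4 * exp (- \<psi> r) \<partial>chi p) \<le> (\<integral>r. ?c * (?Q r * exp (- \<psi> r)) \<partial>chi p)"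
    by (intro integral_mono_AE i2 iQe AE')
  also have "\<dots> = ?c * (\<integral>r. ?Q r * exp (- \<psi> r) \<partial>chi p)" by (rule integral_mult_right_zero)
  also have "\<dots> \<le> ?c * (6400000 * real p ^ 6)"
  proof (intro mult_left_mono c)
    have "(\<integral>r. ?Q r * exp (- \<psi> r) \<partial>chi p) \<le> 3 * (\<integral>r. ?Q r \<partial>chi p) + (sqrt (real p) ^ 16 + real p ^ 8) * (2 / 17) ^ p"
      by (intro t) auto
    also have "sqrt (real p) ^ 16 = (sqrt (real p) ^ 2) ^ 8" by (simp only: power_mult[symmetric]) simp
    also have "((sqrt (real p) ^ 2) ^ 8 + real p ^ 8) * (2 / 17) ^ p = 2 * real p ^ 6 * ((real p)\<^sup>2 * (2 / 17) ^ p)"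
      by (simp flip: power_add add: mult.assoc[symmetric])
    also have "\<dots> \<le> 2 * real p ^ 6 * 1" by (intro mult_left_mono two_seventeenths_power) auto
    finally show "(\<integral>r. ?Q r * exp (- \<psi> r) \<partial>chi p) \<le> 6400000 * real p ^ 6"
      using chi_concentration(2)[OF p] by (smt (verit) zero_le_power of_nat_0_le_iff)
  qed
  finally show "(\<integral>r. increment r ^ 4 * exp (- \<psi> r) \<partial>chi p) \<le> 400000 * (D ^ 4 * real p ^ 4)" unfolding cp by simp
qed

lemma Jensen_square:
  fixes X :: "real \<Rightarrow> real"
  assumes "integrable (chi p) X" "integrable (chi p) (\<lambda>r. (X r)\<^sup>2)"
  shows "(\<integral>r. X r \<partial>chi p)\<^sup>2 \<le> (\<integral>r. (X r)\<^sup>2 \<partial>chi p)"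
proof -
  have "0 \<le> variance X" by (rule variance_positive)
  then show ?thesis using variance_eq[OF assms] by simp
qed

lemma integrable_increment: "integrable (chi p) increment" "integrable (chi p) (\<lambda>r. (increment r)\<^sup>2)"
proof -
  show "integrable (chi p) increment" unfolding increment_def[abs_def] by simp
  show "integrable (chi p) (\<lambda>r. (increment r)\<^sup>2)"
    unfolding increment_def using integrable_psi_power[of 2] by (simp add: power2_diff)
qed

lemma centred_eq: "centred r = (\<integral>r. increment r \<partial>chi p) - increment r"
  unfolding centred_def increment_def[abs_def] mean_def using prob_space by simp

lemma mean_increment_fourth_le: "(\<integral>r. increment r \<partial>chi p) ^ 4 \<le> 125000 * (D ^ 4 * real p ^ 4)"
proof -
  have e: "(\<lambda>r. ((increment r)\<^sup>2)\<^sup>2) = (\<lambda>r. increment r ^ 4)" by (simp flip: power_mult)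
  have "(\<integral>r. increment r \<partial>chi p) ^ 4 = ((\<integral>r. increment r \<partial>chi p)\<^sup>2)\<^sup>2" by (simp flip: power_mult)
  also have "\<dots> \<le> (\<integral>r. (increment r)\<^sup>2 \<partial>chi p)\<^sup>2"
    by (intro power_mono Jensen_square integrable_increment) auto
  also have "\<dots> \<le> (\<integral>r. ((increment r)\<^sup>2)\<^sup>2 \<partial>chi p)"
    by (rule Jensen_square) (use integrable_increment increment_fourth_moment(1) e in simp_all)
  also have "\<dots> \<le> 125000 * (D ^ 4 * real p ^ 4)" unfolding e by (rule increment_fourth_moment(2))
  finally show ?thesis .
qed

text \<open>
  The centred remainder is the negative of the centred increment, and the tilt by \<open>exp centred\<close>
  differs from the tilt by \<open>exp (- \<psi>)\<close> by the bounded factor \<open>exp mean\<close>.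
\<close>

lemma centred_fourth_moment_tilted: "integrable (chi p) (\<lambda>r. centred r ^ 4 * (1 + exp (centred r)))"
    "(\<integral>r. centred r ^ 4 * (1 + exp (centred r)) \<partial>chi p) \<le> 24000000 * (D ^ 4 * real p ^ 4)"
  and centred_fourth_moment: "integrable (chi p) (\<lambda>r. centred r ^ 4)"
    "(\<integral>r. centred r ^ 4 \<partial>chi p) \<le> 2250000 * (D ^ 4 * real p ^ 4)"
proof -
  let ?m = "(\<integral>r. increment r \<partial>chi p)" and ?d = "D ^ 4 * real p ^ 4"
  have d: "0 \<le> ?d" by simp
  have b: "centred r ^ 4 \<le> 8 * (?m ^ 4 + increment r ^ 4)" for r unfolding centred_eq by (rule fourth_power_diff_le)
  have i1: "integrable (chi p) (\<lambda>r. 8 * (?m ^ 4 + increment r ^ 4))" using increment_fourth_moment(1) by simp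
  show i2: "integrable (chi p) (\<lambda>r. centred r ^ 4)"
    by (rule Bochner_Integration.integrable_bound[OF i1])
       (measurable, use b in \<open>auto intro!: AE_I2 order.trans[OF _ abs_ge_self]\<close>)
  have "(\<integral>r. centred r ^ 4 \<partial>chi p) \<le> (\<integral>r. 8 * (?m ^ 4 + increment r ^ 4) \<partial>chi p)"
    by (intro integral_mono i2 i1 b)
  also have "\<dots> = 8 * (?m ^ 4 + (\<integral>r. increment r ^ 4 \<partial>chi p))" using increment_fourth_moment(1) prob_space by simp
  also have "\<dots> \<le> 8 * (125000 * ?d + 125000 * ?d)"
    by (intro mult_left_mono add_mono mean_increment_fourth_le increment_fourth_moment(2)) simp
  also have "\<dots> = 2000000 * ?d" by simp
  finally have fourth: "(\<integral>r. centred r ^ 4 \<partial>chi p) \<le> 2000000 * ?d" .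
  then show "(\<integral>r. centred r ^ 4 \<partial>chi p) \<le> 2250000 * ?d" using d by linarith
  have eY: "exp (centred r) = exp mean * exp (- \<psi> r)" for r by (simp add: centred_def flip: exp_add)
  have be: "centred r ^ 4 * exp (centred r) \<le> exp mean * (8 * (?m ^ 4 * exp (- \<psi> r) + increment r ^ 4 * exp (- \<psi> r)))" for r
    using mult_right_mono[OF b[of r], of "exp mean * exp (- \<psi> r)"] unfolding eY by (simp add: algebra_simps)
  have i3: "integrable (chi p) (\<lambda>r. exp mean * (8 * (?m ^ 4 * exp (- \<psi> r) + increment r ^ 4 * exp (- \<psi> r))))"
    using increment_fourth_moment_tilted(1) integrable_exp by simp
  have i4: "integrable (chi p) (\<lambda>r. centred r ^ 4 * exp (centred r))"
    by (rule Bochner_Integration.integrable_bound[OF i3])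
       (measurable, use be in \<open>auto intro!: AE_I2 order.trans[OF _ abs_ge_self]\<close>)
  have "(\<integral>r. centred r ^ 4 * exp (centred r) \<partial>chi p)
     \<le> (\<integral>r. exp mean * (8 * (?m ^ 4 * exp (- \<psi> r) + increment r ^ 4 * exp (- \<psi> r))) \<partial>chi p)"
    by (intro integral_mono i4 i3 be)
  also have "\<dots> = exp mean * (8 * (?m ^ 4 * tilt_mass + (\<integral>r. increment r ^ 4 * exp (- \<psi> r) \<partial>chi p)))"
    using increment_fourth_moment_tilted(1) integrable_exp by (simp add: tilt_mass_def)
  also have "\<dots> \<le> exp mean * (8 * (125000 * ?d * 4 + 400000 * ?d))"
  proof -
    have "?m ^ 4 * tilt_mass \<le> 125000 * ?d * 4"
      using mean_increment_fourth_le tilt_mass_le tilt_mass_pos d by (intro mult_mono) auto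
    then show ?thesis using increment_fourth_moment_tilted(2) by (intro mult_left_mono add_mono) auto
  qed
  also have "\<dots> \<le> 3 * (8 * (125000 * ?d * 4 + 400000 * ?d))"
  proof (intro mult_right_mono)
    have "mean \<le> 1" using abs_mean_le small by linarith
    then have "exp mean \<le> exp 1" by simp
    then show "exp mean \<le> 3" using e_less_272 by linarith
  qed simp
  finally have "(\<integral>r. centred r ^ 4 * exp (centred r) \<partial>chi p) \<le> 21600000 * ?d" by simp
  moreover have "(\<integral>r. centred r ^ 4 * (1 + exp (centred r)) \<partial>chi p) = (\<integral>r. centred r ^ 4 \<partial>chi p) + (\<integral>r. centred r ^ 4 * exp (centred r) \<partial>chi p)"
    using i2 i4 by (simp add: distrib_left)
  ultimately show "(\<integral>r. centred r ^ 4 * (1 + exp (centred r)) \<partial>chi p) \<le> 24000000 * ?d"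
    using fourth d by linarith
  show "integrable (chi p) (\<lambda>r. centred r ^ 4 * (1 + exp (centred r)))"
    using i2 i4 by (simp add: distrib_left)
qed

text \<open>
  By Cauchy-Schwarz from the fourth moment; the constant of the latter is rounded up to
  \<open>1500\<^sup>2\<close>.
\<close>

lemma centred_second_moment: "integrable (chi p) (\<lambda>r. (centred r)\<^sup>2)" "(\<integral>r. (centred r)\<^sup>2 \<partial>chi p) \<le> 1500 * (D\<^sup>2 * (real p)\<^sup>2)"
proof -
  show i: "integrable (chi p) (\<lambda>r. (centred r)\<^sup>2)"
    unfolding centred_def using integrable_psi_power[of 2] by (simp add: power2_diff)
  have e: "(\<lambda>r. ((centred r)\<^sup>2)\<^sup>2) = (\<lambda>r. centred r ^ 4)" by (simp flip: power_mult)
  have "(\<integral>r. (centred r)\<^sup>2 \<partial>chi p)\<^sup>2 \<le> (\<integral>r. ((centred r)\<^sup>2)\<^sup>2 \<partial>chi p)"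
    by (rule Jensen_square) (use i centred_fourth_moment(1) e in simp_all)
  also have "\<dots> \<le> 2250000 * (D ^ 4 * real p ^ 4)" unfolding e by (rule centred_fourth_moment(2))
  also have "\<dots> = (1500 * (D\<^sup>2 * (real p)\<^sup>2))\<^sup>2" by (simp add: power_mult_distrib flip: power_mult)
  finally show "(\<integral>r. (centred r)\<^sup>2 \<partial>chi p) \<le> 1500 * (D\<^sup>2 * (real p)\<^sup>2)"
    by (rule power2_le_imp_le) simp
qed

text \<open>
  The left-hand side is \<open>ln (E (exp centred))\<close>, which is at most \<open>E (exp centred) -
  1\<close>; the linear term of \<open>exp_remainder_4\<close> has mean \<open>0\<close>.
\<close>

lemma radial_KL_le: "mean + ln tilt_mass \<le> 51/100 * (\<integral>r. (centred r)\<^sup>2 \<partial>chi p) + 48000000 * (D ^ 4 * real p ^ 4)"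
proof -
  have "exp mean * tilt_mass = (\<integral>r. exp (centred r) \<partial>chi p)" by (simp add: integral_exp_centred)
  also have "\<dots> \<le> (\<integral>r. 1 + centred r + 51/100 * (centred r)\<^sup>2 + 2 * (centred r ^ 4 * (1 + exp (centred r))) \<partial>chi p)"
    using integrable_centred centred_second_moment(1) centred_fourth_moment_tilted(1) integrable_exp_centred
    by (intro integral_mono exp_remainder_4) auto
  also have "\<dots> = 1 + 51/100 * (\<integral>r. (centred r)\<^sup>2 \<partial>chi p) + 2 * (\<integral>r. centred r ^ 4 * (1 + exp (centred r)) \<partial>chi p)"
    using integrable_centred centred_second_moment(1) centred_fourth_moment_tilted(1) integral_centred prob_space by simp
  also have "\<dots> \<le> 1 + 51/100 * (\<integral>r. (centred r)\<^sup>2 \<partial>chi p) + 48000000 * (D ^ 4 * real p ^ 4)"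
    using centred_fourth_moment_tilted(2) by simp
  finally have le: "exp mean * tilt_mass - 1 \<le> 51/100 * (\<integral>r. (centred r)\<^sup>2 \<partial>chi p) + 48000000 * (D ^ 4 * real p ^ 4)" by simp
  have "mean + ln tilt_mass = ln (exp mean * tilt_mass)" using tilt_mass_pos by (simp add: ln_mult)
  also have "\<dots> \<le> exp mean * tilt_mass - 1" using tilt_mass_pos by (intro ln_le_minus_one) simp
  finally show ?thesis using le by simp
qed

text \<open>
  With \<open>s = \<surd>p\<close>, the left-hand side is \<open>(D s\<^sup>2)\<^sup>4\<close> and \<open>D
  s\<^sup>2 \<le> D s\<^sup>3 \<le> 1 / 25000\<close>. The second bound uses that \<open>(D s\<^sup>2)\<^sup>4 =
  D\<^sup>3 s\<^sup>5 * D s\<^sup>3\<close>.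
\<close>

lemma fourth_order_le:
  "D ^ 4 * real p ^ 4 \<le> D\<^sup>2 * (real p)\<^sup>2 / 625000000" "D ^ 4 * real p ^ 4 \<le> D ^ 3 * real p powr (5/2)"
proof -
  define s where "s = sqrt (real p)"
  have s: "1 \<le> s" "real p = s\<^sup>2" using p by (simp_all add: s_def)
  have sm: "D * s ^ 3 \<le> 1 / 25000" using small by (simp add: s_def)
  have "D * s\<^sup>2 \<le> D * s ^ 3" using s D by (intro mult_left_mono power_increasing) auto
  then have "(D * s\<^sup>2)\<^sup>2 \<le> (1 / 25000)\<^sup>2" using sm D by (intro power_mono) auto
  then have "(D * s\<^sup>2)\<^sup>2 * (D * s\<^sup>2)\<^sup>2 \<le> (1 / 25000)\<^sup>2 * (D * s\<^sup>2)\<^sup>2" by (intro mult_right_mono) auto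
  then show "D ^ 4 * real p ^ 4 \<le> D\<^sup>2 * (real p)\<^sup>2 / 625000000"
    unfolding s(2) by (simp add: power_mult_distrib power2_eq_square eval_nat_numeral mult_ac)
  have "(D ^ 3 * s ^ 5) * (D * s ^ 3) \<le> (D ^ 3 * s ^ 5) * 1"
    using sm s D by (intro mult_left_mono) auto
  moreover have "(D ^ 3 * s ^ 5) * (D * s ^ 3) = D ^ 4 * (s\<^sup>2) ^ 4"
    by (simp add: eval_nat_numeral mult_ac)
  ultimately show "D ^ 4 * real p ^ 4 \<le> D ^ 3 * real p powr (5/2)"
    unfolding half_integer_powers(2)[OF p] unfolding s_def[symmetric] unfolding s(2) by simp
qed

theorem radial_KL_le_square: "mean + ln tilt_mass \<le> 1000 * (D\<^sup>2 * (real p)\<^sup>2)"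
proof -
  have d: "0 \<le> D\<^sup>2 * (real p)\<^sup>2" by simp
  have "mean + ln tilt_mass \<le> 51/100 * (1500 * (D\<^sup>2 * (real p)\<^sup>2)) + 48000000 * (D\<^sup>2 * (real p)\<^sup>2 / 625000000)"
    by (rule order.trans[OF radial_KL_le]) (intro add_mono mult_left_mono centred_second_moment fourth_order_le; simp)
  also have "\<dots> \<le> 1000 * (D\<^sup>2 * (real p)\<^sup>2)" using d by (simp add: field_simps)
  finally show ?thesis .
qed

lemma integrable_gradient_square: "integrable (chi p) (\<lambda>r. r powr (4/3) * (\<psi>' r)\<^sup>2)"
proof (rule Bochner_Integration.integrable_bound)
  show "integrable (chi p) (\<lambda>r. D\<^sup>2 / 4 * (r ^ 4 + r ^ 6))"
    using integrable_chi_power[OF p] by simp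
  show "AE r in chi p. norm (r powr (4/3) * (\<psi>' r)\<^sup>2) \<le> norm (D\<^sup>2 / 4 * (r ^ 4 + r ^ 6))"
    using AE_chi_nonneg
  proof eventually_elim
    case (elim r)
    have pw: "r powr (4/3) \<le> 1 + r\<^sup>2"
    proof (cases "r \<le> 1")
      case True
      then have "r powr (4/3) \<le> 1" using elim by (intro powr_le1) auto
      then show ?thesis by (simp add: add_increasing2)
    next
      case False
      then have "r powr (4/3) \<le> r powr 2" by (intro powr_mono) auto
      then show ?thesis using False by (simp add: powr_numeral)
    qed
    have "\<bar>\<psi>' r\<bar>\<^sup>2 \<le> (D / 2 * r\<^sup>2)\<^sup>2" using bound'[OF elim] by (intro power_mono) auto
    then have "(\<psi>' r)\<^sup>2 \<le> D\<^sup>2 / 4 * r ^ 4" by (simp add: power_mult_distrib power_divide flip: power_mult)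
    then have "r powr (4/3) * (\<psi>' r)\<^sup>2 \<le> (1 + r\<^sup>2) * (D\<^sup>2 / 4 * r ^ 4)" using pw by (intro mult_mono) auto
    also have "\<dots> = D\<^sup>2 / 4 * (r ^ 4 + r ^ 6)" by (simp add: eval_nat_numeral algebra_simps)
    finally show ?case by (simp add: abs_mult)
  qed
qed measurable

theorem radial_KL_le_gradient:
  "mean + ln tilt_mass \<le> 1 / (2 * real p powr (2/3)) * (\<integral>r. r powr (4/3) * (\<psi>' r)\<^sup>2 \<partial>chi p)
     + 48000000 * (D ^ 3 * real p powr (5/2))"
proof -
  have "51/50 * (\<integral>r. (\<psi> r - mean)\<^sup>2 \<partial>chi p) \<le> (\<integral>r. r powr (4/3) * (\<psi>' r)\<^sup>2 \<partial>chi p) / real p powr (2/3)"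
    unfolding mean_def
    by (rule chi_poincare[OF p deriv cont' integrable_psi_power integrable_gradient_square])
  moreover have "(\<lambda>r. (\<psi> r - mean)\<^sup>2) = (\<lambda>r. (centred r)\<^sup>2)" by (simp add: centred_def power2_commute)
  ultimately have "51/100 * (\<integral>r. (centred r)\<^sup>2 \<partial>chi p) \<le> 1 / (2 * real p powr (2/3)) * (\<integral>r. r powr (4/3) * (\<psi>' r)\<^sup>2 \<partial>chi p)"
    by (simp add: mult.commute)
  moreover have "48000000 * (D ^ 4 * real p ^ 4) \<le> 48000000 * (D ^ 3 * real p powr (5/2))"
    by (intro mult_left_mono fourth_order_le) simp
  ultimately show ?thesis using radial_KL_le by linarith
qed

end

section \<open>Gibbs measures and their tilts\<close>

definition partition_fn :: "nat \<Rightarrow> (rvec \<Rightarrow> real) \<Rightarrow> real" where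
  "partition_fn p \<phi> = (\<integral>x. exp (- \<phi> x) \<partial>leb p)"

lemma Rn_sets [simp, measurable]: "Rn p \<in> sets (leb p)"
  using sets.top[of "leb p"] by simp

lemma measurable_potential:
  fixes \<phi> :: "rvec \<Rightarrow> real"
  assumes "integrable (leb p) (\<lambda>x. exp (- \<phi> x))"
  shows "\<phi> \<in> borel_measurable (leb p)"
proof -
  have "(\<lambda>x. exp (- \<phi> x)) \<in> borel_measurable (leb p)" using assms by auto
  then have "(\<lambda>x. - ln (exp (- \<phi> x))) \<in> borel_measurable (leb p)" by measurable
  then show ?thesis by simp
qed

lemma partition_fn_pos:
  assumes "integrable (leb p) (\<lambda>x. exp (- \<phi> x))"
  shows "0 < partition_fn p \<phi>"
proof (rule ccontr)
  assume "\<not> 0 < partition_fn p \<phi>"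
  moreover have "0 \<le> partition_fn p \<phi>" unfolding partition_fn_def by (intro integral_nonneg_AE AE_I2) simp
  ultimately have "partition_fn p \<phi> = 0" by linarith
  then have "(\<integral>x. exp (- \<phi> x) \<partial>leb p) = 0" by (simp only: partition_fn_def)
  then have "AE x in leb p. exp (- \<phi> x) = 0"
    using assms by (subst (asm) integral_nonneg_eq_0_iff_AE) auto
  then have "AE x in leb p. False" by simp
  then have "emeasure (leb p) (space (leb p)) = 0" by (simp add: AE_iff_null_sets[of "space (leb p)"] ae_filter_eq_bot_iff flip: trivial_limit_def)
  then show False using emeasure_leb_Rn_neq_0[of p] by simp
qed

lemma gibbs_eq:
  assumes "integrable (leb p) (\<lambda>x. exp (- \<phi> x))"
  shows "gibbs p \<phi> = density (leb p) (\<lambda>x. ennreal (exp (- \<phi> x) / partition_fn p \<phi>))"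
  unfolding gibbs_def partition_fn_def[symmetric]
  using partition_fn_pos[OF assms] by (simp add: exp_diff)

lemma sets_gibbs [simp, measurable_cong]: "sets (gibbs p \<phi>) = sets (leb p)"
  and space_gibbs [simp]: "space (gibbs p \<phi>) = Rn p"
  by (simp_all add: gibbs_def)

lemma prob_space_gibbs:
  assumes "integrable (leb p) (\<lambda>x. exp (- \<phi> x))"
  shows "prob_space (gibbs p \<phi>)"
proof
  have m: "\<phi> \<in> borel_measurable (leb p)" by (rule measurable_potential[OF assms])
  have "emeasure (gibbs p \<phi>) (space (gibbs p \<phi>)) = (\<integral>\<^sup>+x. ennreal (exp (- \<phi> x) / partition_fn p \<phi>) \<partial>leb p)"
    unfolding gibbs_eq[OF assms] using m by (subst emeasure_density) (auto intro!: nn_integral_cong)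
  also have "\<dots> = ennreal (\<integral>x. exp (- \<phi> x) / partition_fn p \<phi> \<partial>leb p)"
    using assms partition_fn_pos[OF assms] by (intro nn_integral_eq_integral) auto
  also have "(\<integral>x. exp (- \<phi> x) / partition_fn p \<phi> \<partial>leb p) = 1"
    using partition_fn_pos[OF assms] by (simp add: partition_fn_def)
  finally show "emeasure (gibbs p \<phi>) (space (gibbs p \<phi>)) = 1" by simp
qed

text \<open>
  The additive constant \<open>c\<close> is absorbed by the normalization. This form lets the minimum of the
  potential disappear from the remainder.
\<close>

lemma gibbs_tilt:
  assumes i0: "integrable (leb p) (\<lambda>x. exp (- \<phi>0 x))" and i1: "integrable (leb p) (\<lambda>x. exp (- \<phi>1 x))"
    and h: "\<And>x. x \<in> Rn p \<Longrightarrow> \<phi>1 x = \<phi>0 x + h x + c"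
  shows "integrable (gibbs p \<phi>0) (\<lambda>x. exp (- h x))"
    and "gibbs p \<phi>1 = density (gibbs p \<phi>0) (\<lambda>x. ennreal (exp (- h x) / (\<integral>x. exp (- h x) \<partial>gibbs p \<phi>0)))"
proof -
  let ?Z0 = "partition_fn p \<phi>0" and ?Z1 = "partition_fn p \<phi>1"
  have [measurable]: "\<phi>0 \<in> borel_measurable (leb p)" "\<phi>1 \<in> borel_measurable (leb p)"
    using i0 i1 by (auto intro: measurable_potential)
  have "(\<lambda>x. \<phi>1 x - \<phi>0 x - c) \<in> borel_measurable (leb p)" by measurable
  also have "?this \<longleftrightarrow> h \<in> borel_measurable (leb p)" by (rule measurable_cong) (simp add: h)
  finally have [measurable]: "h \<in> borel_measurable (leb p)" .
  have Z: "0 < ?Z0" "0 < ?Z1" using i0 i1 by (auto intro: partition_fn_pos)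
  have e: "exp (- \<phi>0 x) / ?Z0 * exp (- h x) = exp c / ?Z0 * exp (- \<phi>1 x)" if "x \<in> Rn p" for x
    using that by (simp add: h flip: exp_add)
  have "integrable (leb p) (\<lambda>x. exp (- \<phi>0 x) / ?Z0 * exp (- h x))
      \<longleftrightarrow> integrable (leb p) (\<lambda>x. exp c / ?Z0 * exp (- \<phi>1 x))"
    by (intro Bochner_Integration.integrable_cong refl) (simp only: space_leb e)
  then show int: "integrable (gibbs p \<phi>0) (\<lambda>x. exp (- h x))"
    unfolding gibbs_eq[OF i0] using i1 Z by (subst integrable_real_density) (auto intro!: integrable_mult_right)
  have E: "(\<integral>x. exp (- h x) \<partial>gibbs p \<phi>0) = exp c * ?Z1 / ?Z0"
  proof -
    have "(\<integral>x. exp (- h x) \<partial>gibbs p \<phi>0) = (\<integral>x. exp (- \<phi>0 x) / ?Z0 * exp (- h x) \<partial>leb p)"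
      unfolding gibbs_eq[OF i0] using Z by (subst integral_real_density) auto
    also have "\<dots> = (\<integral>x. exp c / ?Z0 * exp (- \<phi>1 x) \<partial>leb p)"
      by (intro Bochner_Integration.integral_cong refl) (simp only: space_leb e)
    finally show ?thesis by (simp add: partition_fn_def)
  qed
  show "gibbs p \<phi>1 = density (gibbs p \<phi>0) (\<lambda>x. ennreal (exp (- h x) / (\<integral>x. exp (- h x) \<partial>gibbs p \<phi>0)))"
    unfolding E unfolding gibbs_eq[OF i0] gibbs_eq[OF i1]
    apply (subst density_density_eq)
    subgoal using Z by measurable
    subgoal by measurable
    apply (rule density_cong)
    subgoal by measurable
    subgoal by measurable
    apply (rule AE_I2)
    subgoal for x using Z e[of x] by (simp add: ennreal_mult[symmetric] field_simps)
    done
qed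

text \<open>
  The log-ratio of the densities is \<open>h\<close> plus the logarithm of the normalizing constant. All
  divergences of the theorem, in total, for the direction and for the radius, have this form.
\<close>

lemma KL_tilt:
  assumes M: "prob_space M" and h: "integrable M h" and e: "integrable M (\<lambda>x. exp (- h x))"
  shows "KL M (density M (\<lambda>x. ennreal (exp (- h x) / (\<integral>x. exp (- h x) \<partial>M))))
     = (\<integral>x. h x \<partial>M) + ln (\<integral>x. exp (- h x) \<partial>M)" (is "_ = _ + ln ?E")
proof -
  interpret prob_space M by fact
  have [measurable]: "h \<in> borel_measurable M" using h by auto
  have E: "0 < ?E"
  proof -
    have "0 \<le> ?E" by (intro integral_nonneg_AE AE_I2) simp
    moreover have "?E \<noteq> 0"
    proof
      assume "?E = 0"
      then have "AE x in M. exp (- h x) = 0" using e by (subst (asm) integral_nonneg_eq_0_iff_AE) auto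
      then show False by simp
    qed
    ultimately show ?thesis by (metis less_le)
  qed
  have "KL M (density M (\<lambda>x. ennreal (exp (- h x) / ?E)))
    = KL_divergence (exp 1) (density M (\<lambda>x. ennreal (exp (- h x) / ?E))) (density M (\<lambda>x. ennreal 1))"
    by (simp add: KL_def density_1)
  also have "\<dots> = (\<integral>x. 1 * log (exp 1) (1 / (exp (- h x) / ?E)) \<partial>M)"
    by (rule KL_density_density) (use E in auto)
  also have "\<dots> = (\<integral>x. h x + ln ?E \<partial>M)"
    using E by (intro Bochner_Integration.integral_cong) (auto simp: log_def ln_div)
  also have "\<dots> = (\<integral>x. h x \<partial>M) + ln ?E" using h prob_space by simp
  finally show ?thesis .
qed

text \<open>
  The factor of \<open>distr_leb_standardize\<close> occurs in the density and in the normalization, and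
  cancels.
\<close>

lemma distr_gibbs_standardize:
  assumes inv: "minverse p S W" and \<mu>: "\<mu> \<in> Rn p"
    and \<psi> [measurable]: "\<psi> \<in> borel_measurable (leb p)"
    and \<phi>: "\<And>x. x \<in> Rn p \<Longrightarrow> \<phi> x = \<psi> (standardize p \<mu> W x)"
  shows "integrable (leb p) (\<lambda>x. exp (- \<phi> x)) \<longleftrightarrow> integrable (leb p) (\<lambda>y. exp (- \<psi> y))"
    and "integrable (leb p) (\<lambda>y. exp (- \<psi> y)) \<Longrightarrow> distr (gibbs p \<phi>) (leb p) (standardize p \<mu> W) = gibbs p \<psi>"
proof -
  obtain c where c: "0 < c" "distr (leb p) (leb p) (standardize p \<mu> W) = density (leb p) (\<lambda>_. ennreal c)"
    using distr_leb_standardize[OF inv \<mu>] .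
  note [measurable] = measurable_standardize[OF \<mu>, of W]
  have int_iff: "integrable (leb p) (\<lambda>x. exp (- \<phi> x)) \<longleftrightarrow> integrable (leb p) (\<lambda>x. exp (- \<psi> (standardize p \<mu> W x)))"
    by (intro Bochner_Integration.integrable_cong) (auto simp: \<phi>)
  also have "\<dots> \<longleftrightarrow> integrable (distr (leb p) (leb p) (standardize p \<mu> W)) (\<lambda>y. exp (- \<psi> y))"
    by (subst integrable_distr_eq) auto
  also have "\<dots> \<longleftrightarrow> integrable (leb p) (\<lambda>y. exp (- \<psi> y))"
    unfolding c(2) using c(1) by (subst integrable_real_density) auto
  finally show iff: "integrable (leb p) (\<lambda>x. exp (- \<phi> x)) \<longleftrightarrow> integrable (leb p) (\<lambda>y. exp (- \<psi> y))" .
  assume i: "integrable (leb p) (\<lambda>y. exp (- \<psi> y))"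
  have "partition_fn p \<phi> = (\<integral>x. exp (- \<psi> (standardize p \<mu> W x)) \<partial>leb p)"
    unfolding partition_fn_def by (intro Bochner_Integration.integral_cong) (auto simp: \<phi>)
  also have "\<dots> = (\<integral>y. exp (- \<psi> y) \<partial>distr (leb p) (leb p) (standardize p \<mu> W))"
    by (subst integral_distr) auto
  also have "\<dots> = c * partition_fn p \<psi>"
    unfolding c(2) partition_fn_def using c(1) by (subst integral_real_density) auto
  finally have Z: "partition_fn p \<phi> = c * partition_fn p \<psi>" .
  have "gibbs p \<phi> = density (leb p) (\<lambda>x. ennreal (exp (- \<psi> (standardize p \<mu> W x)) / partition_fn p \<phi>))"
    unfolding gibbs_eq[OF iff[THEN iffD2, OF i]]
    by (intro density_cong AE_I2) (use measurable_potential[OF iff[THEN iffD2, OF i]] in \<open>auto simp: \<phi>\<close>)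
  then have "distr (gibbs p \<phi>) (leb p) (standardize p \<mu> W)
     = density (distr (leb p) (leb p) (standardize p \<mu> W)) (\<lambda>y. ennreal (exp (- \<psi> y) / partition_fn p \<phi>))"
    by (subst density_distr) auto
  also have "\<dots> = density (leb p) (\<lambda>y. ennreal c * ennreal (exp (- \<psi> y) / partition_fn p \<phi>))"
    unfolding c(2) by (subst density_density_eq) auto
  also have "\<dots> = gibbs p \<psi>"
    unfolding gibbs_eq[OF i] Z using c(1) by (simp add: ennreal_mult'[symmetric])
  finally show "distr (gibbs p \<phi>) (leb p) (standardize p \<mu> W) = gibbs p \<psi>" .
qed

section \<open>The standard Gaussian in polar coordinates\<close>

definition std_gauss :: "nat \<Rightarrow> rvec measure" where
  "std_gauss p = gibbs p (\<lambda>x. (vnorm p x)\<^sup>2 / 2)"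

definition sphere_law :: "nat \<Rightarrow> rvec measure" where
  "sphere_law p = distr (std_gauss p) (leb p) (vdir p)"

lemma sets_std_gauss [simp, measurable_cong]: "sets (std_gauss p) = sets (leb p)"
  and space_std_gauss [simp]: "space (std_gauss p) = Rn p"
  and sets_sphere_law [simp, measurable_cong]: "sets (sphere_law p) = sets (leb p)"
  and space_sphere_law [simp]: "space (sphere_law p) = Rn p"
  by (simp_all add: std_gauss_def sphere_law_def)

lemma integrable_std_gauss: "integrable (leb p) (\<lambda>x. exp (- ((vnorm p x)\<^sup>2 / 2)))"
proof -
  interpret product_sigma_finite "\<lambda>_. lborel :: real measure" by standard
  have "integrable lborel (\<lambda>x::real. sqrt (2 * pi) * (std_normal_density x * x ^ (2 * 0)))"
    using std_normal_moment_even[of 0] by (intro integrable_mult_right) (simp add: has_bochner_integral_iff)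
  then have "integrable lborel (\<lambda>x::real. exp (- x\<^sup>2 / 2))"
    by (simp add: std_normal_density_def)
  then have "integrable (leb p) (\<lambda>x. \<Prod>i\<in>{..<p}. exp (- (x i)\<^sup>2 / 2))"
    unfolding leb_def by (intro product_integrable_prod) auto
  also have "(\<lambda>x. \<Prod>i\<in>{..<p}. exp (- (x i)\<^sup>2 / 2)) = (\<lambda>x. exp (- ((vnorm p x)\<^sup>2 / 2)))"
    by (simp add: vnorm_square exp_sum[symmetric] sum_negf sum_divide_distrib)
  finally show ?thesis .
qed

lemma prob_space_std_gauss: "prob_space (std_gauss p)"
  unfolding std_gauss_def by (rule prob_space_gibbs[OF integrable_std_gauss])

lemma prob_space_sphere_law: "prob_space (sphere_law p)"
  unfolding sphere_law_def by (rule prob_space.prob_space_distr[OF prob_space_std_gauss]) measurable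

text \<open>
  The density of the Gaussian only depends on the radius, so \<open>distr_leb_polar\<close> makes its law a
  product. The second factor is proportional to \<open>cone_measure\<close>, and the total mass identifies it
  with the law of the direction.
\<close>

theorem distr_std_gauss_polar:
  assumes p: "1 \<le> p"
  shows "distr (std_gauss p) (borel \<Otimes>\<^sub>M leb p) (\<lambda>x. (vnorm p x, vdir p x)) = chi p \<Otimes>\<^sub>M sphere_law p"
proof -
  define Zg where "Zg = partition_fn p (\<lambda>x. (vnorm p x)\<^sup>2 / 2)"
  have Zg: "0 < Zg" unfolding Zg_def by (rule partition_fn_pos[OF integrable_std_gauss])
  have M: "0 < half_moment (p - 1)" by (rule half_moment_pos[OF p])
  interpret chi: prob_space "chi p" by (rule prob_space_chi[OF p])
  interpret sphere: prob_space "sphere_law p" by (rule prob_space_sphere_law)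
  interpret cone: finite_measure "cone_measure p" by (rule finite_cone_measure)
  define k where "k = ennreal (real p * half_moment (p - 1) / Zg)"
  let ?D = "distr (std_gauss p) (borel \<Otimes>\<^sub>M leb p) (\<lambda>x. (vnorm p x, vdir p x))"
  have G: "density (radial_measure p) (\<lambda>r. ennreal (exp (- (r\<^sup>2 / 2)) / Zg)) = density (chi p) (\<lambda>_. k)"
    unfolding radial_measure_def chi_def k_def using M Zg
    by (subst (1 2) density_density_eq)
       (auto intro!: density_cong AE_I2 simp: ennreal_mult'[symmetric] field_simps split: split_indicator)
  have "?D = density (distr (leb p) (borel \<Otimes>\<^sub>M leb p) (\<lambda>x. (vnorm p x, vdir p x)))
      (\<lambda>x. ennreal (exp (- ((fst x)\<^sup>2 / 2)) / Zg))"
    unfolding std_gauss_def gibbs_eq[OF integrable_std_gauss] Zg_def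
    by (subst density_distr) auto
  also have "\<dots> = density (radial_measure p \<Otimes>\<^sub>M cone_measure p) (\<lambda>x. ennreal (exp (- ((fst x)\<^sup>2 / 2)) / Zg))"
    unfolding distr_leb_polar[OF p] ..
  also have "\<dots> = density (radial_measure p \<Otimes>\<^sub>M cone_measure p) (\<lambda>(r, e). ennreal (exp (- (r\<^sup>2 / 2)) / Zg) * 1)"
    by (simp add: case_prod_unfold)
  also have "\<dots> = density (radial_measure p) (\<lambda>r. ennreal (exp (- (r\<^sup>2 / 2)) / Zg)) \<Otimes>\<^sub>M density (cone_measure p) (\<lambda>_. 1)"
    by (subst pair_measure_density) (auto simp: density_1 cone.sigma_finite_measure_axioms)
  finally have D: "?D = density (chi p) (\<lambda>_. k) \<Otimes>\<^sub>M cone_measure p"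
    unfolding G density_1 .
  have box: "emeasure ?D (A \<times> B) = k * emeasure (chi p) A * emeasure (cone_measure p) B"
    if "A \<in> sets borel" "B \<in> sets (leb p)" for A B
    unfolding D using that by (subst cone.emeasure_pair_measure_Times) (auto simp: emeasure_density_const)
  have sphere: "emeasure (sphere_law p) B = k * emeasure (cone_measure p) B" if B: "B \<in> sets (leb p)" for B
  proof -
    have "emeasure (sphere_law p) B = emeasure ?D (UNIV \<times> B)"
      unfolding sphere_law_def using B
      by (subst (1 2) emeasure_distr) (auto intro!: arg_cong[where f="emeasure (std_gauss p)"])
    also have "\<dots> = k * emeasure (cone_measure p) B"
      using box[of UNIV B] B chi.emeasure_space_1 by simp
    finally show ?thesis .
  qed
  show ?thesis
  proof (rule pair_measure_eqI[symmetric])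
    fix A B assume "A \<in> sets (chi p)" "B \<in> sets (sphere_law p)"
    then show "emeasure (chi p) A * emeasure (sphere_law p) B = emeasure ?D (A \<times> B)"
      using box[of A B] sphere[of B] by (simp add: mult_ac)
  qed (auto simp: chi.sigma_finite_measure_axioms sphere.sigma_finite_measure_axioms cong: sets_pair_measure_cong)
qed

lemma distr_std_gauss_vnorm:
  assumes p: "1 \<le> p" shows "distr (std_gauss p) borel (vnorm p) = chi p"
proof -
  interpret sphere: prob_space "sphere_law p" by (rule prob_space_sphere_law)
  have "distr (std_gauss p) borel (vnorm p)
     = distr (distr (std_gauss p) (borel \<Otimes>\<^sub>M leb p) (\<lambda>x. (vnorm p x, vdir p x))) borel fst"
    by (subst distr_distr) (auto simp: o_def)
  also have "\<dots> = distr (chi p \<Otimes>\<^sub>M sphere_law p) (chi p) fst"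
    unfolding distr_std_gauss_polar[OF p] by (rule distr_cong) auto
  also have "\<dots> = chi p"
    using sphere.emeasure_space_1 by (subst sphere.distr_pair_fst) (simp_all add: density_1)
  finally show ?thesis .
qed

lemma AE_sphere_law:
  assumes p: "1 \<le> p" shows "AE e in sphere_law p. e \<in> unit_sphere p"
proof -
  have "AE x in leb p. vdir p x \<in> unit_sphere p"
    using AE_leb_vnorm_neq_0[OF p] AE_space
    by eventually_elim (auto simp: unit_sphere_def vnorm_vdir)
  then have "AE x in std_gauss p. vdir p x \<in> unit_sphere p"
    unfolding std_gauss_def gibbs_eq[OF integrable_std_gauss]
    by (subst AE_density) auto
  moreover have "{e \<in> space (leb p). e \<in> unit_sphere p} \<in> sets (leb p)"
  proof -
    have "{e \<in> space (leb p). e \<in> unit_sphere p} = vnorm p -` {1} \<inter> space (leb p)"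
      by (auto simp: unit_sphere_def)
    then show ?thesis using measurable_sets[OF measurable_vnorm, of "{1}" p] by simp
  qed
  ultimately show ?thesis
    unfolding sphere_law_def by (subst AE_distr_iff) auto
qed

lemma polar_integral:
  fixes F :: "rvec \<Rightarrow> real"
  assumes p: "1 \<le> p" and F [measurable]: "F \<in> borel_measurable (leb p)" and int: "integrable (std_gauss p) F"
  shows "integrable (sphere_law p) (\<lambda>e. \<integral>r. F (vscale p r e) \<partial>chi p)"
    and "(\<integral>x. F x \<partial>std_gauss p) = (\<integral>e. (\<integral>r. F (vscale p r e) \<partial>chi p) \<partial>sphere_law p)"
proof -
  interpret chi: prob_space "chi p" by (rule prob_space_chi[OF p])
  interpret sphere: prob_space "sphere_law p" by (rule prob_space_sphere_law)
  interpret P: pair_sigma_finite "chi p" "sphere_law p" by standard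
  have "integrable (std_gauss p) (\<lambda>x. F (vscale p (vnorm p x) (vdir p x)))"
    using int by (rule Bochner_Integration.integrable_cong[THEN iffD1, rotated -1]) (auto simp: vscale_vnorm_vdir)
  then have i: "integrable (chi p \<Otimes>\<^sub>M sphere_law p) (\<lambda>(r, e). F (vscale p r e))"
    unfolding distr_std_gauss_polar[OF p, symmetric] by (subst integrable_distr_eq) (auto simp: case_prod_beta)
  show "integrable (sphere_law p) (\<lambda>e. \<integral>r. F (vscale p r e) \<partial>chi p)"
    by (rule P.integrable_snd[OF i])
  have "(\<integral>x. F x \<partial>std_gauss p) = (\<integral>x. F (vscale p (vnorm p x) (vdir p x)) \<partial>std_gauss p)"
    by (rule Bochner_Integration.integral_cong) (auto simp: vscale_vnorm_vdir)
  also have "\<dots> = (\<integral>x. (\<lambda>(r, e). F (vscale p r e)) x \<partial>(chi p \<Otimes>\<^sub>M sphere_law p))"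
    unfolding distr_std_gauss_polar[OF p, symmetric] by (subst integral_distr) (auto simp: case_prod_beta)
  also have "\<dots> = (\<integral>e. (\<integral>r. F (vscale p r e) \<partial>chi p) \<partial>sphere_law p)"
    by (rule P.integral_snd[OF i, symmetric])
  finally show "(\<integral>x. F x \<partial>std_gauss p) = (\<integral>e. (\<integral>r. F (vscale p r e) \<partial>chi p) \<partial>sphere_law p)" .
qed

text \<open>
  The density of a marginal of a product measure, in polar coordinates.
\<close>

lemma dir_law_tilt:
  fixes F :: "rvec \<Rightarrow> ennreal"
  assumes p: "1 \<le> p" and F [measurable]: "F \<in> borel_measurable (leb p)"
  shows "distr (density (std_gauss p) F) (leb p) (vdir p) = density (sphere_law p) (\<lambda>e. \<integral>\<^sup>+r. F (vscale p r e) \<partial>chi p)"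
proof (rule measure_eqI)
  interpret chi: prob_space "chi p" by (rule prob_space_chi[OF p])
  interpret sphere: prob_space "sphere_law p" by (rule prob_space_sphere_law)
  interpret P: pair_sigma_finite "chi p" "sphere_law p" by standard
  fix B assume "B \<in> sets (distr (density (std_gauss p) F) (leb p) (vdir p))"
  then have [measurable]: "B \<in> sets (leb p)" by simp
  have [measurable]: "vdir p -` B \<inter> Rn p \<in> sets (leb p)"
    using measurable_sets[OF measurable_vdir, of B] by simp
  have "emeasure (distr (density (std_gauss p) F) (leb p) (vdir p)) B
     = (\<integral>\<^sup>+x. F x * indicator (vdir p -` B \<inter> Rn p) x \<partial>std_gauss p)"
    by (subst emeasure_distr) (auto simp: emeasure_density)
  also have "\<dots> = (\<integral>\<^sup>+x. (\<lambda>(r, e). F (vscale p r e) * indicator B e) (vnorm p x, vdir p x) \<partial>std_gauss p)"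
    by (intro nn_integral_cong) (auto simp: vscale_vnorm_vdir split: split_indicator)
  also have "\<dots> = (\<integral>\<^sup>+x. (\<lambda>(r, e). F (vscale p r e) * indicator B e) x \<partial>(chi p \<Otimes>\<^sub>M sphere_law p))"
    unfolding distr_std_gauss_polar[OF p, symmetric] by (subst nn_integral_distr) auto
  also have "\<dots> = (\<integral>\<^sup>+e. (\<integral>\<^sup>+r. F (vscale p r e) * indicator B e \<partial>chi p) \<partial>sphere_law p)"
    by (subst P.nn_integral_snd[symmetric]) auto
  also have "\<dots> = (\<integral>\<^sup>+e. (\<integral>\<^sup>+r. F (vscale p r e) \<partial>chi p) * indicator B e \<partial>sphere_law p)"
    by (intro nn_integral_cong nn_integral_multc) auto
  also have "\<dots> = emeasure (density (sphere_law p) (\<lambda>e. \<integral>\<^sup>+r. F (vscale p r e) \<partial>chi p)) B"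
    by (subst emeasure_density) auto
  finally show "emeasure (distr (density (std_gauss p) F) (leb p) (vdir p)) B
     = emeasure (density (sphere_law p) (\<lambda>e. \<integral>\<^sup>+r. F (vscale p r e) \<partial>chi p)) B" .
qed simp

section \<open>Differentiation along lines\<close>

lemma frechet_curve:
  assumes d: "\<forall>\<epsilon>>0. \<exists>\<delta>>0. \<forall>y\<in>Rn p. vnorm p (vsub p y x) < \<delta> \<longrightarrow>
        \<bar>\<phi> y - \<phi> x - vdot p d (vsub p y x)\<bar> \<le> \<epsilon> * vnorm p (vsub p y x)"
    and x: "x = vadd p a (vscale p t v)"
  shows "((\<lambda>s. \<phi> (vadd p a (vscale p s v))) has_real_derivative vdot p d v) (at t)"
  unfolding has_field_derivative_def has_derivative_within_alt
proof (intro conjI allI impI)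
  show "bounded_linear ((*) (vdot p d v))" by (rule bounded_linear_mult_right)
  fix e :: real assume e: "0 < e"
  define K where "K = vnorm p v + 1"
  have K: "0 < K" by (simp add: K_def add_nonneg_pos)
  obtain \<delta> where \<delta>: "0 < \<delta>" "\<And>y. y \<in> Rn p \<Longrightarrow> vnorm p (vsub p y x) < \<delta> \<Longrightarrow>
      \<bar>\<phi> y - \<phi> x - vdot p d (vsub p y x)\<bar> \<le> e / K * vnorm p (vsub p y x)"
    using d[rule_format, of "e / K"] e K by auto
  show "\<exists>d'>0. \<forall>y\<in>UNIV. norm (y - t) < d' \<longrightarrow>
      norm (\<phi> (vadd p a (vscale p y v)) - \<phi> (vadd p a (vscale p t v)) - vdot p d v * (y - t)) \<le> e * norm (y - t)"
  proof (intro exI[of _ "\<delta> / K"] conjI ballI impI)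
    show "0 < \<delta> / K" using \<delta> K by simp
    fix s :: real assume s: "norm (s - t) < \<delta> / K"
    have diff: "vsub p (vadd p a (vscale p s v)) x = vscale p (s - t) v"
      unfolding x by (rule Rn_eqI[of _ p]) (auto simp: algebra_simps)
    have nv: "vnorm p (vscale p (s - t) v) \<le> \<bar>s - t\<bar> * K" by (simp add: K_def mult_left_mono)
    also have "\<dots> < \<delta>" using s K by (simp add: field_simps)
    finally have "\<bar>\<phi> (vadd p a (vscale p s v)) - \<phi> x - vdot p d (vscale p (s - t) v)\<bar> \<le> e / K * vnorm p (vscale p (s - t) v)"
      using \<delta>(2)[of "vadd p a (vscale p s v)"] unfolding diff by simp
    also have "\<dots> \<le> e / K * (\<bar>s - t\<bar> * K)" using nv e K by (intro mult_left_mono) auto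
    finally show "norm (\<phi> (vadd p a (vscale p s v)) - \<phi> (vadd p a (vscale p t v)) - vdot p d v * (s - t)) \<le> e * norm (s - t)"
      using K unfolding x by (simp add: vdot_def sum_distrib_left mult_ac)
  qed
qed

definition unit_vec :: "nat \<Rightarrow> nat \<Rightarrow> rvec" where
  "unit_vec p i = (\<lambda>j\<in>{..<p}. of_bool (j = i))"

lemma fun_upd_in_Rn [simp]: "x \<in> Rn p \<Longrightarrow> i < p \<Longrightarrow> x(i := t) \<in> Rn p"
  by (auto simp: Rn_def PiE_iff extensional_def)

lemma fun_upd_eq_line:
  assumes "x \<in> Rn p" "i < p"
  shows "x(i := t) = vadd p (x(i := 0)) (vscale p t (unit_vec p i))"
  using assms by (intro Rn_eqI[of _ p]) (auto simp: unit_vec_def)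

lemma has_partial_derivative:
  assumes d: "\<forall>\<epsilon>>0. \<exists>\<delta>>0. \<forall>y\<in>Rn p. vnorm p (vsub p y x) < \<delta> \<longrightarrow>
        \<bar>\<phi> y - \<phi> x - vdot p d (vsub p y x)\<bar> \<le> \<epsilon> * vnorm p (vsub p y x)"
    and x: "x \<in> Rn p" and i: "i < p"
  shows "partial i \<phi> x = d i"
proof -
  have "((\<lambda>s. \<phi> (vadd p (x(i := 0)) (vscale p s (unit_vec p i)))) has_real_derivative vdot p d (unit_vec p i)) (at (x i))"
    by (rule frechet_curve[OF d]) (simp add: fun_upd_eq_line[OF x i, symmetric])
  moreover have "vdot p d (unit_vec p i) = d i"
    using i by (simp add: vdot_def unit_vec_def of_bool_def if_distrib[of "\<lambda>c. _ * c"] cong: if_cong)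
  ultimately show ?thesis
    unfolding partial_def fun_upd_eq_line[OF x i, symmetric] by (simp add: DERIV_imp_deriv)
qed

lemma frechet_grad:
  assumes f: "frechet_differentiable p \<phi> x" and x: "x \<in> Rn p"
  shows "\<forall>\<epsilon>>0. \<exists>\<delta>>0. \<forall>y\<in>Rn p. vnorm p (vsub p y x) < \<delta> \<longrightarrow>
        \<bar>\<phi> y - \<phi> x - vdot p (grad p \<phi> x) (vsub p y x)\<bar> \<le> \<epsilon> * vnorm p (vsub p y x)"
proof -
  obtain d where d: "\<forall>\<epsilon>>0. \<exists>\<delta>>0. \<forall>y\<in>Rn p. vnorm p (vsub p y x) < \<delta> \<longrightarrow>
        \<bar>\<phi> y - \<phi> x - vdot p d (vsub p y x)\<bar> \<le> \<epsilon> * vnorm p (vsub p y x)"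
    using f unfolding frechet_differentiable_def by blast
  have "vdot p (grad p \<phi> x) h = vdot p d h" for h
    unfolding vdot_def grad_def by (intro sum.cong) (auto simp: has_partial_derivative[OF d x])
  then show ?thesis using d by simp
qed

lemma has_derivative_along_line:
  assumes "frechet_differentiable p \<phi> (vadd p a (vscale p t v))"
  shows "((\<lambda>s. \<phi> (vadd p a (vscale p s v))) has_real_derivative
    (\<Sum>i<p. partial i \<phi> (vadd p a (vscale p t v)) * v i)) (at t)"
  using frechet_curve[OF frechet_grad[OF assms] refl] by (simp add: vdot_def grad_def)

lemma frechet_cong:
  assumes "\<And>x. x \<in> Rn p \<Longrightarrow> \<phi> x = \<eta> x" "x \<in> Rn p"
  shows "frechet_differentiable p \<phi> x = frechet_differentiable p \<eta> x"
  unfolding frechet_differentiable_def using assms by (intro bex_cong refl) simp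

lemma partial_cong:
  assumes "\<And>x. x \<in> Rn p \<Longrightarrow> \<phi> x = \<eta> x" "x \<in> Rn p" "i < p"
  shows "partial i \<phi> x = partial i \<eta> x"
  unfolding partial_def using assms by simp

lemma times_differentiable_cong:
  assumes "\<And>x. x \<in> Rn p \<Longrightarrow> \<phi> x = \<eta> x" "times_differentiable p k \<phi>"
  shows "times_differentiable p k \<eta>"
  using assms
proof (induction k arbitrary: \<phi> \<eta>)
  case (Suc k)
  have "times_differentiable p k (partial i \<eta>)" if "i < p" for i
    using Suc.IH[of "partial i \<phi>" "partial i \<eta>"] partial_cong[OF Suc.prems(1)] Suc.prems(2) that by simp
  then show ?case using Suc.prems frechet_cong[of p \<phi> \<eta>] by simp
qed simp

text \<open>
  The coefficient \<open>c\<close> allows finite linear combinations, in which the derivatives of the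
  standardized potential are expressed.
\<close>

lemma frechet_add:
  assumes "frechet_differentiable p \<phi> x" "frechet_differentiable p \<eta> x" "x \<in> Rn p"
  shows "\<forall>\<epsilon>>0. \<exists>\<delta>>0. \<forall>y\<in>Rn p. vnorm p (vsub p y x) < \<delta> \<longrightarrow>
     \<bar>(\<phi> y + c * \<eta> y) - (\<phi> x + c * \<eta> x) - vdot p (vadd p (grad p \<phi> x) (vscale p c (grad p \<eta> x))) (vsub p y x)\<bar>
       \<le> \<epsilon> * vnorm p (vsub p y x)"
proof (intro allI impI)
  fix \<epsilon> :: real assume \<epsilon>: "0 < \<epsilon>"
  define C where "C = \<bar>c\<bar> + 1"
  have C: "0 < C" "\<bar>c\<bar> \<le> C" by (simp_all add: C_def add_nonneg_pos)
  obtain \<delta>1 where 1: "0 < \<delta>1" "\<And>y. y \<in> Rn p \<Longrightarrow> vnorm p (vsub p y x) < \<delta>1 \<Longrightarrow>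
      \<bar>\<phi> y - \<phi> x - vdot p (grad p \<phi> x) (vsub p y x)\<bar> \<le> \<epsilon> / 2 * vnorm p (vsub p y x)"
    using frechet_grad[OF assms(1,3), rule_format, of "\<epsilon> / 2"] \<epsilon> by auto
  obtain \<delta>2 where 2: "0 < \<delta>2" "\<And>y. y \<in> Rn p \<Longrightarrow> vnorm p (vsub p y x) < \<delta>2 \<Longrightarrow>
      \<bar>\<eta> y - \<eta> x - vdot p (grad p \<eta> x) (vsub p y x)\<bar> \<le> \<epsilon> / (2 * C) * vnorm p (vsub p y x)"
    using frechet_grad[OF assms(2,3), rule_format, of "\<epsilon> / (2 * C)"] \<epsilon> C by auto
  show "\<exists>\<delta>>0. \<forall>y\<in>Rn p. vnorm p (vsub p y x) < \<delta> \<longrightarrow>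
     \<bar>(\<phi> y + c * \<eta> y) - (\<phi> x + c * \<eta> x) - vdot p (vadd p (grad p \<phi> x) (vscale p c (grad p \<eta> x))) (vsub p y x)\<bar>
       \<le> \<epsilon> * vnorm p (vsub p y x)"
  proof (intro exI[of _ "min \<delta>1 \<delta>2"] conjI ballI impI)
    fix y assume y: "y \<in> Rn p" "vnorm p (vsub p y x) < min \<delta>1 \<delta>2"
    let ?n = "vnorm p (vsub p y x)"
    let ?a = "\<phi> y - \<phi> x - vdot p (grad p \<phi> x) (vsub p y x)"
    let ?b = "\<eta> y - \<eta> x - vdot p (grad p \<eta> x) (vsub p y x)"
    have "(\<phi> y + c * \<eta> y) - (\<phi> x + c * \<eta> x) - vdot p (vadd p (grad p \<phi> x) (vscale p c (grad p \<eta> x))) (vsub p y x) = ?a + c * ?b"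
      by (simp add: vdot_def sum.distrib sum_distrib_left sum_subtractf algebra_simps)
    moreover have "\<bar>?a + c * ?b\<bar> \<le> \<epsilon> * ?n"
    proof -
      have "\<bar>c * ?b\<bar> \<le> C * (\<epsilon> / (2 * C) * ?n)"
        unfolding abs_mult using C 2(2)[of y] y by (intro mult_mono) auto
      also have "\<dots> = \<epsilon> / 2 * ?n" using C by simp
      finally have cb: "\<bar>c * ?b\<bar> \<le> \<epsilon> / 2 * ?n" .
      have a: "\<bar>?a\<bar> \<le> \<epsilon> / 2 * ?n" using 1(2)[of y] y by simp
      have "\<bar>?a + c * ?b\<bar> \<le> \<epsilon> / 2 * ?n + \<epsilon> / 2 * ?n"
        by (rule order.trans[OF abs_triangle_ineq add_mono[OF a cb]])
      then show ?thesis by simp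
    qed
    ultimately show "\<bar>(\<phi> y + c * \<eta> y) - (\<phi> x + c * \<eta> x) - vdot p (vadd p (grad p \<phi> x) (vscale p c (grad p \<eta> x))) (vsub p y x)\<bar>
       \<le> \<epsilon> * ?n" by (simp only:)
  qed (use 1 2 in auto)
qed

lemma frechet_differentiable_add:
  assumes "frechet_differentiable p \<phi> x" "frechet_differentiable p \<eta> x" "x \<in> Rn p"
  shows "frechet_differentiable p (\<lambda>x. \<phi> x + c * \<eta> x) x"
  unfolding frechet_differentiable_def using frechet_add[OF assms, of c] vadd_in_Rn by blast

lemma partial_add:
  assumes "frechet_differentiable p \<phi> x" "frechet_differentiable p \<eta> x" "x \<in> Rn p" "i < p"
  shows "partial i (\<lambda>x. \<phi> x + c * \<eta> x) x = partial i \<phi> x + c * partial i \<eta> x"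
  using has_partial_derivative[OF frechet_add[OF assms(1-3), of c] assms(3,4)] assms(4)
  by (simp add: grad_def)

lemma times_differentiable_add:
  assumes "times_differentiable p k \<phi>" "times_differentiable p k \<eta>"
  shows "times_differentiable p k (\<lambda>x. \<phi> x + c * \<eta> x)"
  using assms
proof (induction k arbitrary: \<phi> \<eta>)
  case (Suc k)
  have "times_differentiable p k (partial i (\<lambda>x. \<phi> x + c * \<eta> x))" if i: "i < p" for i
  proof (rule times_differentiable_cong)
    show "times_differentiable p k (\<lambda>x. partial i \<phi> x + c * partial i \<eta> x)"
      using Suc i by simp
    show "partial i \<phi> x + c * partial i \<eta> x = partial i (\<lambda>x. \<phi> x + c * \<eta> x) x" if "x \<in> Rn p" for x
      using Suc.prems that i by (intro partial_add[symmetric]) auto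
  qed
  then show ?case using Suc.prems by (simp add: frechet_differentiable_add)
qed simp

lemma times_differentiable_zero: "times_differentiable p k (\<lambda>_. 0)"
proof (induction k)
  case (Suc k)
  have "frechet_differentiable p (\<lambda>_. 0) x" for x
    unfolding frechet_differentiable_def
    by (rule bexI[of _ "\<lambda>i\<in>{..<p}. 0"]) (auto simp: vdot_def Rn_def intro!: exI[of _ 1])
  moreover have "partial i (\<lambda>_. 0) = (\<lambda>_. 0)" for i by (simp add: partial_def fun_eq_iff)
  ultimately show ?case using Suc by simp
qed simp

lemma times_differentiable_sum:
  fixes n :: nat
  assumes "\<And>j. j < n \<Longrightarrow> times_differentiable p k (\<eta> j)"
  shows "times_differentiable p k (\<lambda>x. \<Sum>j<n. c j * \<eta> j x)"
  using assms
proof (induction n)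
  case (Suc n)
  then show ?case using times_differentiable_add[of p k "\<lambda>x. \<Sum>j<n. c j * \<eta> j x" "\<eta> n" "c n"] by simp
qed (simp add: times_differentiable_zero)

lemma vnorm_mvec_le: "vnorm p (mvec p S h) \<le> (\<Sum>i<p. \<Sum>j<p. \<bar>S i j\<bar>) * vnorm p h"
proof -
  have "vnorm p (mvec p S h) \<le> (\<Sum>i<p. \<bar>mvec p S h i\<bar>)"
    unfolding vnorm_def by (rule L2_set_le_sum_abs)
  also have "\<dots> \<le> (\<Sum>i<p. \<Sum>j<p. \<bar>S i j\<bar> * vnorm p h)"
  proof (intro sum_mono)
    fix i assume "i \<in> {..<p}"
    then have "\<bar>mvec p S h i\<bar> \<le> (\<Sum>j<p. \<bar>S i j * h j\<bar>)" by simp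
    also have "\<dots> \<le> (\<Sum>j<p. \<bar>S i j\<bar> * vnorm p h)"
      by (intro sum_mono) (auto simp: abs_mult intro!: mult_left_mono abs_component_le_vnorm)
    finally show "\<bar>mvec p S h i\<bar> \<le> (\<Sum>j<p. \<bar>S i j\<bar> * vnorm p h)" .
  qed
  finally show ?thesis by (simp add: sum_distrib_right)
qed

text \<open>
  The chain rule for the affine map \<open>\<mu> + S x\<close>.
\<close>

lemma frechet_affine:
  assumes "frechet_differentiable p \<phi> (vadd p \<mu> (mvec p S x))"
  shows "\<forall>\<epsilon>>0. \<exists>\<delta>>0. \<forall>y\<in>Rn p. vnorm p (vsub p y x) < \<delta> \<longrightarrow>
     \<bar>phi_std p \<phi> \<mu> S y - phi_std p \<phi> \<mu> S x
       - vdot p (\<lambda>j\<in>{..<p}. \<Sum>i<p. S i j * partial i \<phi> (vadd p \<mu> (mvec p S x))) (vsub p y x)\<bar>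
       \<le> \<epsilon> * vnorm p (vsub p y x)"
proof (intro allI impI)
  fix \<epsilon> :: real assume \<epsilon>: "0 < \<epsilon>"
  let ?T = "\<lambda>x. vadd p \<mu> (mvec p S x)"
  define K where "K = (\<Sum>i<p. \<Sum>j<p. \<bar>S i j\<bar>) + 1"
  have K: "0 < K" unfolding K_def by (intro add_nonneg_pos sum_nonneg) auto
  obtain \<delta> where \<delta>: "0 < \<delta>" "\<And>y. y \<in> Rn p \<Longrightarrow> vnorm p (vsub p y (?T x)) < \<delta> \<Longrightarrow>
      \<bar>\<phi> y - \<phi> (?T x) - vdot p (grad p \<phi> (?T x)) (vsub p y (?T x))\<bar> \<le> \<epsilon> / K * vnorm p (vsub p y (?T x))"
    using frechet_grad[OF assms vadd_in_Rn, rule_format, of "\<epsilon> / K"] \<epsilon> K by auto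
  show "\<exists>\<delta>>0. \<forall>y\<in>Rn p. vnorm p (vsub p y x) < \<delta> \<longrightarrow>
     \<bar>phi_std p \<phi> \<mu> S y - phi_std p \<phi> \<mu> S x
       - vdot p (\<lambda>j\<in>{..<p}. \<Sum>i<p. S i j * partial i \<phi> (?T x)) (vsub p y x)\<bar>
       \<le> \<epsilon> * vnorm p (vsub p y x)"
  proof (intro exI[of _ "\<delta> / K"] conjI ballI impI)
    fix y assume y: "y \<in> Rn p" "vnorm p (vsub p y x) < \<delta> / K"
    have T: "vsub p (?T y) (?T x) = mvec p S (vsub p y x)"
      by (rule Rn_eqI[of _ p]) (auto simp: sum_subtractf algebra_simps)
    have n: "vnorm p (mvec p S (vsub p y x)) \<le> K * vnorm p (vsub p y x)"
      using vnorm_mvec_le[of p S "vsub p y x"] vnorm_nonneg[of p "vsub p y x"] 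
      by (simp only: K_def distrib_right mult_1_left)
    also have "\<dots> < \<delta>" using y K by (simp add: field_simps)
    finally have "\<bar>\<phi> (?T y) - \<phi> (?T x) - vdot p (grad p \<phi> (?T x)) (mvec p S (vsub p y x))\<bar> \<le> \<epsilon> / K * vnorm p (mvec p S (vsub p y x))"
      using \<delta>(2)[of "?T y"] unfolding T by simp
    also have "\<dots> \<le> \<epsilon> / K * (K * vnorm p (vsub p y x))" using n \<epsilon> K by (intro mult_left_mono) auto
    also have "vdot p (grad p \<phi> (?T x)) (mvec p S (vsub p y x))
       = vdot p (\<lambda>j\<in>{..<p}. \<Sum>i<p. S i j * partial i \<phi> (?T x)) (vsub p y x)"
      unfolding vdot_def grad_def
      by (simp add: sum_distrib_left sum_distrib_right) (subst sum.swap, simp add: mult_ac)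
    finally show "\<bar>phi_std p \<phi> \<mu> S y - phi_std p \<phi> \<mu> S x
       - vdot p (\<lambda>j\<in>{..<p}. \<Sum>i<p. S i j * partial i \<phi> (?T x)) (vsub p y x)\<bar> \<le> \<epsilon> * vnorm p (vsub p y x)"
      using K by (simp add: phi_std_def)
  qed (use \<delta> K in auto)
qed

lemma frechet_differentiableI:
  assumes "d \<in> Rn p" and "\<forall>\<epsilon>>0. \<exists>\<delta>>0. \<forall>y\<in>Rn p. vnorm p (vsub p y x) < \<delta> \<longrightarrow>
        \<bar>\<phi> y - \<phi> x - vdot p d (vsub p y x)\<bar> \<le> \<epsilon> * vnorm p (vsub p y x)"
  shows "frechet_differentiable p \<phi> x"
  unfolding frechet_differentiable_def using assms by blast

text \<open>
  By the chain rule, a partial derivative of the standardized potential is a linear combination of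
  standardizations of partial derivatives, to which the induction hypothesis applies.
\<close>

lemma times_differentiable_phi_std:
  assumes "times_differentiable p k \<phi>"
  shows "times_differentiable p k (phi_std p \<phi> \<mu> S)"
  using assms
proof (induction k arbitrary: \<phi>)
  case (Suc k)
  have "frechet_differentiable p (phi_std p \<phi> \<mu> S) x" if "x \<in> Rn p" for x
  proof -
    have "frechet_differentiable p \<phi> (vadd p \<mu> (mvec p S x))" using Suc.prems by simp
    show ?thesis
      by (rule frechet_differentiableI[OF _ frechet_affine[OF \<open>frechet_differentiable p \<phi> (vadd p \<mu> (mvec p S x))\<close>]])
         (simp add: Rn_def)
  qed
  moreover have "times_differentiable p k (partial j (phi_std p \<phi> \<mu> S))" if j: "j < p" for j
  proof (rule times_differentiable_cong)
    show "times_differentiable p k (\<lambda>x. \<Sum>i<p. S i j * phi_std p (partial i \<phi>) \<mu> S x)"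
    proof (rule times_differentiable_sum)
      fix i assume "i < p"
      then have "times_differentiable p k (partial i \<phi>)" using Suc.prems by simp
      then show "times_differentiable p k (phi_std p (partial i \<phi>) \<mu> S)" by (rule Suc.IH)
    qed
    show "(\<Sum>i<p. S i j * phi_std p (partial i \<phi>) \<mu> S x) = partial j (phi_std p \<phi> \<mu> S) x" if x: "x \<in> Rn p" for x
    proof -
      have "frechet_differentiable p \<phi> (vadd p \<mu> (mvec p S x))" using Suc.prems by simp
      have "partial j (phi_std p \<phi> \<mu> S) x
          = (\<lambda>j\<in>{..<p}. \<Sum>i<p. S i j * partial i \<phi> (vadd p \<mu> (mvec p S x))) j"
        by (rule has_partial_derivative[OF frechet_affine x j]) fact
      then show ?thesis using j by (simp add: phi_std_def[of p "partial _ \<phi>"])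
    qed
  qed
  ultimately show ?case by simp
qed simp

text \<open>
  Successive differentiation puts the newest partial derivative outermost. As all arguments of the form are the
  same \<open>v\<close>, exchanging sums brings the indices into the order of \<open>hess\<close> and
  \<open>third_deriv\<close>.
\<close>

lemma line_derivatives:
  assumes "times_differentiable p 3 \<phi>"
  shows "((\<lambda>s. \<phi> (vadd p a (vscale p s v))) has_real_derivative
      vdot p v (grad p \<phi> (vadd p a (vscale p t v)))) (at t)" (is ?th1)
    and "((\<lambda>s. vdot p v (grad p \<phi> (vadd p a (vscale p s v)))) has_real_derivative
      vdot p v (mvec p (hess \<phi> (vadd p a (vscale p t v))) v)) (at t)" (is ?th2)
    and "((\<lambda>s. vdot p v (mvec p (hess \<phi> (vadd p a (vscale p s v))) v)) has_real_derivative
      third_deriv p \<phi> (vadd p a (vscale p t v)) v v v) (at t)" (is ?th3)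
proof -
  let ?y = "\<lambda>s. vadd p a (vscale p s v)"
  have d: "x \<in> Rn p \<Longrightarrow> frechet_differentiable p \<phi> x"
    "x \<in> Rn p \<Longrightarrow> i < p \<Longrightarrow> frechet_differentiable p (partial i \<phi>) x"
    "x \<in> Rn p \<Longrightarrow> i < p \<Longrightarrow> j < p \<Longrightarrow> frechet_differentiable p (partial j (partial i \<phi>)) x" for x i j
    using assms by (simp_all add: numeral_3_eq_3)
  show ?th1
    using has_derivative_along_line[OF d(1)] by (simp add: vdot_def grad_def mult.commute)
  have 2: "((\<lambda>s. \<Sum>i<p. v i * partial i \<phi> (?y s)) has_real_derivative
     (\<Sum>i<p. v i * (\<Sum>j<p. partial j (partial i \<phi>) (?y t) * v j))) (at t)"
    by (intro DERIV_sum DERIV_cmult has_derivative_along_line d) auto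
  have eq2: "(\<Sum>i<p. v i * (\<Sum>j<p. partial j (partial i \<phi>) (?y s) * v j)) = vdot p v (mvec p (hess \<phi> (?y s)) v)" for s
    unfolding vdot_def hess_def
    by (simp add: sum_distrib_left) (subst sum.swap, simp add: mult_ac)
  show ?th2 using 2 unfolding eq2 by (simp add: vdot_def grad_def)
  have 3: "((\<lambda>s. \<Sum>i<p. v i * (\<Sum>j<p. partial j (partial i \<phi>) (?y s) * v j)) has_real_derivative
     (\<Sum>i<p. v i * (\<Sum>j<p. (\<Sum>k<p. partial k (partial j (partial i \<phi>)) (?y t) * v k) * v j))) (at t)"
    by (intro DERIV_sum DERIV_cmult DERIV_cmult_right has_derivative_along_line d) auto
  have "(\<Sum>i<p. v i * (\<Sum>j<p. (\<Sum>k<p. partial k (partial j (partial i \<phi>)) (?y t) * v k) * v j))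
     = (\<Sum>i<p. \<Sum>j<p. \<Sum>k<p. partial k (partial j (partial i \<phi>)) (?y t) * v k * v j * v i)"
    by (simp add: sum_distrib_left sum_distrib_right mult_ac)
  also have "\<dots> = (\<Sum>j<p. \<Sum>i<p. \<Sum>k<p. partial k (partial j (partial i \<phi>)) (?y t) * v k * v j * v i)"
    by (rule sum.swap)
  also have "\<dots> = (\<Sum>j<p. \<Sum>k<p. \<Sum>i<p. partial k (partial j (partial i \<phi>)) (?y t) * v k * v j * v i)"
    by (intro sum.cong refl sum.swap)
  also have "\<dots> = (\<Sum>k<p. \<Sum>j<p. \<Sum>i<p. partial k (partial j (partial i \<phi>)) (?y t) * v k * v j * v i)"
    by (rule sum.swap)
  also have "\<dots> = third_deriv p \<phi> (?y t) v v v" by (simp add: third_deriv_def)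
  finally show ?th3 using 3 unfolding eq2 by simp
qed

lemma derivative_bound_integrate:
  fixes f f' :: "real \<Rightarrow> real"
  assumes "\<And>x. (f has_real_derivative f' x) (at x)" "f 0 = 0"
    and "\<And>x. 0 \<le> x \<Longrightarrow> \<bar>f' x\<bar> \<le> c * x ^ n" and x: "0 \<le> x"
  shows "\<bar>f x\<bar> \<le> c * x ^ Suc n / real (Suc n)"
proof -
  have pow: "((\<lambda>x. c * x ^ Suc n / real (Suc n)) has_real_derivative c * x ^ n) (at x)" for x
    by (auto intro!: derivative_eq_intros simp del: power_Suc of_nat_Suc)
  have "c * 0 ^ Suc n / real (Suc n) - s * f 0 \<le> c * x ^ Suc n / real (Suc n) - s * f x" if s: "\<bar>s\<bar> = 1" for s
  proof (rule DERIV_nonneg_imp_nondecreasing[OF x])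
    fix z assume z: "0 \<le> z" "z \<le> x"
    have "((\<lambda>x. c * x ^ Suc n / real (Suc n) - s * f x) has_real_derivative c * z ^ n - s * f' z) (at z)"
      by (intro DERIV_diff pow DERIV_cmult assms)
    moreover have "s * f' z \<le> \<bar>f' z\<bar>" using s by (auto simp: abs_if split: if_splits)
    ultimately show "\<exists>y. ((\<lambda>x. c * x ^ Suc n / real (Suc n) - s * f x) has_real_derivative y) (at z) \<and> 0 \<le> y"
      using assms(3)[OF z(1)] by (intro exI conjI) auto
  qed
  from this[of 1] this[of "- 1"] show ?thesis using assms(2) by (simp add: abs_le_iff)
qed

lemma vdot_mvec_symmetric:
  assumes "\<And>i j. i < p \<Longrightarrow> j < p \<Longrightarrow> S i j = S j i"
  shows "vdot p (mvec p S x) y = vdot p x (mvec p S y)"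
proof -
  have "vdot p (mvec p S x) y = (\<Sum>i<p. \<Sum>j<p. S i j * x j * y i)"
    by (simp add: vdot_def sum_distrib_right)
  also have "\<dots> = (\<Sum>j<p. \<Sum>i<p. S i j * x j * y i)" by (rule sum.swap)
  also have "\<dots> = (\<Sum>j<p. \<Sum>i<p. x j * (S j i * y i))"
    by (intro sum.cong refl) (use assms in \<open>simp add: mult_ac\<close>)
  also have "\<dots> = vdot p x (mvec p S y)" by (simp add: vdot_def sum_distrib_left)
  finally show ?thesis .
qed

section \<open>Expansion of a log-partition function\<close>

lemma ln_one_plus_cubic:
  fixes x :: real
  assumes "\<bar>x\<bar> \<le> 1/2"
  shows "\<bar>ln (1 + x) - x + x\<^sup>2 / 2\<bar> \<le> 2 * \<bar>x\<bar> ^ 3"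
proof -
  let ?f = "\<lambda>x::real. ln (1 + x) - x + x\<^sup>2 / 2" and ?f' = "\<lambda>x::real. x\<^sup>2 / (1 + x)"
  have "norm (?f x - ?f 0) \<le> 2 * x\<^sup>2 * norm (x - 0)"
  proof (rule field_differentiable_bound[where S="{- \<bar>x\<bar>..\<bar>x\<bar>}" and f'="?f'"])
    fix z assume z: "z \<in> {- \<bar>x\<bar>..\<bar>x\<bar>}"
    then have z1: "1/2 \<le> 1 + z" using assms by auto
    have "(?f has_field_derivative 1 / (1 + z) - 1 + z) (at z within {- \<bar>x\<bar>..\<bar>x\<bar>})"
      using z1 by (auto intro!: derivative_eq_intros)
    moreover have "1 / (1 + z) - 1 + z = ?f' z" using z1 by (simp add: field_simps power2_eq_square)
    ultimately show "(?f has_field_derivative ?f' z) (at z within {- \<bar>x\<bar>..\<bar>x\<bar>})" by simp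
    have "\<bar>z\<bar> \<le> \<bar>x\<bar>" using z by auto
    then have "\<bar>z\<bar>\<^sup>2 \<le> \<bar>x\<bar>\<^sup>2" by (intro power_mono) auto
    then have zx: "z\<^sup>2 \<le> x\<^sup>2" by simp
    have "z\<^sup>2 / (1 + z) \<le> x\<^sup>2 / (1/2)" using zx z1 by (intro frac_le) auto
    then show "norm (?f' z) \<le> 2 * x\<^sup>2" using z1 by (simp add: abs_mult)
  qed auto
  then show ?thesis by (simp add: power2_eq_square power3_eq_cube abs_mult[symmetric])
qed

text \<open>
  Write \<open>H = 1 + G\<close>. Expanding both logarithms to second order, the linear terms cancel and half
  the variance of \<open>G\<close> remains. As \<open>G = - A + O(d\<^sup>2)\<close> and both are
  \<open>O(d)\<close>, replacing \<open>G\<close> by \<open>A\<close> changes the squares by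
  \<open>O(d\<^sup>3)\<close>.
\<close>

lemma log_partition_expansion:
  fixes A H :: "'a \<Rightarrow> real"
  assumes M: "prob_space M" and A [measurable]: "A \<in> borel_measurable M" and H [measurable]: "H \<in> borel_measurable M"
    and d: "0 \<le> d" "d \<le> 1/8"
    and A_le: "AE e in M. \<bar>A e\<bar> \<le> d" and H_le: "AE e in M. \<bar>H e - 1 + A e\<bar> \<le> 2 * d\<^sup>2"
  shows "\<bar>ln (\<integral>e. H e \<partial>M) - (\<integral>e. ln (H e) \<partial>M) - 1/2 * (\<integral>e. (A e - (\<integral>e. A e \<partial>M))\<^sup>2 \<partial>M)\<bar> \<le> 40 * d ^ 3"
    and "(\<integral>e. (A e - (\<integral>e. A e \<partial>M))\<^sup>2 \<partial>M) \<le> d\<^sup>2"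
proof -
  interpret prob_space M by fact
  define G where "G = (\<lambda>e. H e - 1)"
  have G_meas [measurable]: "G \<in> borel_measurable M" unfolding G_def by measurable
  have dd: "d\<^sup>2 \<le> d / 8" using mult_left_mono[OF d(2) d(1)] by (simp add: power2_eq_square)
  have G_le: "AE e in M. \<bar>G e\<bar> \<le> 2 * d"
    using A_le H_le by eventually_elim (use dd d in \<open>auto simp: G_def\<close>)
  have int_bounded: "integrable M f" if "f \<in> borel_measurable M" "AE e in M. \<bar>f e\<bar> \<le> c" for f :: "'a \<Rightarrow> real" and c
    using that by (intro integrable_const_bound[of _ c]) auto
  have iA: "integrable M A" and iG: "integrable M G" using A_le G_le by (auto intro: int_bounded)
  have iA2: "integrable M (\<lambda>e. (A e)\<^sup>2)"
  proof (rule int_bounded)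
    show "AE e in M. \<bar>(A e)\<^sup>2\<bar> \<le> d\<^sup>2"
      using A_le by eventually_elim (simp add: abs_le_square_iff[symmetric] d)
  qed measurable
  have iG2: "integrable M (\<lambda>e. (G e)\<^sup>2)"
  proof (rule int_bounded)
    show "AE e in M. \<bar>(G e)\<^sup>2\<bar> \<le> (2 * d)\<^sup>2"
      using G_le by eventually_elim (metis abs_ge_zero abs_power2 power2_abs power_mono)
  qed measurable
  define a where "a = (\<integral>e. A e \<partial>M)"
  define g where "g = (\<integral>e. G e \<partial>M)"
  have le_const: "\<bar>\<integral>e. f e \<partial>M\<bar> \<le> c" if "integrable M f" "AE e in M. \<bar>f e\<bar> \<le> c" for f :: "'a \<Rightarrow> real" and c
  proof -
    have "\<bar>\<integral>e. f e \<partial>M\<bar> \<le> (\<integral>e. \<bar>f e\<bar> \<partial>M)" by (rule integral_abs_bound)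
    also have "\<dots> \<le> (\<integral>e. c \<partial>M)" using that by (intro integral_mono_AE) auto
    finally show ?thesis using prob_space by simp
  qed
  have g_le: "\<bar>g\<bar> \<le> 2 * d" unfolding g_def by (rule le_const[OF iG G_le])
  have a_le: "\<bar>a\<bar> \<le> d" unfolding a_def by (rule le_const[OF iA A_le])
  have cube: "2 * \<bar>x\<bar> ^ 3 \<le> 16 * d ^ 3" if "\<bar>x\<bar> \<le> 2 * d" for x
    using power_mono[OF that, of 3] by (simp add: power_mult_distrib)
  have var_A: "(\<integral>e. (A e - a)\<^sup>2 \<partial>M) = (\<integral>e. (A e)\<^sup>2 \<partial>M) - a\<^sup>2"
    unfolding a_def by (rule variance_eq[OF iA iA2])
  have "(\<integral>e. (A e)\<^sup>2 \<partial>M) \<le> (\<integral>e. d\<^sup>2 \<partial>M)"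
  proof (rule integral_mono_AE[OF iA2])
    show "AE e in M. (A e)\<^sup>2 \<le> d\<^sup>2"
      using A_le by eventually_elim (simp add: abs_le_square_iff[symmetric] d)
  qed simp
  also have "\<dots> = d\<^sup>2" using prob_space by simp
  finally show "(\<integral>e. (A e - (\<integral>e. A e \<partial>M))\<^sup>2 \<partial>M) \<le> d\<^sup>2"
    using var_A zero_le_power2[of a] unfolding a_def by linarith
  have "(\<integral>e. H e \<partial>M) = (\<integral>e. 1 + G e \<partial>M)" by (simp add: G_def)
  then have EH: "(\<integral>e. H e \<partial>M) = 1 + g" using iG prob_space by (simp add: g_def)
  have ln_EH: "\<bar>ln (\<integral>e. H e \<partial>M) - g + g\<^sup>2 / 2\<bar> \<le> 16 * d ^ 3"
    unfolding EH using ln_one_plus_cubic[of g] g_le d cube[of g] by linarith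
  have AE_ln: "AE e in M. \<bar>ln (H e) - G e + (G e)\<^sup>2 / 2\<bar> \<le> 16 * d ^ 3"
    using G_le
  proof eventually_elim
    case (elim e)
    have "1 + G e = H e" by (simp add: G_def)
    then show ?case using ln_one_plus_cubic[of "G e"] elim d cube[of "G e"] by force
  qed
  have i_rest: "integrable M (\<lambda>e. ln (H e) - G e + (G e)\<^sup>2 / 2)"
    by (rule int_bounded[OF _ AE_ln]) measurable
  have i_ln: "integrable M (\<lambda>e. ln (H e))"
  proof -
    have "integrable M (\<lambda>e. (G e)\<^sup>2 / 2)" using iG2 by simp
    from Bochner_Integration.integrable_diff[OF Bochner_Integration.integrable_add[OF i_rest iG] this]
    show ?thesis by simp
  qed
  have "(\<integral>e. ln (H e) - G e + (G e)\<^sup>2 / 2 \<partial>M) = (\<integral>e. ln (H e) \<partial>M) - g + (\<integral>e. (G e)\<^sup>2 \<partial>M) / 2"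
    using i_ln iG iG2 by (simp add: g_def)
  then have E_ln: "\<bar>(\<integral>e. ln (H e) \<partial>M) - g + (\<integral>e. (G e)\<^sup>2 \<partial>M) / 2\<bar> \<le> 16 * d ^ 3"
    using le_const[OF i_rest AE_ln] by simp
  have sq_diff: "\<bar>x\<^sup>2 - y\<^sup>2\<bar> \<le> 8 * d ^ 3" if "\<bar>x + y\<bar> \<le> 2 * d\<^sup>2" "\<bar>x\<bar> \<le> 2 * d" "\<bar>y\<bar> \<le> d" for x y
  proof -
    have "\<bar>x\<^sup>2 - y\<^sup>2\<bar> = \<bar>x + y\<bar> * \<bar>x - y\<bar>"
      by (simp add: abs_mult[symmetric] power2_eq_square algebra_simps)
    also have "\<dots> \<le> 2 * d\<^sup>2 * (3 * d)" using that d by (intro mult_mono) auto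
    also have "\<dots> \<le> 8 * d ^ 3" using d by (simp add: power2_eq_square power3_eq_cube)
    finally show ?thesis .
  qed
  have gsq: "\<bar>g\<^sup>2 - a\<^sup>2\<bar> \<le> 8 * d ^ 3"
  proof (rule sq_diff[OF _ g_le a_le])
    have "g + a = (\<integral>e. H e - 1 + A e \<partial>M)" unfolding g_def a_def using iG iA by (simp add: G_def)
    also have "\<bar>\<dots>\<bar> \<le> 2 * d\<^sup>2" by (rule le_const[OF _ H_le]) (use iG iA in \<open>simp add: G_def\<close>)
    finally show "\<bar>g + a\<bar> \<le> 2 * d\<^sup>2" .
  qed
  have Gsq: "\<bar>(\<integral>e. (G e)\<^sup>2 \<partial>M) - (\<integral>e. (A e)\<^sup>2 \<partial>M)\<bar> \<le> 8 * d ^ 3"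
  proof -
    have "(\<integral>e. (G e)\<^sup>2 \<partial>M) - (\<integral>e. (A e)\<^sup>2 \<partial>M) = (\<integral>e. (G e)\<^sup>2 - (A e)\<^sup>2 \<partial>M)" using iG2 iA2 by simp
    also have "\<bar>\<dots>\<bar> \<le> 8 * d ^ 3"
    proof (rule le_const)
      show "AE e in M. \<bar>(G e)\<^sup>2 - (A e)\<^sup>2\<bar> \<le> 8 * d ^ 3"
        using G_le A_le H_le
      proof eventually_elim
        case (elim e)
        then show ?case by (intro sq_diff) (auto simp: G_def)
      qed
    qed (use iG2 iA2 in simp)
    finally show ?thesis .
  qed
  show "\<bar>ln (\<integral>e. H e \<partial>M) - (\<integral>e. ln (H e) \<partial>M) - 1/2 * (\<integral>e. (A e - (\<integral>e. A e \<partial>M))\<^sup>2 \<partial>M)\<bar> \<le> 40 * d ^ 3"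
  proof -
    have combine: "\<bar>l - x + x2 / 2\<bar> \<le> 16 * t \<Longrightarrow> \<bar>q - x + y2 / 2\<bar> \<le> 16 * t \<Longrightarrow> \<bar>x2 - b2\<bar> \<le> 8 * t \<Longrightarrow>
        \<bar>y2 - z2\<bar> \<le> 8 * t \<Longrightarrow> \<bar>l - q - 1/2 * (z2 - b2)\<bar> \<le> 40 * t" for l q x x2 y2 z2 b2 t :: real
      by (simp add: abs_le_iff field_simps)
    show ?thesis
      unfolding a_def[symmetric] var_A by (rule combine[OF ln_EH E_ln gsq Gsq])
  qed
qed

section \<open>The standardized potential\<close>

lemma sets_PiM_borel: "sets (\<Pi>\<^sub>M i\<in>{..<p}. borel) = sets (leb p)"
  by (simp add: sets_leb)

lemma dir_law_eq:
  assumes "\<mu> \<in> Rn p" "sets M = sets (leb p)"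
  shows "dir_law p \<mu> W M = distr (distr M (leb p) (standardize p \<mu> W)) (leb p) (vdir p)"
proof -
  have st: "standardize p \<mu> W \<in> M \<rightarrow>\<^sub>M leb p"
    using measurable_standardize[OF assms(1), of W] assms(2) by (simp cong: measurable_cong_sets)
  have "dir_law p \<mu> W M = distr M (\<Pi>\<^sub>M i\<in>{..<p}. borel) (\<lambda>x. vdir p (standardize p \<mu> W x))"
    by (simp add: dir_law_def vdir_def)
  also have "\<dots> = distr M (leb p) (\<lambda>x. vdir p (standardize p \<mu> W x))"
    by (rule distr_cong) (simp_all add: sets_PiM_borel)
  also have "\<dots> = distr (distr M (leb p) (standardize p \<mu> W)) (leb p) (vdir p)"
    using st by (subst distr_distr) (auto simp: o_def)
  finally show ?thesis .
qed

definition ray_remainder :: "nat \<Rightarrow> (rvec \<Rightarrow> real) \<Rightarrow> rvec \<Rightarrow> rmat \<Rightarrow> rvec \<Rightarrow> real \<Rightarrow> real" where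
  "ray_remainder p \<phi> \<mu> S e r = phi_std p \<phi> \<mu> S (vscale p r e) - r\<^sup>2 / 2 - \<phi> \<mu>"

context
  fixes p \<phi> \<mu> Cov S W
  assumes setting: "laplace_setting p \<phi> \<mu> Cov S W"
begin

abbreviation (input) "D \<equiv> Delta3 p \<phi> \<mu> S"
abbreviation (input) "\<psi> \<equiv> ray_remainder p \<phi> \<mu> S"
abbreviation (input) "slope e r \<equiv> vdot p e (grad p (phi_std p \<phi> \<mu> S) (vscale p r e)) - r"

lemma p_pos: "1 \<le> p" and mu_in: "\<mu> \<in> Rn p" and diff3: "times_differentiable p 3 \<phi>"
  and inv_SW: "minverse p S W" and int_phi: "integrable (leb p) (\<lambda>x. exp (- \<phi> x))"
  using setting by (auto simp: laplace_setting_def)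

text \<open>
  If \<open>z = S H S x\<close> then \<open>S z = \<Sigma> H S x = S x\<close>, and \<open>S\<close> is
  injective. So \<open>S H S\<close> is the identity, and symmetry of \<open>S\<close> moves one factor across
  the inner product.
\<close>

lemma hessian_standardized:
  assumes x: "x \<in> Rn p"
  shows "vdot p (mvec p S x) (mvec p (hess \<phi> \<mu>) (mvec p S x)) = (vnorm p x)\<^sup>2"
proof -
  let ?H = "hess \<phi> \<mu>"
  have inv_H: "minverse p ?H Cov" and SS: "mprod_eq p S S Cov" and sym: "pos_def p S"
    using setting by (auto simp: laplace_setting_def)
  define z where "z = mvec p S (mvec p ?H (mvec p S x))"
  have z: "z \<in> Rn p" by (simp add: z_def)
  have "mvec p S z = mvec p Cov (mvec p ?H (mvec p S x))"
    unfolding z_def by (rule mvec_mprod_eq[OF SS])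
  also have "\<dots> = mvec p S x" by (rule minverse_mvec(2)[OF inv_H]) simp
  finally have "mvec p W (mvec p S z) = mvec p W (mvec p S x)" by simp
  then have "z = x" by (simp add: minverse_mvec(2)[OF inv_SW z] minverse_mvec(2)[OF inv_SW x])
  moreover have "vdot p (mvec p S x) (mvec p ?H (mvec p S x)) = vdot p x z"
    unfolding z_def by (rule vdot_mvec_symmetric) (use sym in \<open>simp add: pos_def_def\<close>)
  ultimately show ?thesis by (simp add: vnorm_square_vdot)
qed

lemma phi_g_standardize:
  assumes x: "x \<in> Rn p"
  shows "phi_g p \<phi> \<mu> x = (vnorm p (standardize p \<mu> W x))\<^sup>2 / 2"
proof -
  have "mvec p S (standardize p \<mu> W x) = vsub p x \<mu>"
    unfolding standardize_def by (rule minverse_mvec(1)[OF inv_SW]) simp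
  then show ?thesis using hessian_standardized[of "standardize p \<mu> W x"] by (simp add: phi_g_def)
qed

lemma phi_standardize: "x \<in> Rn p \<Longrightarrow> \<phi> x = phi_std p \<phi> \<mu> S (standardize p \<mu> W x)"
  using unstandardize_standardize[OF inv_SW mu_in] by (simp add: phi_std_def)

lemma third_deriv_le_Delta3:
  assumes "x \<in> Rn p" "u \<in> unit_sphere p"
  shows "\<bar>third_deriv p (phi_std p \<phi> \<mu> S) x u u u\<bar> \<le> D"
proof -
  have "\<bar>third_deriv p (phi_std p \<phi> \<mu> S) x u u u\<bar> / (vnorm p u * vnorm p u * vnorm p u) \<in> Delta3_set p \<phi> \<mu> S"
    unfolding Delta3_set_def using assms by (force simp: unit_sphere_def)
  moreover have "bdd_above (Delta3_set p \<phi> \<mu> S)" using setting by (simp add: laplace_setting_def)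
  ultimately show ?thesis
    unfolding Delta3_def using cSup_upper assms(2) by (fastforce simp: unit_sphere_def)
qed

lemma Delta3_nonneg: "0 \<le> D"
proof -
  have "vnorm p (unit_vec p 0) = 1"
  proof -
    have "(vnorm p (unit_vec p 0))\<^sup>2 = 1"
      using p_pos by (simp add: vnorm_square unit_vec_def of_bool_def if_distrib[of "\<lambda>c. c ^ 2"] cong: if_cong)
    then show ?thesis by (simp add: power2_eq_1_iff) (use vnorm_nonneg[of p "unit_vec p 0"] in linarith)
  qed
  then have "unit_vec p 0 \<in> unit_sphere p" by (simp add: unit_sphere_def unit_vec_def Rn_def)
  from order.trans[OF abs_ge_zero third_deriv_le_Delta3[OF vscale_in_Rn this]] show ?thesis .
qed

lemma phi_std_zero: "phi_std p \<phi> \<mu> S (vscale p 0 e) = \<phi> \<mu>"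
proof -
  have "vadd p \<mu> (mvec p S (vscale p 0 e)) = \<mu>" using mu_in by (intro Rn_eqI[of _ p]) auto
  then show ?thesis by (simp add: phi_std_def)
qed

text \<open>
  The value and the slope of the remainder vanish at the minimum, its second derivative there because the
  standardized Hessian is the identity. Integrating the bound on the third derivative three times gives the
  bounds; strict convexity along the segment from the minimum gives the last property.
\<close>

lemma cubic_remainder_ray:
  assumes e: "e \<in> unit_sphere p"
  shows "cubic_remainder p D (\<psi> e) (slope e)"
proof -
  let ?f = "phi_std p \<phi> \<mu> S"
  have e_Rn: "e \<in> Rn p" and e1: "vnorm p e = 1" using e by (auto simp: unit_sphere_def)
  have line: "vadd p (\<lambda>i\<in>{..<p}. 0) (vscale p r e) = vscale p r e" for r by (rule Rn_eqI[of _ p]) auto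
  define V where "V = (\<lambda>r. ?f (vscale p r e))"
  define V1 where "V1 = (\<lambda>r. vdot p e (grad p ?f (vscale p r e)))"
  define V2 where "V2 = (\<lambda>r. vdot p e (mvec p (hess ?f (vscale p r e)) e))"
  note d = line_derivatives[OF times_differentiable_phi_std[OF diff3], where v=e and a="\<lambda>i\<in>{..<p}. 0", unfolded line]
  have dV: "(V has_real_derivative V1 r) (at r)" for r unfolding V_def V1_def by (rule d(1))
  have dV1: "(V1 has_real_derivative V2 r) (at r)" for r unfolding V2_def V1_def by (rule d(2))
  have dV2: "(V2 has_real_derivative third_deriv p ?f (vscale p r e) e e e) (at r)" for r
    unfolding V2_def by (rule d(3))
  have V0: "V 0 = \<phi> \<mu>" unfolding V_def by (rule phi_std_zero)
  have V_min: "\<phi> \<mu> \<le> V r" for r using setting by (simp add: V_def phi_std_def laplace_setting_def)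
  have V10: "V1 0 = 0" by (rule DERIV_local_min[OF dV zero_less_one]) (simp add: V0 V_min)
  \<comment> \<open>The second derivative at the origin is computed in the original coordinates, where the Hessian is that of \<open>\<phi>\<close>.\<close>
  have V20: "V2 0 = 1"
  proof -
    define v where "v = mvec p S e"
    have V_line: "V = (\<lambda>r. \<phi> (vadd p \<mu> (vscale p r v)))"
      by (simp add: V_def phi_std_def mvec_vscale v_def)
    note g = line_derivatives[OF diff3, where v=v and a=\<mu>]
    have "V1 = (\<lambda>r. vdot p v (grad p \<phi> (vadd p \<mu> (vscale p r v))))"
      using dV g(1) unfolding V_line by (intro ext DERIV_unique)
    then have "V2 0 = vdot p v (mvec p (hess \<phi> (vadd p \<mu> (vscale p 0 v))) v)"
      using dV1[of 0] g(2)[of 0] by (intro DERIV_unique[of V1 _ 0]) simp_all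
    also have "vadd p \<mu> (vscale p 0 v) = \<mu>" using mu_in by (intro Rn_eqI[of _ p]) auto
    also have "vdot p v (mvec p (hess \<phi> \<mu>) v) = 1"
      unfolding v_def using hessian_standardized[OF e_Rn] e1 by simp
    finally show ?thesis .
  qed
  have B2: "\<bar>V2 x - 1\<bar> \<le> D * x" if "0 \<le> x" for x
  proof -
    have "((\<lambda>x. V2 x - 1) has_real_derivative third_deriv p ?f (vscale p x e) e e e) (at x)" for x
      using dV2[of x] by (auto intro!: derivative_eq_intros)
    from derivative_bound_integrate[OF this, of D 0 x] that V20 third_deriv_le_Delta3[OF vscale_in_Rn e]
    show ?thesis by simp
  qed
  have dV1': "((\<lambda>x. V1 x - x) has_real_derivative V2 x - 1) (at x)" for x
    by (rule DERIV_diff[OF dV1 DERIV_ident])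
  have B1: "\<bar>V1 x - x\<bar> \<le> D / 2 * x\<^sup>2" if "0 \<le> x" for x
    using derivative_bound_integrate[of "\<lambda>x. V1 x - x" "\<lambda>x. V2 x - 1" D 1 x, OF dV1'] that V10 B2
    by (simp add: power2_eq_square)
  have dpsi: "(\<psi> e has_real_derivative V1 x - x) (at x)" for x
  proof -
    have "\<psi> e = (\<lambda>r. V r - r\<^sup>2 / 2 - \<phi> \<mu>)"
      by (simp add: ray_remainder_def V_def fun_eq_iff)
    then show ?thesis using dV[of x] by (auto intro!: derivative_eq_intros)
  qed
  have psi0: "\<psi> e 0 = 0" using V0 by (simp add: ray_remainder_def V_def)
  have B0: "\<bar>\<psi> e x\<bar> \<le> D * x ^ 3 / 6" if "0 \<le> x" for x
    using derivative_bound_integrate[of "\<psi> e" "\<lambda>x. V1 x - x" "D / 2" 2 x, OF dpsi psi0 B1 that]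
    by (simp add: eval_nat_numeral)
  have V_convex: "V s - \<phi> \<mu> \<le> s / r * (V r - \<phi> \<mu>)" if s: "0 < s" "s < r" for s r
  proof -
    define t where "t = s / r"
    have t: "0 < t" "t < 1" using s by (simp_all add: t_def)
    \<comment> \<open>Strict convexity requires distinct end points.\<close>
    have ne: "\<mu> \<noteq> vadd p \<mu> (mvec p S (vscale p r e))"
    proof
      assume "\<mu> = vadd p \<mu> (mvec p S (vscale p r e))"
      then have "standardize p \<mu> W \<mu> = vscale p r e"
        using standardize_unstandardize[OF inv_SW mu_in vscale_in_Rn, of r e] by simp
      moreover have "standardize p \<mu> W \<mu> = vscale p 0 e"
        by (rule Rn_eqI[of _ p]) (auto simp: standardize_def)
      ultimately have "vnorm p (vscale p 0 e) = vnorm p (vscale p r e)" by simp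
      then show False using s e1 by simp
    qed
    have pt: "vadd p (vscale p (1 - t) \<mu>) (vscale p t (vadd p \<mu> (mvec p S (vscale p r e))))
       = vadd p \<mu> (mvec p S (vscale p s e))"
      using s by (intro Rn_eqI[of _ p]) (auto simp: t_def sum_distrib_left algebra_simps)
    have "\<phi> (vadd p \<mu> (mvec p S (vscale p s e))) < (1 - t) * \<phi> \<mu> + t * \<phi> (vadd p \<mu> (mvec p S (vscale p r e)))"
      using setting ne t mu_in unfolding laplace_setting_def strictly_convex_def pt[symmetric] by auto
    then show ?thesis by (simp add: V_def phi_std_def t_def algebra_simps)
  qed
  show ?thesis
  proof
    show "1 \<le> p" by (rule p_pos)
    show "0 \<le> D" by (rule Delta3_nonneg)
    show "(\<psi> e has_real_derivative vdot p e (grad p ?f (vscale p r e)) - r) (at r)" for r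
      using dpsi[of r] by (simp add: V1_def)
    show "continuous_on UNIV (\<lambda>r. vdot p e (grad p ?f (vscale p r e)) - r)"
      using dV1' unfolding V1_def by (intro continuous_at_imp_continuous_on ballI) (rule DERIV_isCont)
    show "\<bar>\<psi> e r\<bar> \<le> D * r ^ 3 / 6" "\<bar>vdot p e (grad p ?f (vscale p r e)) - r\<bar> \<le> D / 2 * r\<^sup>2" if "0 \<le> r" for r
      using B0[OF that] B1[OF that] by (simp_all add: V1_def)
    show "r / s * (\<psi> e s + s\<^sup>2 / 2) \<le> \<psi> e r + r\<^sup>2 / 2" if "0 < s" "s \<le> r" for s r
    proof (cases "s = r")
      case False
      have "r / s * (V s - \<phi> \<mu>) \<le> r / s * (s / r * (V r - \<phi> \<mu>))"
        using V_convex[of s r] that False by (intro mult_left_mono) auto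
      then show ?thesis using that by (simp add: ray_remainder_def V_def)
    qed (use that in simp)
  qed
qed

section \<open>The divergences as integrals of the remainder\<close>

definition "remainder x = phi_std p \<phi> \<mu> S x - (vnorm p x)\<^sup>2 / 2 - \<phi> \<mu>"
definition "ray_mean e = (\<integral>r. \<psi> e r \<partial>chi p)"
definition "ray_mass e = (\<integral>r. exp (- \<psi> e r) \<partial>chi p)"

lemma measurable_phi_std [measurable]: "phi_std p \<phi> \<mu> S \<in> borel_measurable (leb p)"
proof -
  have "\<phi> \<in> borel_measurable (leb p)" by (rule measurable_potential[OF int_phi])
  moreover have "(\<lambda>_. \<mu>) \<in> leb p \<rightarrow>\<^sub>M leb p" using mu_in by (intro measurable_const) simp
  then have "(\<lambda>x. vadd p \<mu> (mvec p S x)) \<in> leb p \<rightarrow>\<^sub>M leb p" by (intro measurable_vadd measurable_mvec) simp_all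
  ultimately have "(\<lambda>x. \<phi> (vadd p \<mu> (mvec p S x))) \<in> borel_measurable (leb p)" by simp
  then show ?thesis by (simp add: phi_std_def[abs_def])
qed

lemma measurable_remainder [measurable]: "remainder \<in> borel_measurable (leb p)"
  unfolding remainder_def[abs_def] by measurable

lemma measurable_ray_remainder [measurable]:
  "(\<lambda>x. \<psi> (fst x) (snd x)) \<in> borel_measurable (leb p \<Otimes>\<^sub>M borel)"
  unfolding ray_remainder_def by measurable

lemma measurable_ray_mean [measurable]: "ray_mean \<in> borel_measurable (leb p)"
  and measurable_ray_mass [measurable]: "ray_mass \<in> borel_measurable (leb p)"
proof -
  interpret chi: prob_space "chi p" by (rule prob_space_chi[OF p_pos])
  have "(\<lambda>(e, r). \<psi> e r) \<in> borel_measurable (leb p \<Otimes>\<^sub>M chi p)"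
    "(\<lambda>(e, r). exp (- \<psi> e r)) \<in> borel_measurable (leb p \<Otimes>\<^sub>M chi p)"
    unfolding case_prod_beta by measurable
  then show "ray_mean \<in> borel_measurable (leb p)" "ray_mass \<in> borel_measurable (leb p)"
    unfolding ray_mean_def[abs_def] ray_mass_def[abs_def]
    by (intro chi.borel_measurable_lebesgue_integral; simp)+
qed

lemma remainder_ray: "e \<in> unit_sphere p \<Longrightarrow> remainder (vscale p r e) = \<psi> e r"
  by (simp add: remainder_def ray_remainder_def unit_sphere_def)

lemma abs_remainder_le:
  assumes x: "x \<in> Rn p" shows "\<bar>remainder x\<bar> \<le> D * vnorm p x ^ 3 / 6"
proof (cases "vnorm p x = 0")
  case True
  then have "x = vscale p 0 x" using x by (intro Rn_eqI[of _ p]) (auto simp: vnorm_eq_0_iff)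
  then have "phi_std p \<phi> \<mu> S x = \<phi> \<mu>" using phi_std_zero[of x] by simp
  then show ?thesis using True by (simp add: remainder_def)
next
  case False
  then have e: "vdir p x \<in> unit_sphere p" using x by (simp add: unit_sphere_def vnorm_vdir)
  interpret cubic_remainder p D "\<psi> (vdir p x)" "slope (vdir p x)"
    by (rule cubic_remainder_ray[OF e])
  show ?thesis using bound[of "vnorm p x"] remainder_ray[OF e, of "vnorm p x"] x by (simp add: vscale_vnorm_vdir)
qed

lemma integrable_vnorm_power: "integrable (std_gauss p) (\<lambda>x. vnorm p x ^ k)"
proof -
  have "integrable (distr (std_gauss p) borel (vnorm p)) (\<lambda>r. r ^ k)"
    unfolding distr_std_gauss_vnorm[OF p_pos] by (rule integrable_chi_power[OF p_pos])
  then show ?thesis by (subst (asm) integrable_distr_eq) auto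
qed

lemma integrable_remainder_power: "integrable (std_gauss p) (\<lambda>x. remainder x ^ k)"
proof (rule Bochner_Integration.integrable_bound)
  show "integrable (std_gauss p) (\<lambda>x. (D / 6) ^ k * vnorm p x ^ (3 * k))"
    by (intro integrable_mult_right integrable_vnorm_power)
  show "AE x in std_gauss p. norm (remainder x ^ k) \<le> norm ((D / 6) ^ k * vnorm p x ^ (3 * k))"
  proof (rule AE_I2)
    fix x assume "x \<in> space (std_gauss p)"
    then have "\<bar>remainder x\<bar> ^ k \<le> (D * vnorm p x ^ 3 / 6) ^ k" by (intro power_mono abs_remainder_le) auto
    also have "\<dots> = (D / 6) ^ k * vnorm p x ^ (3 * k)" by (simp add: power_mult power_mult_distrib power_divide)
    finally show "norm (remainder x ^ k) \<le> norm ((D / 6) ^ k * vnorm p x ^ (3 * k))"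
      using Delta3_nonneg by (simp add: power_abs)
  qed
qed measurable

lemma integrable_remainder: "integrable (std_gauss p) remainder"
  using integrable_remainder_power[of 1] by simp

lemma integrable_phi_std: "integrable (leb p) (\<lambda>x. exp (- phi_std p \<phi> \<mu> S x))"
  using distr_gibbs_standardize(1)[OF inv_SW mu_in measurable_phi_std phi_standardize]
    int_phi by blast

lemma integrable_phi_g: "integrable (leb p) (\<lambda>x. exp (- phi_g p \<phi> \<mu> x))"
  and distr_laplace_standardize: "distr (laplace_approx p \<phi> \<mu>) (leb p) (standardize p \<mu> W) = std_gauss p"
proof -
  have m: "(\<lambda>x. (vnorm p x)\<^sup>2 / 2) \<in> borel_measurable (leb p)" by measurable
  note t = distr_gibbs_standardize[OF inv_SW mu_in m phi_g_standardize]
  show "integrable (leb p) (\<lambda>x. exp (- phi_g p \<phi> \<mu> x))"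
    using t(1) integrable_std_gauss by blast
  show "distr (laplace_approx p \<phi> \<mu>) (leb p) (standardize p \<mu> W) = std_gauss p"
    unfolding laplace_approx_def std_gauss_def by (rule t(2)) (simp_all add: integrable_std_gauss)
qed

lemma sets_laplace [simp, measurable_cong]: "sets (laplace_approx p \<phi> \<mu>) = sets (leb p)"
  and space_laplace [simp]: "space (laplace_approx p \<phi> \<mu>) = Rn p"
  by (simp_all add: laplace_approx_def)

lemma prob_space_laplace: "prob_space (laplace_approx p \<phi> \<mu>)"
  unfolding laplace_approx_def by (rule prob_space_gibbs[OF integrable_phi_g])

lemma dir_g_eq: "dir_g p \<phi> \<mu> W = sphere_law p"
  unfolding dir_g_def by (subst dir_law_eq[OF mu_in])
    (simp_all add: distr_laplace_standardize sphere_law_def)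

lemma rad_g_eq: "rad_g p \<phi> \<mu> W = chi p"
proof -
  note [measurable] = measurable_standardize[OF mu_in, of W]
  have "rad_g p \<phi> \<mu> W = distr (distr (laplace_approx p \<phi> \<mu>) (leb p) (standardize p \<mu> W)) borel (vnorm p)"
    unfolding rad_g_def rad_law_def by (subst distr_distr) (auto simp: o_def)
  then show ?thesis by (simp add: distr_laplace_standardize distr_std_gauss_vnorm[OF p_pos])
qed

definition "mass = (\<integral>x. exp (- remainder x) \<partial>std_gauss p)"

lemma std_tilt:
  "integrable (std_gauss p) (\<lambda>x. exp (- remainder x))"
  "gibbs p (phi_std p \<phi> \<mu> S) = density (std_gauss p) (\<lambda>x. ennreal (exp (- remainder x) / mass))"
  unfolding std_gauss_def mass_def
  using gibbs_tilt[OF integrable_std_gauss integrable_phi_std, of remainder "\<phi> \<mu>"]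
  by (auto simp: remainder_def)

text \<open>
  The divergence is computed for the original variables; only the two integrals of \<open>KL_tilt\<close> are
  transported to the standard Gaussian.
\<close>

lemma KL_total: "KL (laplace_approx p \<phi> \<mu>) (gibbs p \<phi>) = (\<integral>x. remainder x \<partial>std_gauss p) + ln mass"
proof -
  let ?L = "laplace_approx p \<phi> \<mu>" and ?h = "\<lambda>x. remainder (standardize p \<mu> W x)"
  note [measurable] = measurable_standardize[OF mu_in, of W]
  have st: "standardize p \<mu> W \<in> ?L \<rightarrow>\<^sub>M leb p" by measurable
  have tr: "(\<integral>x. F (standardize p \<mu> W x) \<partial>?L) = (\<integral>x. F x \<partial>std_gauss p)"
    if "F \<in> borel_measurable (leb p)" for F :: "rvec \<Rightarrow> real"
    unfolding distr_laplace_standardize[symmetric] using that by (subst integral_distr[OF st]) auto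
  have h: "\<phi> x = phi_g p \<phi> \<mu> x + ?h x + \<phi> \<mu>" if "x \<in> Rn p" for x
    using phi_standardize[OF that] phi_g_standardize[OF that] by (simp add: remainder_def)
  have t: "integrable ?L (\<lambda>x. exp (- ?h x))"
    "gibbs p \<phi> = density ?L (\<lambda>x. ennreal (exp (- ?h x) / (\<integral>x. exp (- ?h x) \<partial>?L)))"
    unfolding laplace_approx_def
    by (rule gibbs_tilt[OF integrable_phi_g int_phi, of ?h "\<phi> \<mu>"]; erule h)+
  have "integrable ?L ?h"
    using integrable_remainder unfolding distr_laplace_standardize[symmetric]
    by (subst (asm) integrable_distr_eq[OF st]) auto
  then have "KL ?L (gibbs p \<phi>) = (\<integral>x. ?h x \<partial>?L) + ln (\<integral>x. exp (- ?h x) \<partial>?L)"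
    unfolding t(2) by (intro KL_tilt prob_space_laplace t(1))
  then show ?thesis
    using tr[of remainder] tr[of "\<lambda>x. exp (- remainder x)"] by (simp add: mass_def)
qed

lemma KL_var_eq: "KL_var p \<phi> \<mu> = (\<integral>x. (remainder x)\<^sup>2 \<partial>std_gauss p) - (\<integral>x. remainder x \<partial>std_gauss p)\<^sup>2"
proof -
  interpret L: prob_space "laplace_approx p \<phi> \<mu>" by (rule prob_space_laplace)
  interpret G: prob_space "std_gauss p" by (rule prob_space_std_gauss)
  let ?L = "laplace_approx p \<phi> \<mu>"
  note [measurable] = measurable_standardize[OF mu_in, of W]
  have st: "standardize p \<mu> W \<in> ?L \<rightarrow>\<^sub>M leb p" by measurable
  have tr: "(\<integral>x. F (standardize p \<mu> W x) \<partial>?L) = (\<integral>x. F x \<partial>std_gauss p)"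
    if "F \<in> borel_measurable (leb p)" for F :: "rvec \<Rightarrow> real"
    unfolding distr_laplace_standardize[symmetric] using that by (subst integral_distr[OF st]) auto
  have h: "\<phi> x - phi_g p \<phi> \<mu> x = remainder (standardize p \<mu> W x) + \<phi> \<mu>" if "x \<in> Rn p" for x
    using phi_standardize[OF that] phi_g_standardize[OF that] by (simp add: remainder_def)
  have m: "(\<integral>x. \<phi> x - phi_g p \<phi> \<mu> x \<partial>?L) = (\<integral>x. remainder x \<partial>std_gauss p) + \<phi> \<mu>"
  proof -
    have "(\<integral>x. \<phi> x - phi_g p \<phi> \<mu> x \<partial>?L) = (\<integral>x. (\<lambda>y. remainder y + \<phi> \<mu>) (standardize p \<mu> W x) \<partial>?L)"
      by (intro Bochner_Integration.integral_cong) (auto simp: h)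
    also have "\<dots> = (\<integral>x. remainder x + \<phi> \<mu> \<partial>std_gauss p)" by (rule tr) measurable
    finally show ?thesis using integrable_remainder G.prob_space by simp
  qed
  have "KL_var p \<phi> \<mu> = (\<integral>x. (\<lambda>y. (remainder y - (\<integral>x. remainder x \<partial>std_gauss p))\<^sup>2) (standardize p \<mu> W x) \<partial>?L)"
    unfolding KL_var_def m by (intro Bochner_Integration.integral_cong) (auto simp: h)
  also have "\<dots> = (\<integral>x. (remainder x - (\<integral>x. remainder x \<partial>std_gauss p))\<^sup>2 \<partial>std_gauss p)" by (rule tr) measurable
  also have "\<dots> = (\<integral>x. (remainder x)\<^sup>2 \<partial>std_gauss p) - (\<integral>x. remainder x \<partial>std_gauss p)\<^sup>2"
    using integrable_remainder integrable_remainder_power[of 2] by (rule G.variance_eq)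
  finally show ?thesis .
qed

text \<open>
  The density \<open>exp (- phi_std) r\<^sup>p\<^sup>-\<^sup>1\<close> of the conditional law is the density of
  the chi law times \<open>exp (- \<psi>)\<close>, up to a factor that the normalization removes.
\<close>

lemma KL_rad_eq:
  assumes e: "e \<in> unit_sphere p"
  shows "KL_rad p \<phi> \<mu> S W e = ray_mean e + ln (ray_mass e)"
proof -
  interpret R: cubic_remainder p D "\<psi> e" "slope e"
    by (rule cubic_remainder_ray[OF e])
  have M: "0 < half_moment (p - 1)" by (rule half_moment_pos[OF p_pos])
  let ?w = "\<lambda>r::real. indicator {0..} r * (r ^ (p - 1) * exp (- r\<^sup>2 / 2))"
  have w: "rad_weight p \<phi> \<mu> S e r = exp (- \<phi> \<mu>) * (?w r * exp (- \<psi> e r))" for r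
  proof -
    have "exp (- phi_std p \<phi> \<mu> S (vscale p r e)) = exp (- \<phi> \<mu>) * exp (- r\<^sup>2 / 2) * exp (- \<psi> e r)"
      unfolding ray_remainder_def by (simp flip: exp_add)
    then show ?thesis by (simp add: rad_weight_def)
  qed
  have Z: "(\<integral>r. rad_weight p \<phi> \<mu> S e r \<partial>lborel) = exp (- \<phi> \<mu>) * (half_moment (p - 1) * ray_mass e)"
    unfolding w ray_mass_def using M p_pos by (simp add: integral_chi)
  have mass: "0 < ray_mass e" using R.tilt_mass_pos by (simp add: R.tilt_mass_def ray_mass_def)
  have "rad_cond_law p \<phi> \<mu> S e = density (chi p) (\<lambda>r. ennreal (exp (- \<psi> e r) / ray_mass e))"
    unfolding rad_cond_law_def chi_def Z w
    by (subst density_density_eq)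
       (use M mass in \<open>auto intro!: density_cong AE_I2 simp: ennreal_mult'[symmetric] field_simps split: split_indicator\<close>)
  then show ?thesis
    unfolding KL_rad_def rad_g_eq ray_mass_def ray_mean_def
    using KL_tilt[OF prob_space_chi[OF p_pos] R.integrable_psi R.integrable_exp] by simp
qed

text \<open>
  Measurability in the direction, needed since the average over directions is a Bochner integral, whose value
  for a non-measurable function would be \<open>0\<close>. Off the sphere the normalizing constant may be
  \<open>0\<close>, when the weight is not integrable; then the conditional law is the null measure and the
  value does not depend on the direction.
\<close>

lemma measurable_KL_rad [measurable]: "(\<lambda>e. KL_rad p \<phi> \<mu> S W e) \<in> borel_measurable (leb p)"
proof -
  let ?g = "\<lambda>r::real. indicator {0..} r * (r ^ (p - 1) * exp (- r\<^sup>2 / 2)) / half_moment (p - 1)"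
  let ?Z = "\<lambda>e. \<integral>s. rad_weight p \<phi> \<mu> S e s \<partial>lborel"
  have M: "0 < half_moment (p - 1)" by (rule half_moment_pos[OF p_pos])
  have w_meas [measurable]: "(\<lambda>x. rad_weight p \<phi> \<mu> S (fst x) (snd x)) \<in> borel_measurable (leb p \<Otimes>\<^sub>M borel)"
    unfolding rad_weight_def by measurable
  have [measurable]: "(\<lambda>x. rad_weight p \<phi> \<mu> S (fst x) (snd x)) \<in> borel_measurable (leb p \<Otimes>\<^sub>M lborel)"
    using w_meas by (simp cong: measurable_cong_sets sets_pair_measure_cong)
  have Z_meas [measurable]: "?Z \<in> borel_measurable (leb p)"
    by (rule lborel.borel_measurable_lebesgue_integral) (simp add: case_prod_beta)
  \<comment> \<open>When \<open>?Z e\<close> is \<open>0\<close>, division by it gives the zero density.\<close>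
  have eq: "KL_rad p \<phi> \<mu> S W e = (if ?Z e = 0 then KL (chi p) (density lborel (\<lambda>_. 0))
      else (\<integral>r. ?g r * log (exp 1) (?g r / (rad_weight p \<phi> \<mu> S e r / ?Z e)) \<partial>lborel))" if e: "e \<in> Rn p" for e
  proof (cases "?Z e = 0")
    case False
    have we [measurable]: "rad_weight p \<phi> \<mu> S e \<in> borel_measurable borel"
      using measurable_compose[OF measurable_Pair1'[of e "leb p" borel] w_meas] e by simp
    have nn: "0 \<le> rad_weight p \<phi> \<mu> S e r" for r by (auto simp: rad_weight_def split: split_indicator)
    define z where "z = ?Z e"
    have z: "0 \<le> z" "z \<noteq> 0" using False nn by (simp_all add: z_def)
    have w0: "rad_weight p \<phi> \<mu> S e r = 0 \<longleftrightarrow> indicator {0..} r * r ^ (p - 1) = (0::real)" for r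
      by (auto simp: rad_weight_def)
    have "KL_divergence (exp 1) (density lborel (\<lambda>r. ennreal (rad_weight p \<phi> \<mu> S e r / z))) (density lborel (\<lambda>r. ennreal (?g r)))
      = (\<integral>r. ?g r * log (exp 1) (?g r / (rad_weight p \<phi> \<mu> S e r / z)) \<partial>lborel)"
    proof (rule lborel.KL_density_density)
      show "AE r in lborel. rad_weight p \<phi> \<mu> S e r / z = 0 \<longrightarrow> ?g r = 0"
        using z by (auto simp: w0)
    qed (use M z nn in \<open>auto intro!: AE_I2 split: split_indicator\<close>)
    then show ?thesis using False unfolding KL_rad_def rad_g_eq KL_def rad_cond_law_def chi_def z_def by simp
  qed (simp add: KL_rad_def rad_g_eq rad_cond_law_def)
  have I: "(\<lambda>e. \<integral>r. ?g r * log (exp 1) (?g r / (rad_weight p \<phi> \<mu> S e r / ?Z e)) \<partial>lborel) \<in> borel_measurable (leb p)"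
    by (rule lborel.borel_measurable_lebesgue_integral) (unfold case_prod_beta, measurable)
  have "(\<lambda>e. if ?Z e = 0 then KL (chi p) (density lborel (\<lambda>_. 0))
      else (\<integral>r. ?g r * log (exp 1) (?g r / (rad_weight p \<phi> \<mu> S e r / ?Z e)) \<partial>lborel)) \<in> borel_measurable (leb p)"
    using I by measurable
  then show ?thesis by (subst measurable_cong[OF eq]) simp_all
qed

lemma AE_sphere: "AE e in sphere_law p. e \<in> unit_sphere p"
  by (rule AE_sphere_law[OF p_pos])

text \<open>
  Bounds that are uniform in the direction make \<open>ln ray_mass\<close> integrable over the sphere. They hold
  for every value of \<open>D\<close>, with a cutoff \<open>s\<close> that satisfies \<open>D s \<le> 1\<close>.
\<close>

lemma ray_mass_bounds:
  obtains K where "\<And>e. e \<in> unit_sphere p \<Longrightarrow> exp (- K) \<le> ray_mass e \<and> ray_mass e \<le> exp K"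
proof -
  define s where "s = 1 / (D + 1)"
  have s: "0 < s" "D * s \<le> 1" using Delta3_nonneg by (auto simp: s_def field_simps)
  define U where "U = exp (D * s ^ 3 / 6) + cubic_remainder.tail p s 0"
  define K where "K = max (D * sqrt (real p) ^ 3) (ln U)"
  have "exp (- K) \<le> ray_mass e \<and> ray_mass e \<le> exp K" if e: "e \<in> unit_sphere p" for e
  proof -
    interpret R: cubic_remainder p D "\<psi> e" "slope e"
      by (rule cubic_remainder_ray[OF e])
    have mass: "ray_mass e = R.tilt_mass" by (simp add: R.tilt_mass_def ray_mass_def)
    have "exp (- K) \<le> exp (- R.mean)" using R.abs_mean_le by (simp add: K_def)
    also have "\<dots> \<le> ray_mass e" unfolding mass by (rule R.tilt_mass_ge)
    finally have 1: "exp (- K) \<le> ray_mass e" .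
    have "(\<integral>r. 1 * exp (- \<psi> e r) \<partial>chi p) \<le> exp (D * s ^ 3 / 6) * (\<integral>r. 1 \<partial>chi p) + (R.tail s 0 + 0 * R.tail s 0)"
      by (rule R.tilted_expectation[OF s]) auto
    then have U: "ray_mass e \<le> U" using R.prob_space by (simp add: ray_mass_def U_def)
    also have "U \<le> exp K"
    proof -
      have "0 < U" using U R.tilt_mass_pos unfolding mass by linarith
      then have "U = exp (ln U)" by simp
      also have "\<dots> \<le> exp K" by (simp only: exp_le_cancel_iff K_def max.cobounded2)
      finally show ?thesis .
    qed
    finally show ?thesis using 1 by simp
  qed
  then show ?thesis by (rule that)
qed

lemma integrable_ray:
  "integrable (sphere_law p) ray_mean" "integrable (sphere_law p) (\<lambda>e. ln (ray_mass e))" "integrable (sphere_law p) ray_mass"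
  and AE_ray_mass_pos: "AE e in sphere_law p. 0 < ray_mass e"
  and mass_pos: "0 < mass"
  and integral_ray: "(\<integral>e. ray_mean e \<partial>sphere_law p) = (\<integral>x. remainder x \<partial>std_gauss p)"
    "(\<integral>e. ray_mass e \<partial>sphere_law p) = mass"
proof -
  interpret sphere: prob_space "sphere_law p" by (rule prob_space_sphere_law)
  obtain K where K: "\<And>e. e \<in> unit_sphere p \<Longrightarrow> exp (- K) \<le> ray_mass e \<and> ray_mass e \<le> exp K"
    using ray_mass_bounds by blast
  have AE_K: "AE e in sphere_law p. exp (- K) \<le> ray_mass e \<and> ray_mass e \<le> exp K"
    using AE_sphere by eventually_elim (rule K)
  show pos: "AE e in sphere_law p. 0 < ray_mass e"
    using AE_K by eventually_elim (meson exp_gt_zero less_le_trans)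
  show i_mass: "integrable (sphere_law p) ray_mass"
  proof (rule sphere.integrable_const_bound)
    show "AE e in sphere_law p. norm (ray_mass e) \<le> exp K"
      using AE_K pos by eventually_elim simp
  qed measurable
  show "integrable (sphere_law p) (\<lambda>e. ln (ray_mass e))"
  proof (rule sphere.integrable_const_bound)
    show "AE e in sphere_law p. norm (ln (ray_mass e)) \<le> K"
      using AE_K pos
    proof eventually_elim
      case (elim e)
      have "- K \<le> ln (ray_mass e)" using elim by (simp add: ln_ge_iff)
      moreover have "ln (ray_mass e) \<le> K" using elim by (metis ln_exp ln_le_cancel_iff exp_gt_zero)
      ultimately show ?case by simp
    qed
  qed measurable
  note P1 = polar_integral[OF p_pos measurable_remainder integrable_remainder]
  have AE1: "AE e in sphere_law p. (\<integral>r. remainder (vscale p r e) \<partial>chi p) = ray_mean e"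
    using AE_sphere by eventually_elim (simp add: remainder_ray ray_mean_def)
  show "integrable (sphere_law p) ray_mean"
    using P1(1) by (rule Bochner_Integration.integrable_cong_AE_imp) (use AE1 in \<open>auto elim: eventually_mono\<close>)
  show "(\<integral>e. ray_mean e \<partial>sphere_law p) = (\<integral>x. remainder x \<partial>std_gauss p)"
    unfolding P1(2) by (rule integral_cong_AE) (use P1(1) AE1 in \<open>auto elim: eventually_mono\<close>)
  have m: "(\<lambda>x. exp (- remainder x)) \<in> borel_measurable (leb p)" by measurable
  note P2 = polar_integral[OF p_pos m std_tilt(1)]
  have AE2: "AE e in sphere_law p. (\<integral>r. exp (- remainder (vscale p r e)) \<partial>chi p) = ray_mass e"
    using AE_sphere by eventually_elim (simp add: remainder_ray ray_mass_def)
  show int_mass: "(\<integral>e. ray_mass e \<partial>sphere_law p) = mass"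
    unfolding mass_def P2(2) by (rule integral_cong_AE) (use P2(1) AE2 in \<open>auto elim: eventually_mono\<close>)
  have "0 < exp (- K)" by simp
  also have "exp (- K) = (\<integral>e. exp (- K) \<partial>sphere_law p)" using sphere.prob_space by simp
  also have "\<dots> \<le> (\<integral>e. ray_mass e \<partial>sphere_law p)"
    using AE_K by (intro integral_mono_AE i_mass) (auto elim: eventually_mono)
  finally show "0 < mass" by (simp add: int_mass)
qed

text \<open>
  The direction under \<open>f\<close> has density \<open>ray_mass / mass\<close> with respect to the uniform
  law, which is a tilt by \<open>- ln ray_mass\<close>.
\<close>

lemma KL_dir_eq: "KL_dir p \<phi> \<mu> W = ln mass - (\<integral>e. ln (ray_mass e) \<partial>sphere_law p)"
proof -
  let ?h = "\<lambda>e. - ln (ray_mass e)"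
  have st: "distr (gibbs p \<phi>) (leb p) (standardize p \<mu> W) = gibbs p (phi_std p \<phi> \<mu> S)"
    by (rule distr_gibbs_standardize(2)[OF inv_SW mu_in measurable_phi_std phi_standardize])
       (simp_all add: integrable_phi_std)
  have eq_h: "AE e in sphere_law p. exp (- ?h e) = ray_mass e"
    using AE_ray_mass_pos by eventually_elim simp
  have i_h: "integrable (sphere_law p) (\<lambda>e. exp (- ?h e))"
    using integrable_ray(3) by (rule Bochner_Integration.integrable_cong_AE_imp) (use eq_h in \<open>auto elim: eventually_mono\<close>)
  have E: "(\<integral>e. exp (- ?h e) \<partial>sphere_law p) = mass"
    unfolding integral_ray(2)[symmetric] by (rule integral_cong_AE) (use eq_h in auto)
  have "dir_law p \<mu> W (gibbs p \<phi>) = distr (density (std_gauss p) (\<lambda>x. ennreal (exp (- remainder x) / mass))) (leb p) (vdir p)"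
    by (subst dir_law_eq[OF mu_in]) (simp_all add: st std_tilt(2))
  also have "\<dots> = density (sphere_law p) (\<lambda>e. \<integral>\<^sup>+r. ennreal (exp (- remainder (vscale p r e)) / mass) \<partial>chi p)"
    by (rule dir_law_tilt[OF p_pos]) measurable
  also have "\<dots> = density (sphere_law p) (\<lambda>e. ennreal (exp (- ?h e) / mass))"
  proof (rule density_cong)
    interpret chi: prob_space "chi p" by (rule prob_space_chi[OF p_pos])
    show "(\<lambda>e. \<integral>\<^sup>+r. ennreal (exp (- remainder (vscale p r e)) / mass) \<partial>chi p) \<in> borel_measurable (sphere_law p)"
      by measurable
    show "AE e in sphere_law p. (\<integral>\<^sup>+r. ennreal (exp (- remainder (vscale p r e)) / mass) \<partial>chi p) = ennreal (exp (- ?h e) / mass)"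
      using AE_sphere eq_h
    proof eventually_elim
      case (elim e)
      interpret R: cubic_remainder p D "\<psi> e" "slope e"
        by (rule cubic_remainder_ray[OF elim(1)])
      have "(\<integral>\<^sup>+r. ennreal (exp (- remainder (vscale p r e)) / mass) \<partial>chi p)
         = (\<integral>\<^sup>+r. ennreal (exp (- \<psi> e r) / mass) \<partial>chi p)"
        using elim(1) by (simp add: remainder_ray)
      also have "\<dots> = ennreal (\<integral>r. exp (- \<psi> e r) / mass \<partial>chi p)"
        using R.integrable_exp mass_pos by (intro nn_integral_eq_integral) auto
      also have "\<dots> = ennreal (ray_mass e / mass)" by (simp add: ray_mass_def)
      finally show ?case using elim(2) by simp
    qed
  qed measurable
  finally have law: "dir_law p \<mu> W (gibbs p \<phi>) = density (sphere_law p) (\<lambda>e. ennreal (exp (- ?h e) / (\<integral>e. exp (- ?h e) \<partial>sphere_law p)))"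
    unfolding E .
  have "KL_dir p \<phi> \<mu> W = (\<integral>e. ?h e \<partial>sphere_law p) + ln (\<integral>e. exp (- ?h e) \<partial>sphere_law p)"
    unfolding KL_dir_def dir_g_eq law
    using integrable_ray(2) i_h by (intro KL_tilt prob_space_sphere_law) auto
  then show ?thesis unfolding E by simp
qed

lemma integral_KL_rad:
  "integrable (sphere_law p) (\<lambda>e. KL_rad p \<phi> \<mu> S W e)"
  "(\<integral>e. KL_rad p \<phi> \<mu> S W e \<partial>sphere_law p) = (\<integral>e. ray_mean e \<partial>sphere_law p) + (\<integral>e. ln (ray_mass e) \<partial>sphere_law p)"
proof -
  have i: "integrable (sphere_law p) (\<lambda>e. ray_mean e + ln (ray_mass e))"
    using integrable_ray by simp
  have AE: "AE e in sphere_law p. ray_mean e + ln (ray_mass e) = KL_rad p \<phi> \<mu> S W e"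
    using AE_sphere by eventually_elim (simp add: KL_rad_eq)
  show "integrable (sphere_law p) (\<lambda>e. KL_rad p \<phi> \<mu> S W e)"
    using i by (rule Bochner_Integration.integrable_cong_AE_imp) (use AE in \<open>auto elim: eventually_mono\<close>)
  have "(\<integral>e. KL_rad p \<phi> \<mu> S W e \<partial>sphere_law p) = (\<integral>e. ray_mean e + ln (ray_mass e) \<partial>sphere_law p)"
    by (rule integral_cong_AE) (use AE in \<open>auto elim: eventually_mono\<close>)
  also have "\<dots> = (\<integral>e. ray_mean e \<partial>sphere_law p) + (\<integral>e. ln (ray_mass e) \<partial>sphere_law p)"
    using integrable_ray by simp
  finally show "(\<integral>e. KL_rad p \<phi> \<mu> S W e \<partial>sphere_law p) = (\<integral>e. ray_mean e \<partial>sphere_law p) + (\<integral>e. ln (ray_mass e) \<partial>sphere_law p)" .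
qed

text \<open>
  The integral of \<open>ln ray_mass\<close> occurs in both parts with opposite signs, and the mean of
  \<open>ray_mean\<close> is that of the remainder.
\<close>

theorem KL_chain_rule:
  "KL (laplace_approx p \<phi> \<mu>) (gibbs p \<phi>) = KL_dir p \<phi> \<mu> W + (\<integral>e. KL_rad p \<phi> \<mu> S W e \<partial>dir_g p \<phi> \<mu> W)"
  unfolding dir_g_eq KL_total KL_dir_eq integral_KL_rad(2) integral_ray(1) by simp

definition "ray_average e = (\<integral>r. (phi_std p \<phi> \<mu> S (vscale p r e) - 1/2 * r\<^sup>2) \<partial>chi p)"

lemma measurable_ray_average [measurable]: "ray_average \<in> borel_measurable (leb p)"
proof -
  interpret chi: prob_space "chi p" by (rule prob_space_chi[OF p_pos])
  have "(\<lambda>(e, r). phi_std p \<phi> \<mu> S (vscale p r e) - 1/2 * r\<^sup>2) \<in> borel_measurable (leb p \<Otimes>\<^sub>M chi p)"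
    unfolding case_prod_beta by measurable
  then show ?thesis
    unfolding ray_average_def[abs_def] by (intro chi.borel_measurable_lebesgue_integral) simp
qed

text \<open>
  The two averages differ by the minimum of the potential.
\<close>

lemma variance_ray_average:
  "prob_space.variance (sphere_law p) ray_average
     = (\<integral>e. (ray_mean e - (\<integral>e. ray_mean e \<partial>sphere_law p))\<^sup>2 \<partial>sphere_law p)"
proof -
  interpret sphere: prob_space "sphere_law p" by (rule prob_space_sphere_law)
  have AE: "AE e in sphere_law p. ray_average e = ray_mean e + \<phi> \<mu>"
    using AE_sphere
  proof eventually_elim
    case (elim e)
    interpret R: cubic_remainder p D "\<psi> e" "slope e"
      by (rule cubic_remainder_ray[OF elim])
    have "ray_average e = (\<integral>r. \<psi> e r + \<phi> \<mu> \<partial>chi p)"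
      unfolding ray_average_def by (simp add: ray_remainder_def)
    then show ?case using R.prob_space by (simp add: ray_mean_def)
  qed
  have "(\<integral>e. ray_average e \<partial>sphere_law p) = (\<integral>e. ray_mean e + \<phi> \<mu> \<partial>sphere_law p)"
    by (rule integral_cong_AE) (use AE in auto)
  also have "\<dots> = (\<integral>e. ray_mean e \<partial>sphere_law p) + \<phi> \<mu>"
    using integrable_ray(1) sphere.prob_space by simp
  finally have m: "(\<integral>e. ray_average e \<partial>sphere_law p) = (\<integral>e. ray_mean e \<partial>sphere_law p) + \<phi> \<mu>" .
  show ?thesis unfolding m
    by (rule integral_cong_AE) (use AE in \<open>auto elim: eventually_mono\<close>)
qed

section \<open>Bounds for a small third derivative\<close>

context
  assumes small: "D * real p powr (3/2) \<le> 1 / 25000"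
begin

lemma small_cubic_remainder_ray:
  assumes e: "e \<in> unit_sphere p"
  shows "small_cubic_remainder p D (\<psi> e) (slope e)"
  using cubic_remainder_ray[OF e] small
  by (simp add: small_cubic_remainder_def small_cubic_remainder_axioms_def half_integer_powers[OF p_pos])

lemma KL_rad_bounds:
  assumes e: "e \<in> unit_sphere p"
  shows "0 \<le> KL_rad p \<phi> \<mu> S W e"
    and "KL_rad p \<phi> \<mu> S W e \<le> 1000 * (D\<^sup>2 * (real p)\<^sup>2)"
    and "KL_rad p \<phi> \<mu> S W e \<le> 1 / (2 * real p powr (2/3)) *
      (\<integral>r. r powr (4/3) * (vdot p e (grad p (phi_std p \<phi> \<mu> S) (vscale p r e)) - r)\<^sup>2 \<partial>rad_g p \<phi> \<mu> W)
      + 48000000 * (D ^ 3 * real p powr (5/2))"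
proof -
  interpret R: small_cubic_remainder p D "\<psi> e" "slope e"
    by (rule small_cubic_remainder_ray[OF e])
  have eq: "KL_rad p \<phi> \<mu> S W e = R.mean + ln R.tilt_mass"
    unfolding KL_rad_eq[OF e] by (simp add: ray_mean_def ray_mass_def R.mean_def R.tilt_mass_def)
  show "0 \<le> KL_rad p \<phi> \<mu> S W e" unfolding eq by (rule R.radial_KL_nonneg)
  show "KL_rad p \<phi> \<mu> S W e \<le> 1000 * (D\<^sup>2 * (real p)\<^sup>2)" unfolding eq by (rule R.radial_KL_le_square)
  show "KL_rad p \<phi> \<mu> S W e \<le> 1 / (2 * real p powr (2/3)) *
      (\<integral>r. r powr (4/3) * (vdot p e (grad p (phi_std p \<phi> \<mu> S) (vscale p r e)) - r)\<^sup>2 \<partial>rad_g p \<phi> \<mu> W)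
      + 48000000 * (D ^ 3 * real p powr (5/2))"
    unfolding eq rad_g_eq by (rule R.radial_KL_le_gradient)
qed

lemma scale_powers: "(D * sqrt (real p) ^ 3)\<^sup>2 = D\<^sup>2 * real p ^ 3" "(D * sqrt (real p) ^ 3) ^ 3 = D ^ 3 * real p powr (9/2)"
proof -
  have "(sqrt (real p) ^ 3)\<^sup>2 = (sqrt (real p) ^ 2) ^ 3" by (simp only: power_mult[symmetric]) simp
  then show "(D * sqrt (real p) ^ 3)\<^sup>2 = D\<^sup>2 * real p ^ 3" by (simp add: power_mult_distrib)
  show "(D * sqrt (real p) ^ 3) ^ 3 = D ^ 3 * real p powr (9/2)"
    by (simp add: power_mult_distrib half_integer_powers[OF p_pos] flip: power_mult)
qed

lemma KL_dir_expansion: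
  shows "\<bar>KL_dir p \<phi> \<mu> W - 1/2 * prob_space.variance (sphere_law p) ray_average\<bar> \<le> 40 * (D ^ 3 * real p powr (9/2))"
    and "prob_space.variance (sphere_law p) ray_average \<le> D\<^sup>2 * real p ^ 3"
proof -
  let ?d = "D * sqrt (real p) ^ 3"
  have d: "0 \<le> ?d" "?d \<le> 1 / 8"
    using Delta3_nonneg small half_integer_powers[OF p_pos] by simp_all
  have A_le: "AE e in sphere_law p. \<bar>ray_mean e\<bar> \<le> ?d"
    using AE_sphere
  proof eventually_elim
    case (elim e)
    interpret R: small_cubic_remainder p D "\<psi> e" "slope e"
      by (rule small_cubic_remainder_ray[OF elim])
    show ?case using R.abs_mean_le by (simp add: ray_mean_def R.mean_def)
  qed
  have H_le: "AE e in sphere_law p. \<bar>ray_mass e - 1 + ray_mean e\<bar> \<le> 2 * ?d\<^sup>2"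
    using AE_sphere
  proof eventually_elim
    case (elim e)
    interpret R: small_cubic_remainder p D "\<psi> e" "slope e"
      by (rule small_cubic_remainder_ray[OF elim])
    show ?case unfolding scale_powers using R.tilt_mass_expansion
      by (simp add: ray_mean_def ray_mass_def R.mean_def R.tilt_mass_def)
  qed
  have m: "ray_mean \<in> borel_measurable (sphere_law p)" "ray_mass \<in> borel_measurable (sphere_law p)"
    by measurable
  note L = log_partition_expansion[OF prob_space_sphere_law m d A_le H_le]
  show "\<bar>KL_dir p \<phi> \<mu> W - 1/2 * prob_space.variance (sphere_law p) ray_average\<bar> \<le> 40 * (D ^ 3 * real p powr (9/2))"
    unfolding KL_dir_eq variance_ray_average using L(1) unfolding scale_powers integral_ray(2) .
  show "prob_space.variance (sphere_law p) ray_average \<le> D\<^sup>2 * real p ^ 3"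
    unfolding variance_ray_average using L(2) unfolding scale_powers .
qed

lemma variance_ray_average_nonneg: "0 \<le> prob_space.variance (sphere_law p) ray_average"
  by (rule integral_nonneg_AE) simp

lemma cubic_le_square: "D ^ 3 * real p powr (9/2) \<le> D\<^sup>2 * real p ^ 3"
proof -
  let ?d = "D * sqrt (real p) ^ 3"
  have d: "0 \<le> ?d" "?d \<le> 1"
    using Delta3_nonneg small half_integer_powers[OF p_pos] by simp_all
  have "?d ^ 3 \<le> ?d\<^sup>2" by (rule power_decreasing) (use d in auto)
  then show ?thesis unfolding scale_powers .
qed

lemma abs_KL_dir_le: "\<bar>KL_dir p \<phi> \<mu> W\<bar> \<le> 41 * (D\<^sup>2 * real p ^ 3)"
proof -
  let ?V = "prob_space.variance (sphere_law p) ray_average"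
  have "\<bar>KL_dir p \<phi> \<mu> W\<bar> \<le> \<bar>KL_dir p \<phi> \<mu> W - 1/2 * ?V\<bar> + \<bar>1/2 * ?V\<bar>" by linarith
  also have "\<dots> \<le> 40 * (D\<^sup>2 * real p ^ 3) + D\<^sup>2 * real p ^ 3"
  proof (rule add_mono)
    show "\<bar>KL_dir p \<phi> \<mu> W - 1/2 * ?V\<bar> \<le> 40 * (D\<^sup>2 * real p ^ 3)"
      by (rule order.trans[OF KL_dir_expansion(1)]) (intro mult_left_mono cubic_le_square; simp)
    show "\<bar>1/2 * ?V\<bar> \<le> D\<^sup>2 * real p ^ 3"
      using KL_dir_expansion(2) variance_ray_average_nonneg by linarith
  qed
  also have "\<dots> = 41 * (D\<^sup>2 * real p ^ 3)" by simp
  finally show ?thesis .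
qed

text \<open>
  The average over \<open>r\<close> is the conditional expectation of the remainder given the direction. By
  Jensen's inequality it has a smaller second moment, and it has the same mean.
\<close>

lemma variance_ray_average_le_KL_var: "prob_space.variance (sphere_law p) ray_average \<le> KL_var p \<phi> \<mu>"
proof -
  interpret sphere: prob_space "sphere_law p" by (rule prob_space_sphere_law)
  have m: "(\<lambda>x. (remainder x)\<^sup>2) \<in> borel_measurable (leb p)" by measurable
  note P = polar_integral[OF p_pos m integrable_remainder_power]
  have AE: "AE e in sphere_law p. (ray_mean e)\<^sup>2 \<le> (\<integral>r. (remainder (vscale p r e))\<^sup>2 \<partial>chi p)"
    using AE_sphere
  proof eventually_elim
    case (elim e)
    interpret R: small_cubic_remainder p D "\<psi> e" "slope e"
      by (rule small_cubic_remainder_ray[OF elim])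
    show ?case using R.Jensen_square[OF R.integrable_psi R.integrable_psi_power[of 2]] elim
      by (simp add: ray_mean_def remainder_ray)
  qed
  have i: "integrable (sphere_law p) (\<lambda>e. (ray_mean e)\<^sup>2)"
    by (rule Bochner_Integration.integrable_bound[OF P(1)])
       (measurable, use AE in \<open>auto elim!: eventually_mono intro: order.trans[OF _ abs_ge_self]\<close>)
  have "prob_space.variance (sphere_law p) ray_average
     = (\<integral>e. (ray_mean e)\<^sup>2 \<partial>sphere_law p) - (\<integral>e. ray_mean e \<partial>sphere_law p)\<^sup>2"
    unfolding variance_ray_average by (rule sphere.variance_eq[OF integrable_ray(1) i])
  also have "(\<integral>e. (ray_mean e)\<^sup>2 \<partial>sphere_law p) \<le> (\<integral>x. (remainder x)\<^sup>2 \<partial>std_gauss p)"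
    unfolding P(2) by (rule integral_mono_AE[OF i P(1) AE])
  finally show ?thesis unfolding KL_var_eq integral_ray(1) by simp
qed

text \<open>
  By the chain rule; the radial part has an additional factor \<open>1 / p\<close>.
\<close>

lemma abs_KL_le: "\<bar>KL (laplace_approx p \<phi> \<mu>) (gibbs p \<phi>)\<bar> \<le> 1041 * (D\<^sup>2 * real p ^ 3)"
proof -
  interpret sphere: prob_space "sphere_law p" by (rule prob_space_sphere_law)
  let ?I = "\<integral>e. KL_rad p \<phi> \<mu> S W e \<partial>sphere_law p"
  have "0 \<le> ?I"
    by (rule integral_nonneg_AE) (use AE_sphere in \<open>eventually_elim, simp add: KL_rad_bounds(1)\<close>)
  moreover have "?I \<le> (\<integral>e. 1000 * (D\<^sup>2 * (real p)\<^sup>2) \<partial>sphere_law p)"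
    by (rule integral_mono_AE[OF integral_KL_rad(1)])
       (simp, use AE_sphere in \<open>eventually_elim, simp add: KL_rad_bounds(2)\<close>)
  moreover have "(\<integral>e. 1000 * (D\<^sup>2 * (real p)\<^sup>2) \<partial>sphere_law p) = 1000 * (D\<^sup>2 * (real p)\<^sup>2)"
    using sphere.prob_space by simp
  moreover have "D\<^sup>2 * (real p)\<^sup>2 \<le> D\<^sup>2 * real p ^ 3"
    using p_pos by (intro mult_left_mono power_increasing) auto
  ultimately have "\<bar>?I\<bar> \<le> 1000 * (D\<^sup>2 * real p ^ 3)" by linarith
  then show ?thesis unfolding KL_chain_rule dir_g_eq using abs_KL_dir_le by linarith
qed

text \<open>
  The constant is that of the gradient bound in \<open>KL_rad_bounds\<close>, the largest one.
\<close>

lemma asymptotic_bounds: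
  "(\<forall>e\<in>unit_sphere p.
      KL_rad p \<phi> \<mu> S W e \<le> 48000000 * (D ^ 2 * real p ^ 2)) \<and>
   (\<forall>e\<in>unit_sphere p.
      KL_rad p \<phi> \<mu> S W e
        \<le> 1 / (2 * real p powr (2/3)) *
            (\<integral>r. r powr (4/3) *
                 (vdot p e (grad p (phi_std p \<phi> \<mu> S) (vscale p r e)) - r)\<^sup>2
               \<partial>rad_g p \<phi> \<mu> W)
          + 48000000 * (D ^ 3 * real p powr (5/2))) \<and>
   \<bar>KL_dir p \<phi> \<mu> W\<bar> \<le> 48000000 * (D ^ 2 * real p ^ 3) \<and>
   \<bar>KL_dir p \<phi> \<mu> W
      - 1/2 * prob_space.variance (dir_g p \<phi> \<mu> W)
          (\<lambda>e. \<integral>r. (phi_std p \<phi> \<mu> S (vscale p r e) - 1/2 * r\<^sup>2) \<partial>rad_g p \<phi> \<mu> W)\<bar>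
     \<le> 48000000 * (D ^ 3 * real p powr (9/2)) \<and>
   KL_dir p \<phi> \<mu> W
     \<le> 1/2 * KL_var p \<phi> \<mu> + 48000000 * (D ^ 3 * real p powr (9/2)) \<and>
   \<bar>KL (laplace_approx p \<phi> \<mu>) (gibbs p \<phi>)\<bar>
     \<le> 48000000 * (D ^ 2 * real p ^ 3)"
proof -
  have weaken: "x \<le> 48000000 * y" if "x \<le> c * y" "c \<le> 48000000" "0 \<le> y" for x c y :: real
    using that by (meson mult_right_mono order.trans)
  have D0: "0 \<le> D" by (rule Delta3_nonneg)
  have var: "prob_space.variance (dir_g p \<phi> \<mu> W)
          (\<lambda>e. \<integral>r. (phi_std p \<phi> \<mu> S (vscale p r e) - 1/2 * r\<^sup>2) \<partial>rad_g p \<phi> \<mu> W)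
      = prob_space.variance (sphere_law p) ray_average"
    by (simp only: dir_g_eq rad_g_eq ray_average_def[abs_def])
  have expansion: "\<bar>KL_dir p \<phi> \<mu> W - 1/2 * prob_space.variance (sphere_law p) ray_average\<bar> \<le> 48000000 * (D ^ 3 * real p powr (9/2))"
    by (rule weaken[OF KL_dir_expansion(1)]) (use D0 in auto)
  have "KL_dir p \<phi> \<mu> W \<le> 1/2 * KL_var p \<phi> \<mu> + 48000000 * (D ^ 3 * real p powr (9/2))"
    using expansion variance_ray_average_le_KL_var by linarith
  then show ?thesis
    unfolding var using expansion KL_rad_bounds
    by (intro conjI ballI weaken[OF KL_rad_bounds(2)] weaken[OF abs_KL_dir_le] weaken[OF abs_KL_le]) auto
qed

end

end

section \<open>The radial and directional parts of the divergence\<close>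

theorem theorem5:
  shows
    "(\<forall>p \<phi> \<mu> Cov S W. laplace_setting p \<phi> \<mu> Cov S W \<longrightarrow>
        KL (laplace_approx p \<phi> \<mu>) (gibbs p \<phi>)
          = KL_dir p \<phi> \<mu> W + (\<integral>e. KL_rad p \<phi> \<mu> S W e \<partial>dir_g p \<phi> \<mu> W))
     \<and>
     (\<exists>C \<delta> :: real. 0 < \<delta> \<and>
       (\<forall>p \<phi> \<mu> Cov S W. laplace_setting p \<phi> \<mu> Cov S W \<and>
            Delta3 p \<phi> \<mu> S * real p powr (3/2) \<le> \<delta> \<longrightarrow>
          (\<forall>e\<in>unit_sphere p.
             KL_rad p \<phi> \<mu> S W e \<le> C * (Delta3 p \<phi> \<mu> S ^ 2 * real p ^ 2)) \<and>
          (\<forall>e\<in>unit_sphere p.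
             KL_rad p \<phi> \<mu> S W e
               \<le> 1 / (2 * real p powr (2/3)) *
                   (\<integral>r. r powr (4/3) *
                        (vdot p e (grad p (phi_std p \<phi> \<mu> S) (vscale p r e)) - r)\<^sup>2
                      \<partial>rad_g p \<phi> \<mu> W)
                 + C * (Delta3 p \<phi> \<mu> S ^ 3 * real p powr (5/2))) \<and>
          \<bar>KL_dir p \<phi> \<mu> W\<bar> \<le> C * (Delta3 p \<phi> \<mu> S ^ 2 * real p ^ 3) \<and>
          \<bar>KL_dir p \<phi> \<mu> W
             - 1/2 * prob_space.variance (dir_g p \<phi> \<mu> W)
                 (\<lambda>e. \<integral>r. (phi_std p \<phi> \<mu> S (vscale p r e) - 1/2 * r\<^sup>2) \<partial>rad_g p \<phi> \<mu> W)\<bar>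
            \<le> C * (Delta3 p \<phi> \<mu> S ^ 3 * real p powr (9/2)) \<and>
          KL_dir p \<phi> \<mu> W
            \<le> 1/2 * KL_var p \<phi> \<mu> + C * (Delta3 p \<phi> \<mu> S ^ 3 * real p powr (9/2)) \<and>
          \<bar>KL (laplace_approx p \<phi> \<mu>) (gibbs p \<phi>)\<bar>
            \<le> C * (Delta3 p \<phi> \<mu> S ^ 2 * real p ^ 3)))"
proof (rule conjI)
  show "\<forall>p \<phi> \<mu> Cov S W. laplace_setting p \<phi> \<mu> Cov S W \<longrightarrow>
        KL (laplace_approx p \<phi> \<mu>) (gibbs p \<phi>)
          = KL_dir p \<phi> \<mu> W + (\<integral>e. KL_rad p \<phi> \<mu> S W e \<partial>dir_g p \<phi> \<mu> W)"
    using KL_chain_rule by blast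
qed (rule exI[of _ 48000000], rule exI[of _ "1/25000"], rule conjI, simp, intro allI impI, elim conjE,
    erule (1) asymptotic_bounds)

end
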